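(* Let $G$ be a Lie group with Lie algebra $\mathfrak{g}$, endowed with the left-invariant Riemannian metric determined by an inner product $\mathbb{I}$ on $\mathfrak{g}$, and let $\{e_1,\dots,e_n\}$ be a basis of $\mathfrak{g}$. Let $\sigma>0$, $V:G\to\mathbb{R}$ a $\mathcal{C}^2$ potential function, $S\subset G$ a regular submanifold (the obstacle boundary), $x_0,\dots,x_N\in G$ distinct points not lying on $S$, $0=T_0<T_1<\dots<T_N=T$, $v_0\in T_{x_0}G$, $v_N\in T_{x_N}G$. Let $\overline{\Omega}$ be the associated set of admissible curves in $G$ and $$J(x)=\int_0^T\frac12\left(\Big\|\frac{D^2x}{dt^2}(t)\Big\|^2+\sigma\Big\|\frac{dx}{dt}(t)\Big\|^2+V(x(t))\right)dt .$$ If $x\in\overline{\Omega}$ is an extremizer of $J$ over $\overline{\Omega}$, then $x$ and its body velocity $v=\sum_{i=1}^nv_ie_i$ satisfy, on each interval $[T_{i-1},T_i]$, $i=1,\dots,N$, $$\begin{aligned}0={}&v'''+\stackrel{\mathfrak{g}}{\nabla}_{v''}v+3\stackrel{\mathfrak{g}}{\nabla}_{v'}v'+3\stackrel{\mathfrak{g}}{\nabla}_vv''+\stackrel{\mathfrak{g}}{\nabla}_{v'}\stackrel{\mathfrak{g}}{\nabla}_vv+2\stackrel{\mathfrak{g}}{\nabla}_v\stackrel{\mathfrak{g}}{\nabla}_{v'}v+3\stackrel{\mathfrak{g}}{\nabla}{}_v^2v'+\stackrel{\mathfrak{g}}{\nabla}{}_v^3v\\&+\mathfrak{R}(v',v)v+\mathfrak{R}(\stackrel{\mathfrak{g}}{\nabla}_vv,v)v-\sigma\stackrel{\mathfrak{g}}{\nabla}_vv-\sigma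 v'+\frac12T_xL_{x^{-1}}(\mathrm{grad}\,V(x))\end{aligned}$$ together with $$\frac{dx}{dt}(t)=T_eL_{x(t)}v(t)=\sum_{i=1}^nv_i(t)(e_i)_L(x(t)),$$ subject to $x(T_i)=x_i$ for $i=1,\dots,N-1$, $x(0)=x_0$, $x(T)=x_N$, $v(0)=T_{x_0}L_{x_0^{-1}}(v_0)$, $v(T)=T_{x_N}L_{x_N^{-1}}(v_N)$.
   Context: $L_g$ is left translation by $g$, $e$ the identity, $u_L$ the left-invariant vector field with $u_L(e)=u\in\mathfrak{g}$. The body velocity of a curve $x$ in $G$ is $v(t)=T_{x(t)}L_{x(t)^{-1}}\left(\frac{dx}{dt}(t)\right)\in\mathfrak{g}$; primes denote ordinary time derivatives in $\mathfrak{g}$. $\stackrel{\mathfrak{g}}{\nabla}:\mathfrak{g}\times\mathfrak{g}\to\mathfrak{g}$ is the restriction to $\mathfrak{g}$ of the Levi-Civita connection $\nabla$ of the metric, i.e. $\nabla_{w_L}u_L=(\stackrel{\mathfrak{g}}{\nabla}_wu)_L$; explicitly $\stackrel{\mathfrak{g}}{\nabla}_wu=\frac12[w,u]-\frac12\mathbb{I}^\sharp\left(\mathrm{ad}_w^*\mathbb{I}^\flat(u)+\mathrm{ad}_u^*\mathbb{I}^\flat(w)\right)$, where $\mathbb{I}^\flat:\mathfrak{g}\to\mathfrak{g}^*$, $\mathbb{I}^\sharp=(\mathbb{I}^\flat)^{-1}$ are the isomorphisms induced by $\mathbb{I}$ and $\mathrm{ad}^*_w$ is the dual map of $\mathrm{ad}_w$.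 $\stackrel{\mathfrak{g}}{\nabla}{}_v^k$ denotes $k$-fold application of $\stackrel{\mathfrak{g}}{\nabla}_v$. $\mathfrak{R}$ is the restriction to $\mathfrak{g}$ of the curvature tensor $R(X,Y)Z=\nabla_X\nabla_YZ-\nabla_Y\nabla_XZ-\nabla_{[X,Y]}Z$. $\frac{D^2x}{dt^2}$ is the covariant derivative along $x$ of $\frac{dx}{dt}$. $V$ is the artificial potential used to repel curves from the obstacle bounded by $S$. Admissible set $\overline{\Omega}$: all $\mathcal{C}^1$ curves $x:[0,T]\to G$ that are smooth on each $[T_{i-1},T_i]$, $i=1,\dots,N$, and satisfy $x(T_i)=x_i$ for $i=1,\dots,N-1$, $x(0)=x_0$, $x(T)=x_N$, $\frac{dx}{dt}(0)=v_0$, $\frac{dx}{dt}(T)=v_N$. Admissible variation of $x\in\overline{\Omega}$: a $\mathcal{C}^1$ map $\alpha:(-\epsilon,\epsilon)\times[0,T]\to G$, $(r,t)\mapsto\alpha_r(t)$, smooth on each $(-\epsilon,\epsilon)\times[T_{i-1},T_i]$, with $\alpha_0=x$ and $\alpha_r\in\overline{\Omega}$ for every $r$. A curve $x\in\overline{\Omega}$ is an extremizer of $J$ over $\overline{\Omega}$ if $\frac{d}{dr}J(\alpha_r)\big|_{r=0}=0$ for every admissible variation $\alpha$ of $x$. *)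

theory Defs
  imports "HOL-Analysis.Analysis" "HOL-Algebra.Group"
begin

section \<open>Differentiability of class \<open>C\<^sup>k\<close> in normed spaces\<close>

text \<open>
  All derivatives are taken within \<open>S\<close>: on an open set these are the ordinary derivatives, on a
  closed interval or a strip \<open>I \<times> [a,b]\<close> they are one-sided at the boundary. The definition is
  meant for such sets, where the derivative within \<open>S\<close> is unique.
\<close>

primrec Ck_on ::
  "nat \<Rightarrow> ('a::real_normed_vector \<Rightarrow> 'b::real_normed_vector) \<Rightarrow> 'a set \<Rightarrow> bool" where
  "Ck_on 0 f S \<longleftrightarrow> continuous_on S f"
| "Ck_on (Suc k) f S \<longleftrightarrow>
     (\<forall>x\<in>S. f differentiable (at x within S)) \<and>
     (\<forall>h. Ck_on k (\<lambda>x. frechet_derivative f (at x within S) h) S)"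

definition smooth_on :: "('a::real_normed_vector \<Rightarrow> 'b::real_normed_vector) \<Rightarrow> 'a set \<Rightarrow> bool" where
  "smooth_on f S \<longleftrightarrow> (\<forall>k. Ck_on k f S)"


section \<open>Smooth manifolds\<close>

text \<open>
  The points of a manifold form a Hausdorff, second countable type; its smooth structure is an
  atlas. A chart is a pair of its domain and its coordinate map (arbitrary off the domain).
\<close>

type_synonym ('m, 'e) chart = "'m set \<times> ('m \<Rightarrow> 'e)"

definition chart_inv :: "('m, 'e) chart \<Rightarrow> 'e \<Rightarrow> 'm" where
  "chart_inv c = inv_into (fst c) (snd c)"

definition is_chart :: "('m::topological_space, 'e::euclidean_space) chart \<Rightarrow> bool" where
  "is_chart c \<longleftrightarrow> open (fst c) \<and> open (snd c ` fst c) \<and>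
     homeomorphism (fst c) (snd c ` fst c) (snd c) (chart_inv c)"

definition compatible ::
  "('m::topological_space, 'e::euclidean_space) chart \<Rightarrow> ('m, 'e) chart \<Rightarrow> bool" where
  "compatible c d \<longleftrightarrow>
     smooth_on (snd d \<circ> chart_inv c) (snd c ` (fst c \<inter> fst d)) \<and>
     smooth_on (snd c \<circ> chart_inv d) (snd d ` (fst c \<inter> fst d))"

definition smooth_atlas ::
  "('m::{t2_space, second_countable_topology}, 'e::euclidean_space) chart set \<Rightarrow> bool" where
  "smooth_atlas A \<longleftrightarrow> (\<forall>c\<in>A. is_chart c) \<and> (\<Union>c\<in>A. fst c) = UNIV \<and> (\<forall>c\<in>A. \<forall>d\<in>A. compatible c d)"

definition std_atlas :: "('e, 'e) chart set" where
  "std_atlas = {(UNIV, \<lambda>x. x)}"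

definition prod_atlas :: "('m, 'e) chart set \<Rightarrow> ('n, 'f) chart set \<Rightarrow> ('m \<times> 'n, 'e \<times> 'f) chart set" where
  "prod_atlas A B = {(fst c \<times> fst d, map_prod (snd c) (snd d)) | c d. c \<in> A \<and> d \<in> B}"

definition Ck_map_on ::
  "nat \<Rightarrow> ('m::topological_space, 'e::real_normed_vector) chart set \<Rightarrow>
   ('n::topological_space, 'f::real_normed_vector) chart set \<Rightarrow> ('m \<Rightarrow> 'n) \<Rightarrow> 'm set \<Rightarrow> bool" where
  "Ck_map_on k A B f S \<longleftrightarrow> continuous_on S f \<and>
     (\<forall>c\<in>A. \<forall>d\<in>B. Ck_on k (snd d \<circ> f \<circ> chart_inv c) (snd c ` (S \<inter> fst c \<inter> f -` fst d)))"

definition smooth_map_on ::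
  "('m::topological_space, 'e::real_normed_vector) chart set \<Rightarrow>
   ('n::topological_space, 'f::real_normed_vector) chart set \<Rightarrow> ('m \<Rightarrow> 'n) \<Rightarrow> 'm set \<Rightarrow> bool" where
  "smooth_map_on A B f S \<longleftrightarrow> (\<forall>k. Ck_map_on k A B f S)"

text \<open>
  Embedded submanifolds, by slice charts of the maximal atlas; \<open>k\<close> is the dimension of \<open>S\<close>.
\<close>

definition regular_submanifold ::
  "('m::topological_space, 'e::euclidean_space) chart set \<Rightarrow> 'm set \<Rightarrow> bool" where
  "regular_submanifold A S \<longleftrightarrow>
     (\<exists>k. \<forall>p\<in>S. \<exists>c W. is_chart c \<and> (\<forall>d\<in>A. compatible c d) \<and> p \<in> fst c \<and>
        subspace W \<and> dim W = k \<and> snd c ` (S \<inter> fst c) = snd c ` fst c \<inter> W)"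

text \<open>
  Every point \<open>p\<close> gets a preferred chart around it. The tangent space at \<open>p\<close> is the model space
  \<open>'e\<close>, where \<open>w :: 'e\<close> stands for the tangent vector whose components in the preferred chart at
  \<open>p\<close> are \<open>w\<close>. Hence a vector field is a function \<open>'m \<Rightarrow> 'e\<close>; its components in a fixed chart
  are \<open>in_chart\<close> below.
\<close>

definition chart_at :: "('m, 'e) chart set \<Rightarrow> 'm \<Rightarrow> ('m, 'e) chart" where
  "chart_at A p = (SOME c. c \<in> A \<and> p \<in> fst c)"

definition tangent_map ::
  "('m, 'e::real_normed_vector) chart set \<Rightarrow> ('n, 'f::real_normed_vector) chart set \<Rightarrow>
   ('m \<Rightarrow> 'n) \<Rightarrow> 'm \<Rightarrow> 'e \<Rightarrow> 'f" where
  "tangent_map A B f p =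
     frechet_derivative (snd (chart_at B (f p)) \<circ> f \<circ> chart_inv (chart_at A p))
       (at (snd (chart_at A p) p))"

definition velocity ::
  "('m, 'e::real_normed_vector) chart set \<Rightarrow> real set \<Rightarrow> (real \<Rightarrow> 'm) \<Rightarrow> real \<Rightarrow> 'e" where
  "velocity A S x t = vector_derivative (\<lambda>s. snd (chart_at A (x t)) (x s)) (at t within S)"

definition in_chart ::
  "('m, 'e::real_normed_vector) chart set \<Rightarrow> ('m \<Rightarrow> 'e) \<Rightarrow> ('m, 'e) chart \<Rightarrow> 'e \<Rightarrow> 'e" where
  "in_chart A X c z = tangent_map A std_atlas (snd c) (chart_inv c z) (X (chart_inv c z))"

text \<open>Sign convention: \<open>[X,Y] f = X (Y f) - Y (X f)\<close>.\<close>

definition lie_bracket ::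
  "('m, 'e::real_normed_vector) chart set \<Rightarrow> ('m \<Rightarrow> 'e) \<Rightarrow> ('m \<Rightarrow> 'e) \<Rightarrow> 'm \<Rightarrow> 'e" where
  "lie_bracket A X Y p =
     (let c = chart_at A p; z = snd c p in
        frechet_derivative (in_chart A Y c) (at z) (X p) -
        frechet_derivative (in_chart A X c) (at z) (Y p))"


section \<open>Riemannian geometry\<close>

definition inner_product :: "('e::real_vector \<Rightarrow> 'e \<Rightarrow> real) \<Rightarrow> bool" where
  "inner_product h \<longleftrightarrow> bilinear h \<and> (\<forall>u w. h u w = h w u) \<and> (\<forall>u. u \<noteq> 0 \<longrightarrow> 0 < h u u)"

text \<open>A metric assigns to each point an inner product on the tangent space there.\<close>

type_synonym ('m, 'e) metric = "'m \<Rightarrow> 'e \<Rightarrow> 'e \<Rightarrow> real"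

definition metric_in_chart ::
  "('m, 'e::real_normed_vector) chart set \<Rightarrow> ('m, 'e) metric \<Rightarrow> ('m, 'e) chart \<Rightarrow> ('e, 'e) metric"
  where
  "metric_in_chart A g c z a b =
     (let T = tangent_map std_atlas A (chart_inv c) z in g (chart_inv c z) (T a) (T b))"

definition gradient ::
  "('m, 'e::real_normed_vector) chart set \<Rightarrow> ('m, 'e) metric \<Rightarrow> ('m \<Rightarrow> real) \<Rightarrow> 'm \<Rightarrow> 'e" where
  "gradient A g V p = (THE w. \<forall>u. g p w u = tangent_map A std_atlas V p u)"

text \<open>
  In a chart, an affine connection is \<open>\<nabla>\<^sub>a Y = DY(a) + \<Gamma>(a, Y)\<close>. It is torsion-free iff \<open>\<Gamma>\<close>
  is symmetric, and compatible with the metric \<open>h\<close> iff \<open>(D\<^sub>w h)(a,b) = h(\<Gamma>(w,a),b) + h(a,\<Gamma>(w,b))\<close>;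
  these two properties determine the Levi-Civita connection.
\<close>

definition levi_civita_symbol ::
  "('e::euclidean_space \<Rightarrow> 'e \<Rightarrow> real) \<Rightarrow> ('e \<Rightarrow> 'e \<Rightarrow> 'e \<Rightarrow> real) \<Rightarrow> ('e \<Rightarrow> 'e \<Rightarrow> 'e) \<Rightarrow> bool" where
  "levi_civita_symbol h dh \<Gamma> \<longleftrightarrow> bilinear \<Gamma> \<and> (\<forall>a b. \<Gamma> a b = \<Gamma> b a) \<and>
     (\<forall>w a b. dh w a b = h (\<Gamma> w a) b + h a (\<Gamma> w b))"

lemma inner_product_riesz:
  fixes h :: "'e::euclidean_space \<Rightarrow> 'e \<Rightarrow> real"
  assumes h: "inner_product h" and f: "linear f"
  shows "\<exists>!w. \<forall>u. h w u = f u"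
proof -
  have bil: "bilinear h" and pos: "\<And>u. u \<noteq> 0 \<Longrightarrow> 0 < h u u"
    using h by (auto simp: inner_product_def)
  have lin1: "linear (\<lambda>w. h w u)" and lin2: "linear (h w)" for u w
    using bil by (auto simp: bilinear_def)
  define F where "F = (\<lambda>w. \<Sum>b\<in>Basis. h w b *\<^sub>R b)"
  have linF: "linear F"
    unfolding F_def
    by (intro linearI)
      (simp_all add: bilinear_ladd[OF bil] bilinear_lmul[OF bil] scaleR_left_distrib sum.distrib
        scaleR_sum_right)
  have F_inner: "F w \<bullet> b = h w b" if "b \<in> Basis" for w b
    unfolding F_def using that by (rule inner_sum_left_Basis)
  have F_eqD: "h w u = g u" if "\<And>b. b \<in> Basis \<Longrightarrow> h w b = g b" "linear g" for w u g
    using linear_eq_on_span[OF lin2 that(2), of Basis w u] that(1) by auto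
  have "w = 0" if "F w = 0" for w
  proof (rule ccontr)
    assume "w \<noteq> 0"
    have "h w b = 0" if "b \<in> Basis" for b
      using F_inner[OF that, of w] \<open>F w = 0\<close> by simp
    then have "h w w = 0"
      using F_eqD[of w "\<lambda>_. 0" w] linear_zero by auto
    with pos[OF \<open>w \<noteq> 0\<close>] show False by simp
  qed
  then have "inj F" using linF by (simp add: linear_injective_0)
  then have "surj F" using linF by (simp add: linear_injective_imp_surjective)
  then obtain w where w: "F w = (\<Sum>b\<in>Basis. f b *\<^sub>R b)" by (metis surjD)
  have "h w b = f b" if "b \<in> Basis" for b
    using F_inner[OF that, of w] inner_sum_left_Basis[OF that, of f] w by simp
  then have ex: "\<forall>u. h w u = f u" using F_eqD f by blast
  moreover have "w' = w" if "\<forall>u. h w' u = f u" for w'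
  proof -
    have "F w' = F w" unfolding F_def using ex that by simp
    then show ?thesis using \<open>inj F\<close> by (simp add: inj_eq)
  qed
  ultimately show ?thesis by blast
qed

text \<open>
  Such a \<open>\<Gamma>\<close> exists, is unique and is given by Koszul's formula; so the definite description in
  \<open>christoffel\<close> below is proper.
\<close>

lemma levi_civita_symbol_iff_koszul:
  fixes h :: "'e::euclidean_space \<Rightarrow> 'e \<Rightarrow> real"
  assumes h: "inner_product h"
    and lin: "\<And>a b. linear (\<lambda>w. dh w a b)" "\<And>w b. linear (\<lambda>a. dh w a b)"
    and sym: "\<And>w a b. dh w a b = dh w b a"
  shows "levi_civita_symbol h dh \<Gamma> \<longleftrightarrow>
    (\<forall>a b w. h (\<Gamma> a b) w = (dh a b w + dh b a w - dh w a b) / 2)"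
proof
  have hs: "h u w = h w u" for u w using h by (auto simp: inner_product_def)
  {
    assume G: "levi_civita_symbol h dh \<Gamma>"
    show "\<forall>a b w. h (\<Gamma> a b) w = (dh a b w + dh b a w - dh w a b) / 2"
    proof (intro allI)
      fix a b w
      have m: "dh w a b = h (\<Gamma> w a) b + h a (\<Gamma> w b)" and s: "\<Gamma> a b = \<Gamma> b a" for w a b
        using G by (auto simp: levi_civita_symbol_def)
      show "h (\<Gamma> a b) w = (dh a b w + dh b a w - dh w a b) / 2"
        using m[of a b w] m[of b a w] m[of w a b] s[of a b] s[of a w] s[of b w]
          hs[of b "\<Gamma> a w"] hs[of a "\<Gamma> b w"] hs[of a "\<Gamma> w b"] by simp
    qed
  }
  assume K: "\<forall>a b w. h (\<Gamma> a b) w = (dh a b w + dh b a w - dh w a b) / 2"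
  have bil: "bilinear h" using h by (auto simp: inner_product_def)
  have eqI: "p = q" if "\<And>w. h p w = h q w" for p q
    using inner_product_riesz[OF h, of "h q"] that bil by (auto simp: bilinear_def)
  have lin3: "linear (\<lambda>b. dh w a b)" for w a
    using lin(2)[where w = w and b = a] unfolding sym[of w _ a] .
  have la: "dh (p + q) a b = dh p a b + dh q a b" "dh w (p + q) b = dh w p b + dh w q b"
    "dh w a (p + q) = dh w a p + dh w a q" for p q w a b
    by (rule linear_add[OF lin(1)], rule linear_add[OF lin(2)], rule linear_add[OF lin3])
  have ls: "dh (c *\<^sub>R p) a b = c * dh p a b" "dh w (c *\<^sub>R p) b = c * dh w p b"
    "dh w a (c *\<^sub>R p) = c * dh w a p" for c p w a b
    using linear_scale[OF lin(1), of c p a b] linear_scale[OF lin(2), of w c p b]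
      linear_scale[OF lin3, of w a c p] by simp_all
  have symG: "\<Gamma> a b = \<Gamma> b a" for a b
    by (rule eqI) (simp add: K sym[of w a b for w])
  have linG: "linear (\<Gamma> a)" for a
    by (intro linearI eqI) (simp_all add: K bilinear_ladd[OF bil] bilinear_lmul[OF bil] la ls field_simps)
  then have "bilinear \<Gamma>"
    unfolding bilinear_def using symG[of _ y for y] by simp
  moreover have "dh w a b = h (\<Gamma> w a) b + h a (\<Gamma> w b)" for w a b
    unfolding hs[of a "\<Gamma> w b"] K[rule_format] sym[of w b a] by (simp add: field_simps)
  ultimately show "levi_civita_symbol h dh \<Gamma>"
    unfolding levi_civita_symbol_def using symG by blast
qed

lemma levi_civita_symbol_ex1:
  fixes h :: "'e::euclidean_space \<Rightarrow> 'e \<Rightarrow> real" and dh :: "'e \<Rightarrow> 'e \<Rightarrow> 'e \<Rightarrow> real"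
  assumes h: "inner_product h"
    and lin: "\<And>a b. linear (\<lambda>w. dh w a b)" "\<And>w b. linear (\<lambda>a. dh w a b)"
    and sym: "\<And>w a b. dh w a b = dh w b a"
  shows "\<exists>!\<Gamma>. levi_civita_symbol h dh \<Gamma>"
proof -
  have lin3: "linear (\<lambda>b. dh w a b)" for w a
    using lin(2)[where w = w and b = a] unfolding sym[of w _ a] .
  have "linear (\<lambda>w. (dh a b w + dh b a w - dh w a b) / 2)" for a b
    by (intro linearI)
      (simp_all add: linear_add[OF lin(1)] linear_scale[OF lin(1)] linear_add[OF lin3]
        linear_scale[OF lin3] field_simps)
  then have ex1: "\<exists>!z. \<forall>w. h z w = (dh a b w + dh b a w - dh w a b) / 2" for a b
    by (rule inner_product_riesz[OF h])
  define \<Gamma> where "\<Gamma> a b = (THE z. \<forall>w. h z w = (dh a b w + dh b a w - dh w a b) / 2)" for a b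
  have \<Gamma>: "\<forall>w. h (\<Gamma> a b) w = (dh a b w + dh b a w - dh w a b) / 2" for a b
    unfolding \<Gamma>_def by (rule theI'[OF ex1])
  have "\<Gamma>' = \<Gamma>" if "\<forall>a b w. h (\<Gamma>' a b) w = (dh a b w + dh b a w - dh w a b) / 2" for \<Gamma>'
  proof (intro ext)
    fix a b
    show "\<Gamma>' a b = \<Gamma> a b" using ex1[of a b] \<Gamma>[of a b] that by blast
  qed
  then show ?thesis
    unfolding levi_civita_symbol_iff_koszul[OF h lin sym] using \<Gamma> by (intro ex1I[of _ \<Gamma>]) blast+
qed

definition christoffel ::
  "('m, 'e::euclidean_space) chart set \<Rightarrow> ('m, 'e) metric \<Rightarrow> ('m, 'e) chart \<Rightarrow> 'e \<Rightarrow> 'e \<Rightarrow> 'e \<Rightarrow> 'e"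
  where
  "christoffel A g c z =
     (THE \<Gamma>. levi_civita_symbol (metric_in_chart A g c z)
        (\<lambda>w a b. frechet_derivative (\<lambda>y. metric_in_chart A g c y a b) (at z) w) \<Gamma>)"

definition levi_civita ::
  "('m, 'e::euclidean_space) chart set \<Rightarrow> ('m, 'e) metric \<Rightarrow> ('m \<Rightarrow> 'e) \<Rightarrow> ('m \<Rightarrow> 'e) \<Rightarrow> 'm \<Rightarrow> 'e"
  where
  "levi_civita A g X Y p =
     (let c = chart_at A p; z = snd c p in
        frechet_derivative (in_chart A Y c) (at z) (X p) + christoffel A g c z (X p) (Y p))"

definition curvature ::
  "('m, 'e::euclidean_space) chart set \<Rightarrow> ('m, 'e) metric \<Rightarrow>
   ('m \<Rightarrow> 'e) \<Rightarrow> ('m \<Rightarrow> 'e) \<Rightarrow> ('m \<Rightarrow> 'e) \<Rightarrow> 'm \<Rightarrow> 'e" where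
  "curvature A g X Y Z p =
     levi_civita A g X (levi_civita A g Y Z) p - levi_civita A g Y (levi_civita A g X Z) p
     - levi_civita A g (lie_bracket A X Y) Z p"

text \<open>
  Covariant derivative of a vector field \<open>W\<close> along the curve \<open>x\<close>, where \<open>W s\<close> is a tangent vector
  at \<open>x s\<close>: in coordinates \<open>W' + \<Gamma>(x', W)\<close>.
\<close>

definition covariant_derivative_along ::
  "('m, 'e::euclidean_space) chart set \<Rightarrow> ('m, 'e) metric \<Rightarrow> real set \<Rightarrow> (real \<Rightarrow> 'm) \<Rightarrow>
   (real \<Rightarrow> 'e) \<Rightarrow> real \<Rightarrow> 'e" where
  "covariant_derivative_along A g S x W t =
     (let c = chart_at A (x t) in
        vector_derivative (\<lambda>s. tangent_map A std_atlas (snd c) (x s) (W s)) (at t within S)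
        + christoffel A g c (snd c (x t)) (velocity A S x t) (W t))"

definition acceleration ::
  "('m, 'e::euclidean_space) chart set \<Rightarrow> ('m, 'e) metric \<Rightarrow> real set \<Rightarrow> (real \<Rightarrow> 'm) \<Rightarrow> real \<Rightarrow> 'e"
  where
  "acceleration A g S x = covariant_derivative_along A g S x (velocity A S x)"


section \<open>Lie groups\<close>

record ('g, 'e) lie_group_structure = "'g monoid" +
  atlas :: "('g, 'e) chart set"

definition lie_group ::
  "('g::{t2_space, second_countable_topology}, 'e::euclidean_space) lie_group_structure \<Rightarrow> bool" where
  "lie_group G \<longleftrightarrow> group G \<and> carrier G = UNIV \<and> smooth_atlas (atlas G) \<and>
     smooth_map_on (prod_atlas (atlas G) (atlas G)) (atlas G) (\<lambda>(x, y). x \<otimes>\<^bsub>G\<^esub> y) UNIV \<and>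
     smooth_map_on (atlas G) (atlas G) (\<lambda>x. inv\<^bsub>G\<^esub> x) UNIV"

text \<open>The Lie algebra is the tangent space at \<open>\<one>\<^bsub>G\<^esub>\<close>, so its elements are of type \<open>'e\<close>.\<close>

definition left_translation :: "('g, 'e) lie_group_structure \<Rightarrow> 'g \<Rightarrow> 'g \<Rightarrow> 'g" where
  "left_translation G a = (\<lambda>x. a \<otimes>\<^bsub>G\<^esub> x)"

text \<open>\<open>T_left G a p\<close> is \<open>T\<^sub>p L\<^sub>a\<close>, from the tangent space at \<open>p\<close> to the one at \<open>a p\<close>.\<close>

definition T_left ::
  "('g, 'e::real_normed_vector) lie_group_structure \<Rightarrow> 'g \<Rightarrow> 'g \<Rightarrow> 'e \<Rightarrow> 'e" where
  "T_left G a p = tangent_map (atlas G) (atlas G) (left_translation G a) p"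

definition left_invariant_field ::
  "('g, 'e::real_normed_vector) lie_group_structure \<Rightarrow> 'e \<Rightarrow> 'g \<Rightarrow> 'e" where
  "left_invariant_field G u = (\<lambda>a. T_left G a \<one>\<^bsub>G\<^esub> u)"

definition left_invariant_metric ::
  "('g, 'e::real_normed_vector) lie_group_structure \<Rightarrow> ('e \<Rightarrow> 'e \<Rightarrow> real) \<Rightarrow> ('g, 'e) metric" where
  "left_invariant_metric G I p a b = I (T_left G (inv\<^bsub>G\<^esub> p) p a) (T_left G (inv\<^bsub>G\<^esub> p) p b)"

definition body_velocity ::
  "('g, 'e::real_normed_vector) lie_group_structure \<Rightarrow> real set \<Rightarrow> (real \<Rightarrow> 'g) \<Rightarrow> real \<Rightarrow> 'e" where
  "body_velocity G S x t = T_left G (inv\<^bsub>G\<^esub> (x t)) (x t) (velocity (atlas G) S x t)"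

definition lie_algebra_connection ::
  "('g, 'e::euclidean_space) lie_group_structure \<Rightarrow> ('e \<Rightarrow> 'e \<Rightarrow> real) \<Rightarrow> 'e \<Rightarrow> 'e \<Rightarrow> 'e" where
  "lie_algebra_connection G I w u =
     levi_civita (atlas G) (left_invariant_metric G I)
       (left_invariant_field G w) (left_invariant_field G u) \<one>\<^bsub>G\<^esub>"

definition lie_algebra_curvature ::
  "('g, 'e::euclidean_space) lie_group_structure \<Rightarrow> ('e \<Rightarrow> 'e \<Rightarrow> real) \<Rightarrow> 'e \<Rightarrow> 'e \<Rightarrow> 'e \<Rightarrow> 'e" where
  "lie_algebra_curvature G I u v w =
     curvature (atlas G) (left_invariant_metric G I)
       (left_invariant_field G u) (left_invariant_field G v) (left_invariant_field G w) \<one>\<^bsub>G\<^esub>"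


section \<open>The variational obstacle avoidance problem\<close>

text \<open>
  Curves are functions on all of \<open>real\<close> of which only the values on \<open>{0..\<tau> N}\<close> matter; the points
  are \<open>X 0, \<dots>, X N\<close>, the times \<open>\<tau> 0 < \<dots> < \<tau> N\<close>.
\<close>

definition admissible_curves ::
  "('g::topological_space, 'e::euclidean_space) chart set \<Rightarrow> nat \<Rightarrow> (nat \<Rightarrow> real) \<Rightarrow> (nat \<Rightarrow> 'g) \<Rightarrow>
   'e \<Rightarrow> 'e \<Rightarrow> (real \<Rightarrow> 'g) set" where
  "admissible_curves A N \<tau> X v0 vN =
     {x. Ck_map_on 1 std_atlas A x {0..\<tau> N} \<and>
         (\<forall>i\<in>{1..N}. smooth_map_on std_atlas A x {\<tau> (i - 1)..\<tau> i}) \<and>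
         (\<forall>i\<in>{1..<N}. x (\<tau> i) = X i) \<and> x 0 = X 0 \<and> x (\<tau> N) = X N \<and>
         velocity A {0..\<tau> N} x 0 = v0 \<and> velocity A {0..\<tau> N} x (\<tau> N) = vN}"

definition admissible_variation ::
  "('g::topological_space, 'e::euclidean_space) chart set \<Rightarrow> nat \<Rightarrow> (nat \<Rightarrow> real) \<Rightarrow> (nat \<Rightarrow> 'g) \<Rightarrow>
   'e \<Rightarrow> 'e \<Rightarrow> (real \<Rightarrow> 'g) \<Rightarrow> (real \<Rightarrow> real \<Rightarrow> 'g) \<Rightarrow> bool" where
  "admissible_variation A N \<tau> X v0 vN x \<alpha> \<longleftrightarrow>
     (\<exists>\<epsilon>>0. Ck_map_on 1 std_atlas A (\<lambda>(r, t). \<alpha> r t) ({-\<epsilon><..<\<epsilon>} \<times> {0..\<tau> N}) \<and>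
        (\<forall>i\<in>{1..N}. smooth_map_on std_atlas A (\<lambda>(r, t). \<alpha> r t) ({-\<epsilon><..<\<epsilon>} \<times> {\<tau> (i - 1)..\<tau> i})) \<and>
        (\<forall>t\<in>{0..\<tau> N}. \<alpha> 0 t = x t) \<and>
        (\<forall>r\<in>{-\<epsilon><..<\<epsilon>}. \<alpha> r \<in> admissible_curves A N \<tau> X v0 vN))"

text \<open>
  For admissible curves the acceleration may fail to exist at the finitely many interior times
  \<open>\<tau> i\<close>, which does not affect the integral.
\<close>

definition cost ::
  "('g, 'e::euclidean_space) chart set \<Rightarrow> ('g, 'e) metric \<Rightarrow> real \<Rightarrow> ('g \<Rightarrow> real) \<Rightarrow> real \<Rightarrow>
   (real \<Rightarrow> 'g) \<Rightarrow> real" where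
  "cost A g \<sigma> V T x =
     integral {0..T} (\<lambda>t. 1/2 *
       (g (x t) (acceleration A g {0..T} x t) (acceleration A g {0..T} x t)
        + \<sigma> * g (x t) (velocity A {0..T} x t) (velocity A {0..T} x t)
        + V (x t)))"

definition extremizer ::
  "('g::topological_space, 'e::euclidean_space) chart set \<Rightarrow> ('g, 'e) metric \<Rightarrow> real \<Rightarrow> ('g \<Rightarrow> real) \<Rightarrow>
   nat \<Rightarrow> (nat \<Rightarrow> real) \<Rightarrow> (nat \<Rightarrow> 'g) \<Rightarrow> 'e \<Rightarrow> 'e \<Rightarrow> (real \<Rightarrow> 'g) \<Rightarrow> bool" where
  "extremizer A g \<sigma> V N \<tau> X v0 vN x \<longleftrightarrow>
     x \<in> admissible_curves A N \<tau> X v0 vN \<and>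
     (\<forall>\<alpha>. admissible_variation A N \<tau> X v0 vN x \<alpha> \<longrightarrow>
        ((\<lambda>r. cost A g \<sigma> V (\<tau> N) (\<alpha> r)) has_real_derivative 0) (at 0))"

end

theory Submission
  imports Defs
begin

text \<open>
  Everything is moved to the Lie algebra. If a curve \<open>x\<close> with body velocity \<open>v\<close> is varied, and the
  variation field is \<open>\<xi>\<close> after left translation to the identity, then \<open>v\<close> varies by \<open>\<xi>' + [v, \<xi>]\<close>. The
  covariant derivative along \<open>x\<close> becomes \<open>D = d/dt + \<nabla>\<^sub>v\<close>, with the bilinear map \<open>\<nabla>\<close> on the Lie algebra
  that Koszul's formula attaches to the bracket and to the inner product. So the acceleration becomes
  \<open>a = v' + \<nabla>\<^sub>v v\<close>, and its variation is \<open>D\<^sup>2\<xi> + R(\<xi>, v) v - \<nabla>\<^sub>\<xi> a\<close>, whose last term is orthogonal to \<open>a\<close>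
  because \<open>\<nabla>\<^sub>\<xi>\<close> is skew. Two integrations by parts and the self-adjointness of \<open>\<xi> \<mapsto> R(\<xi>, v) v\<close> turn the
  first variation of the cost into the integral of the inner product of \<open>\<xi>\<close> with
  \<open>D\<^sup>2a + R(a, v) v - \<sigma> a\<close> plus half of the left-translated gradient; expanding \<open>D\<^sup>2a\<close> gives the
  differential equation of the theorem. Variations \<open>\<xi> = \<phi> w\<close> with a bump function \<open>\<phi>\<close> that is supported
  inside a smooth piece show that this expression vanishes there, and it extends to the end points of
  the piece by continuity.

  The purely algebraic part takes place in the locale \<open>metric_lie_algebra\<close>
  (\<open>variation_of_acceleration\<close>, \<open>R_self_adjoint\<close>, \<open>first_variation_by_parts\<close>). The analysis takes place
  in a single chart, where the left-invariant fields are the columns of a smooth matrix \<open>E\<close> with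
  smooth inverse \<open>F\<close>: the bracket relation for \<open>E\<close> yields the Jacobi identity (\<open>br_jacobi\<close>) and,
  together with the inner product, the Christoffel symbols (\<open>christoffel_frame\<close>) and the first variation
  (\<open>first_variation\<close>).

  That left-invariant fields have these coordinate properties in every chart is a consequence of
  the smoothness of the multiplication (\<open>frame_bracket\<close>). It identifies the Levi-Civita connection and
  the curvature with \<open>\<nabla>\<close> and \<open>R\<close> (\<open>lie_algebra_connection_eq\<close>, \<open>lie_algebra_curvature_eq\<close>) and the integrand
  of the cost with an expression in \<open>v\<close> and \<open>v'\<close> (\<open>integrand_body\<close>), which does not depend on the
  charts chosen along the curve. The bump variations are shown to be admissible in
  \<open>\<alpha>_admissible\<close>, and \<open>euler_lagrange_interior\<close> evaluates the stationarity condition on them.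
\<close>

section \<open>Calculus of \<open>C\<^sup>k\<close> maps\<close>

text \<open>
  Approaching each point along every coordinate direction makes derivatives within the set unique.
  Unlike openness, the property covers closed intervals and strips, and it is inherited by products
  and by relatively open subsets.
\<close>

definition fat :: "'a::euclidean_space set \<Rightarrow> bool" where
  "fat S \<longleftrightarrow> (\<forall>x\<in>S. \<forall>i\<in>Basis. \<forall>e>0. \<exists>d. 0 < \<bar>d\<bar> \<and> \<bar>d\<bar> < e \<and> x + d *\<^sub>R i \<in> S)"

lemma fat_unique:
  fixes f :: "'a::euclidean_space \<Rightarrow> 'b::real_normed_vector"
  assumes "fat S" "x \<in> S" "(f has_derivative f') (at x within S)" "(f has_derivative f'') (at x within S)"
  shows "f' = f''"
  using frechet_derivative_unique_within[OF assms(3,4)] assms(1,2) by (auto simp: fat_def)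

lemma fat_frechet_eq:
  fixes f :: "'a::euclidean_space \<Rightarrow> 'b::real_normed_vector"
  assumes "fat S" "x \<in> S" "(f has_derivative f') (at x within S)"
  shows "frechet_derivative f (at x within S) = f'"
  using fat_unique[OF assms(1,2) _ assms(3)] assms(3) frechet_derivative_works differentiableI
  by blast

lemma fat_Int_open:
  fixes S :: "'a::euclidean_space set"
  assumes "fat S" "open U" shows "fat (S \<inter> U)"
  unfolding fat_def
proof (intro ballI allI impI)
  fix x i :: 'a and e :: real
  assume x: "x \<in> S \<inter> U" and i: "i \<in> Basis" and e: "e > 0"
  obtain r where r: "r > 0" "ball x r \<subseteq> U" using assms(2) x openE by blast
  obtain d where d: "0 < \<bar>d\<bar>" "\<bar>d\<bar> < min e r" "x + d *\<^sub>R i \<in> S"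
    using assms(1) x i e r(1) unfolding fat_def by (metis IntD1 min_less_iff_conj)
  then have "x + d *\<^sub>R i \<in> ball x r" using i by (simp add: dist_norm)
  then show "\<exists>d. 0 < \<bar>d\<bar> \<and> \<bar>d\<bar> < e \<and> x + d *\<^sub>R i \<in> S \<inter> U"
    using d r by (intro exI[of _ d]) auto
qed

lemma fat_UNIV: "fat (UNIV :: 'a::euclidean_space set)"
  unfolding fat_def
proof (intro ballI allI impI)
  fix x i :: 'a and e :: real assume "e > 0"
  then show "\<exists>d. 0 < \<bar>d\<bar> \<and> \<bar>d\<bar> < e \<and> x + d *\<^sub>R i \<in> UNIV" by (intro exI[of _ "e/2"]) auto
qed

lemma fat_open: "open U \<Longrightarrow> fat U"
  using fat_Int_open[OF fat_UNIV, of U] by simp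

lemma fat_Icc: "a < b \<Longrightarrow> fat {a..b::real}"
  unfolding fat_def
proof (intro ballI allI impI)
  fix x i e :: real
  assume ab: "a < b" and x: "x \<in> {a..b}" and i: "i \<in> Basis" and e: "e > 0"
  then have [simp]: "i = 1" by simp
  show "\<exists>d. 0 < \<bar>d\<bar> \<and> \<bar>d\<bar> < e \<and> x + d *\<^sub>R i \<in> {a..b}"
  proof (cases "x < b")
    case True
    then show ?thesis using x e by (intro exI[of _ "min e (b - x) / 2"]) (auto simp: min_def field_simps)
  next
    case False
    then show ?thesis using x e ab by (intro exI[of _ "- min e (x - a) / 2"]) (auto simp: min_def field_simps)
  qed
qed

lemma fat_Times: assumes "fat S" "fat T" shows "fat (S \<times> T)"
  unfolding fat_def
proof (intro ballI allI impI)
  fix x i :: "'a \<times> 'b" and e :: real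
  assume x: "x \<in> S \<times> T" and i: "i \<in> Basis" and e: "e > 0"
  from i consider j where "i = (j, 0)" "j \<in> Basis" | j where "i = (0, j)" "j \<in> Basis"
    unfolding Basis_prod_def by auto
  then show "\<exists>d. 0 < \<bar>d\<bar> \<and> \<bar>d\<bar> < e \<and> x + d *\<^sub>R i \<in> S \<times> T"
  proof cases
    case 1
    then obtain d where "0 < \<bar>d\<bar>" "\<bar>d\<bar> < e" "fst x + d *\<^sub>R j \<in> S"
      using assms(1) x e unfolding fat_def by (metis mem_Times_iff)
    then show ?thesis using 1 x by (intro exI[of _ d]) (auto simp: mem_Times_iff)
  next
    case 2
    then obtain d where "0 < \<bar>d\<bar>" "\<bar>d\<bar> < e" "snd x + d *\<^sub>R j \<in> T"
      using assms(2) x e unfolding fat_def by (metis mem_Times_iff)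
    then show ?thesis using 2 x by (intro exI[of _ d]) (auto simp: mem_Times_iff)
  qed
qed

lemma fat_not_bot:
  fixes S :: "real set" assumes "fat S" "x \<in> S" shows "at x within S \<noteq> bot"
proof -
  have "x islimpt S"
    unfolding islimpt_approachable
  proof (intro allI impI)
    fix e :: real assume "e > 0"
    then obtain d where "0 < \<bar>d\<bar>" "\<bar>d\<bar> < e" "x + d *\<^sub>R 1 \<in> S"
      using assms unfolding fat_def by force
    then show "\<exists>x'\<in>S. x' \<noteq> x \<and> dist x' x < e" by (intro bexI[of _ "x + d"]) (auto simp: dist_real_def)
  qed
  then show ?thesis by (simp add: trivial_limit_within)
qed

lemma frechet_derivative_cong_within:
  assumes "x \<in> S" "\<And>y. y \<in> S \<Longrightarrow> f y = g y"
  shows "frechet_derivative f (at x within S) = frechet_derivative g (at x within S)"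
proof -
  have "(f has_derivative D) (at x within S) \<longleftrightarrow> (g has_derivative D) (at x within S)" for D
    using assms has_derivative_transform by metis
  then show ?thesis unfolding frechet_derivative_def by simp
qed

lemma at_within_Int_open: "x \<in> U \<Longrightarrow> open U \<Longrightarrow> at x within (S \<inter> U) = at x within S"
  by (rule at_within_nhd[of _ U]) auto

lemma Ck_on_cong:
  assumes "Ck_on k f S" "\<And>x. x \<in> S \<Longrightarrow> f x = g x" shows "Ck_on k g S"
  using assms
proof (induction k arbitrary: f g)
  case 0 then show ?case by (simp cong: continuous_on_cong)
next
  case (Suc k)
  have d: "g differentiable (at x within S)" if "x \<in> S" for x
    using Suc.prems that has_derivative_transform[of x S g f] unfolding differentiable_def
    by (metis Ck_on.simps(2) differentiable_def)
  have "Ck_on k (\<lambda>x. frechet_derivative g (at x within S) h) S" for h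
    by (rule Suc.IH[of "\<lambda>x. frechet_derivative f (at x within S) h"])
      (use Suc.prems frechet_derivative_cong_within[of _ S f g] in auto)
  then show ?case using d by simp
qed

lemma Ck_on_Suc_imp: "Ck_on (Suc k) f S \<Longrightarrow> Ck_on k f S"
proof (induction k arbitrary: f)
  case 0 then show ?case
    by (auto simp: continuous_on_eq_continuous_within intro!: differentiable_imp_continuous_within)
next
  case (Suc k)
  then show ?case by (metis Ck_on.simps(2))
qed

lemma Ck_on_le: "Ck_on k f S \<Longrightarrow> j \<le> k \<Longrightarrow> Ck_on j f S"
proof (induction k)
  case (Suc k) then show ?case using Ck_on_Suc_imp[of k f S] by (auto simp only: le_Suc_eq)
qed simp

lemma Ck_on_continuous: "Ck_on k f S \<Longrightarrow> continuous_on S f"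
  using Ck_on_le[of k f S 0] by simp

text \<open>
  The filter \<open>at x within S\<close> only sees a neighbourhood of \<open>x\<close>, so differentiability of class \<open>C\<^sup>k\<close> can be
  checked in charts around the single points.
\<close>

lemma Ck_on_local:
  assumes "\<And>x. x \<in> S \<Longrightarrow> \<exists>U. open U \<and> x \<in> U \<and> Ck_on k f (S \<inter> U)"
  shows "Ck_on k f S"
  using assms
proof (induction k arbitrary: f)
  case 0
  show ?case unfolding Ck_on.simps continuous_on_eq_continuous_within
  proof
    fix x assume x: "x \<in> S"
    then obtain U where U: "open U" "x \<in> U" "continuous_on (S \<inter> U) f" using 0 by auto
    then have "continuous (at x within S \<inter> U) f"
      using x continuous_on_eq_continuous_within by blast
    then show "continuous (at x within S) f" using U at_within_Int_open by metis
  qed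
next
  case (Suc k)
  have d: "f differentiable (at x within S)" if "x \<in> S" for x
    using Suc.prems[OF that] that by (auto simp: at_within_Int_open)
  have "Ck_on k (\<lambda>x. frechet_derivative f (at x within S) h) S" for h
  proof (rule Suc.IH)
    fix x assume x: "x \<in> S"
    then obtain U where U: "open U" "x \<in> U" "Ck_on (Suc k) f (S \<inter> U)" using Suc.prems by blast
    then have "Ck_on k (\<lambda>x. frechet_derivative f (at x within S \<inter> U) h) (S \<inter> U)" by simp
    then have "Ck_on k (\<lambda>x. frechet_derivative f (at x within S) h) (S \<inter> U)"
      by (rule Ck_on_cong) (use U in \<open>auto simp: at_within_Int_open\<close>)
    then show "\<exists>U. open U \<and> x \<in> U \<and> Ck_on k (\<lambda>x. frechet_derivative f (at x within S) h) (S \<inter> U)"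
      using U by blast
  qed
  then show ?case using d by simp
qed

lemma Ck_on_has_derivative:
  assumes "Ck_on (Suc k) f S" "x \<in> S"
  shows "(f has_derivative frechet_derivative f (at x within S)) (at x within S)"
  using assms by (auto simp: frechet_derivative_works)

text \<open>
  As derivatives within fat sets are unique, any explicit derivative may replace the one selected
  in the definition of \<open>Ck_on\<close>.
\<close>

lemma Ck_on_SucI:
  fixes f :: "'a::euclidean_space \<Rightarrow> 'b::real_normed_vector"
  assumes "fat S" "\<And>x. x \<in> S \<Longrightarrow> (f has_derivative f' x) (at x within S)"
    and "\<And>h. Ck_on k (\<lambda>x. f' x h) S"
  shows "Ck_on (Suc k) f S"
proof -
  have "Ck_on k (\<lambda>x. frechet_derivative f (at x within S) h) S" for h
    by (rule Ck_on_cong[OF assms(3)[of h]]) (simp add: fat_frechet_eq[OF assms(1) _ assms(2)])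
  then show ?thesis using assms(2) by (auto simp: differentiable_def)
qed

lemma Ck_on_subset:
  fixes f :: "'a::euclidean_space \<Rightarrow> 'b::real_normed_vector"
  assumes "Ck_on k f S" "T \<subseteq> S" "fat T" shows "Ck_on k f T"
  using assms(1)
proof (induction k arbitrary: f)
  case 0 then show ?case using assms(2) by (auto intro: continuous_on_subset)
next
  case (Suc k)
  show ?case
  proof (rule Ck_on_SucI[OF assms(3)])
    show "(f has_derivative frechet_derivative f (at x within S)) (at x within T)" if "x \<in> T" for x
      using Ck_on_has_derivative[OF Suc.prems, of x] that assms(2) has_derivative_subset by blast
    show "Ck_on k (\<lambda>x. frechet_derivative f (at x within S) h) T" for h
      using Suc by simp
  qed
qed

lemma Ck_on_const:
  fixes c :: "'b::real_normed_vector"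
  assumes "fat (S :: 'a::euclidean_space set)" shows "Ck_on k (\<lambda>x. c) S"
proof (induction k arbitrary: c)
  case 0 show ?case by simp
next
  case (Suc k)
  show ?case by (rule Ck_on_SucI[OF assms has_derivative_const]) (rule Suc.IH)
qed

lemma Ck_on_bounded_linear:
  fixes f :: "'a::euclidean_space \<Rightarrow> 'b::real_normed_vector"
  assumes "bounded_linear L" "fat S" "Ck_on k f S" shows "Ck_on k (\<lambda>x. L (f x)) S"
  using assms(3)
proof (induction k arbitrary: f)
  case 0 then show ?case
    using bounded_linear.continuous_on[OF assms(1)] by simp
next
  case (Suc k)
  show ?case
    by (rule Ck_on_SucI[OF assms(2) bounded_linear.has_derivative[OF assms(1)]])
      (use Suc in \<open>auto intro!: Ck_on_has_derivative\<close>)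
qed

lemma Ck_on_linear:
  fixes L :: "'a::euclidean_space \<Rightarrow> 'b::real_normed_vector"
  assumes "bounded_linear L" "fat S" shows "Ck_on k L S"
proof (cases k)
  case 0 then show ?thesis by (simp add: assms linear_continuous_on)
next
  case (Suc j)
  show ?thesis unfolding Suc
    by (rule Ck_on_SucI[OF assms(2) bounded_linear_imp_has_derivative[OF assms(1)] Ck_on_const[OF assms(2)]])
qed

lemma Ck_on_add:
  fixes f :: "'a::euclidean_space \<Rightarrow> 'b::real_normed_vector"
  assumes "fat S" "Ck_on k f S" "Ck_on k g S" shows "Ck_on k (\<lambda>x. f x + g x) S"
  using assms(2,3)
proof (induction k arbitrary: f g)
  case 0 then show ?case by (auto intro: continuous_intros)
next
  case (Suc k)
  show ?case
    by (rule Ck_on_SucI[OF assms(1) has_derivative_add])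
      (use Suc in \<open>auto intro!: Ck_on_has_derivative\<close>)
qed

lemma Ck_on_sum:
  fixes f :: "'i \<Rightarrow> 'a::euclidean_space \<Rightarrow> 'b::real_normed_vector"
  assumes "fat S" "\<And>i. i \<in> A \<Longrightarrow> Ck_on k (f i) S" shows "Ck_on k (\<lambda>x. \<Sum>i\<in>A. f i x) S"
proof (cases "finite A")
  case True
  then show ?thesis using assms(2)
    by (induction A) (auto intro!: Ck_on_const Ck_on_add assms(1))
qed (simp add: Ck_on_const assms(1))

lemma Ck_on_bilinear:
  fixes f :: "'a::euclidean_space \<Rightarrow> 'b::real_normed_vector" and g :: "'a \<Rightarrow> 'c::real_normed_vector"
  assumes B: "bounded_bilinear B" and "fat S" "Ck_on k f S" "Ck_on k g S"
  shows "Ck_on k (\<lambda>x. B (f x) (g x)) S"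
  using assms(3,4)
proof (induction k arbitrary: f g)
  case 0 then show ?case using bounded_bilinear.continuous_on[OF B] by simp
next
  case (Suc k)
  show ?case
  proof (rule Ck_on_SucI[OF assms(2) bounded_bilinear.FDERIV[OF B]])
    fix h
    show "Ck_on k (\<lambda>x. B (f x) (frechet_derivative g (at x within S) h)
       + B (frechet_derivative f (at x within S) h) (g x)) S"
      using Suc.prems Suc.prems[THEN Ck_on_Suc_imp] by (intro Ck_on_add assms(2) Suc.IH) auto
  qed (use Suc in \<open>auto intro!: Ck_on_has_derivative\<close>)
qed

lemma Ck_on_scaleR:
  fixes f :: "'a::euclidean_space \<Rightarrow> real" and g :: "'a \<Rightarrow> 'c::real_normed_vector"
  assumes "fat S" "Ck_on k f S" "Ck_on k g S" shows "Ck_on k (\<lambda>x. f x *\<^sub>R g x) S"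
  by (rule Ck_on_bilinear[OF bounded_bilinear_scaleR assms])

lemma Ck_on_Pair:
  fixes f :: "'a::euclidean_space \<Rightarrow> 'b::real_normed_vector" and g :: "'a \<Rightarrow> 'c::real_normed_vector"
  assumes S: "fat S" and "Ck_on k f S" "Ck_on k g S" shows "Ck_on k (\<lambda>x. (f x, g x)) S"
proof -
  have "bounded_linear (\<lambda>x::'b. (x, 0::'c))" "bounded_linear (\<lambda>x::'c. (0::'b, x))"
    by (auto intro!: bounded_linear_Pair bounded_linear_ident bounded_linear_zero)
  from Ck_on_add[OF S Ck_on_bounded_linear[OF this(1) S assms(2)] Ck_on_bounded_linear[OF this(2) S assms(3)]]
  show ?thesis by simp
qed

text \<open>
  The derivative of a composition is expanded in a basis, \<open>D(g \<circ> f)(h) = \<Sum>\<^sub>i (Df(h) \<bullet> i) Dg(i)\<close>, so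
  that the induction hypothesis applies to each partial derivative of \<open>g\<close> composed with \<open>f\<close>.
\<close>

lemma Ck_on_compose:
  fixes f :: "'a::euclidean_space \<Rightarrow> 'b::euclidean_space" and g :: "'b \<Rightarrow> 'c::real_normed_vector"
  assumes S: "fat S" and "Ck_on k g T" "Ck_on k f S" and sub: "f ` S \<subseteq> T"
  shows "Ck_on k (\<lambda>x. g (f x)) S"
  using assms(2,3)
proof (induction k arbitrary: g)
  case 0 then show ?case using sub by (auto intro: continuous_on_compose2)
next
  case (Suc k)
  let ?Df = "\<lambda>x. frechet_derivative f (at x within S)"
  let ?Dg = "\<lambda>y. frechet_derivative g (at y within T)"
  show ?case
  proof (rule Ck_on_SucI[OF S])
    fix x assume x: "x \<in> S"
    have g: "(g has_derivative ?Dg (f x)) (at (f x) within T)"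
      using Suc.prems x sub by (auto intro!: Ck_on_has_derivative)
    have f: "(f has_derivative ?Df x) (at x within S)"
      using Suc.prems x by (auto intro!: Ck_on_has_derivative)
    have "((\<lambda>x. g (f x)) has_derivative (\<lambda>h. ?Dg (f x) (?Df x h))) (at x within S)"
      using has_derivative_in_compose2[OF Ck_on_has_derivative[OF Suc.prems(1)] sub x f] .
    moreover have "?Dg (f x) (?Df x h) = (\<Sum>i\<in>Basis. (?Df x h \<bullet> i) *\<^sub>R ?Dg (f x) i)" for h
    proof -
      have lin: "linear (?Dg (f x))" using g has_derivative_linear by blast
      have "?Dg (f x) (?Df x h) = ?Dg (f x) (\<Sum>i\<in>Basis. (?Df x h \<bullet> i) *\<^sub>R i)"
        by (simp add: euclidean_representation)
      then show ?thesis by (simp add: linear_sum[OF lin] linear_scale[OF lin])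
    qed
    ultimately show "((\<lambda>x. g (f x)) has_derivative (\<lambda>h. \<Sum>i\<in>Basis. (?Df x h \<bullet> i) *\<^sub>R ?Dg (f x) i)) (at x within S)"
      by simp
  next
    fix h
    have "Ck_on k (\<lambda>x. ?Dg (f x) i) S" for i
      using Suc.IH[of "\<lambda>y. ?Dg y i", OF _ Ck_on_Suc_imp[OF Suc.prems(2)]] Suc.prems(1) by simp
    moreover have "Ck_on k (\<lambda>x. ?Df x h \<bullet> i) S" for i
      by (rule Ck_on_bounded_linear[OF bounded_linear_inner_left S]) (use Suc.prems in simp)
    ultimately show "Ck_on k (\<lambda>x. \<Sum>i\<in>Basis. (?Df x h \<bullet> i) *\<^sub>R ?Dg (f x) i) S"
      by (intro Ck_on_sum Ck_on_scaleR S)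
  qed
qed

lemma Ck_on_fst: "fat S \<Longrightarrow> Ck_on k fst S" and Ck_on_snd: "fat S \<Longrightarrow> Ck_on k snd S"
  for S :: "('a::euclidean_space \<times> 'b::euclidean_space) set"
  by (auto intro!: Ck_on_linear bounded_linear_fst bounded_linear_snd)

lemma Ck_on_open_has_derivative:
  fixes f :: "'a::euclidean_space \<Rightarrow> 'b::real_normed_vector"
  assumes "Ck_on (Suc k) f U" "open U" "x \<in> U"
  shows "(f has_derivative frechet_derivative f (at x)) (at x)"
  using Ck_on_has_derivative[OF assms(1,3)] at_within_open[OF assms(3,2)] by simp

lemma Ck_on_open_frechet:
  fixes f :: "'a::euclidean_space \<Rightarrow> 'b::real_normed_vector"
  assumes "Ck_on (Suc k) f U" "open U"
  shows "Ck_on k (\<lambda>x. frechet_derivative f (at x) h) U"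
proof -
  have "Ck_on k (\<lambda>x. frechet_derivative f (at x within U) h) U" using assms by simp
  then show ?thesis by (rule Ck_on_cong) (simp add: at_within_open[OF _ assms(2)])
qed

lemma frechet_eqI: "(f has_derivative f') (at x) \<Longrightarrow> frechet_derivative f (at x) = f'"
  using frechet_derivative_at by metis

lemma Ck_on_vector_derivative:
  fixes f :: "real \<Rightarrow> 'b::real_normed_vector"
  assumes "Ck_on (Suc k) f S" "fat S"
  shows "\<And>t. t \<in> S \<Longrightarrow> (f has_vector_derivative vector_derivative f (at t within S)) (at t within S)"
    and "Ck_on k (\<lambda>t. vector_derivative f (at t within S)) S"
proof -
  have *: "(f has_vector_derivative frechet_derivative f (at t within S) 1) (at t within S)" if "t \<in> S" for t
  proof -
    have h: "(f has_derivative frechet_derivative f (at t within S)) (at t within S)"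
      by (rule Ck_on_has_derivative[OF assms(1) that])
    have "frechet_derivative f (at t within S) x = x *\<^sub>R frechet_derivative f (at t within S) 1" for x
      using linear_scale[OF has_derivative_linear[OF h], of x 1] by simp
    then show ?thesis unfolding has_vector_derivative_def using h by (metis (no_types, lifting) ext)
  qed
  then have eq: "vector_derivative f (at t within S) = frechet_derivative f (at t within S) 1" if "t \<in> S" for t
    using vector_derivative_within[OF fat_not_bot[OF assms(2) that]] that by blast
  show "(f has_vector_derivative vector_derivative f (at t within S)) (at t within S)" if "t \<in> S" for t
    using * eq that by simp
  have "Ck_on k (\<lambda>t. frechet_derivative f (at t within S) 1) S" using assms(1) by simp
  then show "Ck_on k (\<lambda>t. vector_derivative f (at t within S)) S"
    by (rule Ck_on_cong) (simp add: eq)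
qed

lemma Ck_on_SucI_vector:
  fixes f :: "real \<Rightarrow> 'b::real_normed_vector"
  assumes "fat S" "\<And>t. t \<in> S \<Longrightarrow> (f has_vector_derivative f' t) (at t within S)" "Ck_on k f' S"
  shows "Ck_on (Suc k) f S"
  by (rule Ck_on_SucI[OF assms(1), where f' = "\<lambda>t h. h *\<^sub>R f' t"])
    (use assms in \<open>auto simp: has_vector_derivative_def intro!: Ck_on_scaleR Ck_on_const\<close>)

section \<open>Mixed derivatives and bump functions\<close>

abbreviation der where "der f x \<equiv> frechet_derivative f (at x)"

text \<open>
  Equality of mixed partial derivatives: the second difference of \<open>g\<close> over the parallelogram
  spanned by \<open>s u\<close> and \<open>s v\<close> is, by the mean value theorem, \<open>s\<^sup>2\<close> times either mixed derivative at
  some point of the parallelogram; let \<open>s\<close> tend to \<open>0\<close>.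
\<close>

lemma second_difference:
  fixes g :: "'a::euclidean_space \<Rightarrow> real"
  assumes g: "Ck_on 2 g U" and U: "open U" and s: "s > 0"
    and sub: "\<And>a b. 0 \<le> a \<Longrightarrow> a \<le> s \<Longrightarrow> 0 \<le> b \<Longrightarrow> b \<le> s \<Longrightarrow> x + a *\<^sub>R u + b *\<^sub>R v \<in> U"
  shows "\<exists>a b. 0 \<le> a \<and> a \<le> s \<and> 0 \<le> b \<and> b \<le> s \<and>
    g (x + s *\<^sub>R u + s *\<^sub>R v) - g (x + s *\<^sub>R u) - g (x + s *\<^sub>R v) + g x =
    s * s * der (\<lambda>y. der g y u) (x + a *\<^sub>R u + b *\<^sub>R v) v"
proof -
  let ?Du = "\<lambda>y. der g y u"
  have g1: "Ck_on (Suc 1) g U" using g by (simp add: numeral_2_eq_2)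
  have Du: "Ck_on (Suc 0) ?Du U" using Ck_on_open_frechet[OF g1 U, of u] by simp
  have line: "((\<lambda>a. f (p + a *\<^sub>R w)) has_real_derivative der f (p + a *\<^sub>R w) w) (at a)"
    if "Ck_on (Suc k) f U" "p + a *\<^sub>R w \<in> U" for f :: "'a \<Rightarrow> real" and k p a w
  proof -
    have d: "(f has_derivative der f (p + a *\<^sub>R w)) (at (p + a *\<^sub>R w))"
      by (rule Ck_on_open_has_derivative[OF that(1) U that(2)])
    have "((\<lambda>a. p + a *\<^sub>R w) has_derivative (\<lambda>h. h *\<^sub>R w)) (at a)"
      by (auto intro!: derivative_eq_intros)
    from has_derivative_compose[OF this d] linear_scale[OF has_derivative_linear[OF d]]
    show ?thesis by (simp add: has_field_derivative_def mult.commute[of _ "frechet_derivative _ _ _"])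
  qed
  have inU: "x + s *\<^sub>R v + a *\<^sub>R u \<in> U" "x + a *\<^sub>R u \<in> U" if "0 \<le> a" "a \<le> s" for a
    using sub[of a s] sub[of a 0] that s by (simp_all add: algebra_simps)
  have "\<exists>z>0. z < s \<and> (g (x + s *\<^sub>R v + s *\<^sub>R u) - g (x + s *\<^sub>R u)) - (g (x + s *\<^sub>R v + 0 *\<^sub>R u) - g (x + 0 *\<^sub>R u)) =
    (s - 0) * (?Du (x + s *\<^sub>R v + z *\<^sub>R u) - ?Du (x + z *\<^sub>R u))"
    by (rule MVT2[OF s, of "\<lambda>a. g (x + s *\<^sub>R v + a *\<^sub>R u) - g (x + a *\<^sub>R u)"])
      (use inU s in \<open>auto intro!: DERIV_diff line[OF g1]\<close>)
  then obtain a where a: "0 < a" "a < s" "g (x + s *\<^sub>R v + s *\<^sub>R u) - g (x + s *\<^sub>R u) - (g (x + s *\<^sub>R v) - g x) =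
      s * (?Du (x + s *\<^sub>R v + a *\<^sub>R u) - ?Du (x + a *\<^sub>R u))" by auto
  have "\<exists>z>0. z < s \<and> ?Du (x + a *\<^sub>R u + s *\<^sub>R v) - ?Du (x + a *\<^sub>R u + 0 *\<^sub>R v) =
    (s - 0) * der ?Du (x + a *\<^sub>R u + z *\<^sub>R v) v"
    by (rule MVT2[OF s, of "\<lambda>b. ?Du (x + a *\<^sub>R u + b *\<^sub>R v)"])
      (use a sub[of a] in \<open>auto intro!: line[OF Du]\<close>)
  then obtain b where "0 < b" "b < s" "?Du (x + a *\<^sub>R u + s *\<^sub>R v) - ?Du (x + a *\<^sub>R u) =
    s * der ?Du (x + a *\<^sub>R u + b *\<^sub>R v) v" by auto
  then show ?thesis using a by (intro exI[of _ a] exI[of _ b]) (simp add: algebra_simps)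
qed

lemma mixed_derivative_symmetric_real:
  fixes g :: "'a::euclidean_space \<Rightarrow> real"
  assumes g: "Ck_on 2 g U" and U: "open U" and x: "x \<in> U"
  shows "der (\<lambda>y. der g y u) x v =
    der (\<lambda>y. der g y v) x u"
proof -
  define H where "H = (\<lambda>u v y. der (\<lambda>y. der g y u) y v)"
  have g1: "Ck_on (Suc 1) g U" using g by (simp add: numeral_2_eq_2)
  have cont: "continuous_on U (H u v)" for u v
    using Ck_on_open_frechet[OF _ U, of 0 "\<lambda>y. der g y u" v]
      Ck_on_open_frechet[OF g1 U, of u] by (simp add: H_def)
  have "\<bar>H u v x - H v u x\<bar> \<le> e" if e: "e > 0" for e
  proof -
    obtain d0 where d0: "d0 > 0" "ball x d0 \<subseteq> U" using U x openE by blast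
    obtain d1 where d1: "d1 > 0" "\<And>y. y \<in> U \<Longrightarrow> dist y x < d1 \<Longrightarrow> dist (H u v y) (H u v x) < e / 2"
      using cont[of u v] x e unfolding continuous_on_iff by (metis half_gt_zero)
    obtain d2 where d2: "d2 > 0" "\<And>y. y \<in> U \<Longrightarrow> dist y x < d2 \<Longrightarrow> dist (H v u y) (H v u x) < e / 2"
      using cont[of v u] x e unfolding continuous_on_iff by (metis half_gt_zero)
    define d where "d = min d0 (min d1 d2)"
    define M where "M = norm u + norm v + 1"
    define s where "s = d / (2 * M)"
    have M: "M > 0" unfolding M_def by (simp add: add_nonneg_pos)
    have d: "d > 0" using d0 d1 d2 by (simp add: d_def)
    then have s: "s > 0" using M by (simp add: s_def)
    have near: "dist (x + a *\<^sub>R p + b *\<^sub>R q) x < d"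
      if "0 \<le> a" "a \<le> s" "0 \<le> b" "b \<le> s" "norm p + norm q + 1 = M" for a b p q
    proof -
      have "dist (x + a *\<^sub>R p + b *\<^sub>R q) x = norm (a *\<^sub>R p + b *\<^sub>R q)" by (simp add: dist_norm)
      also have "\<dots> \<le> a * norm p + b * norm q" using that norm_triangle_ineq[of "a *\<^sub>R p" "b *\<^sub>R q"] by simp
      also have "\<dots> \<le> s * norm p + s * norm q" using that by (intro add_mono mult_right_mono) auto
      also have "\<dots> < s * M" using s that(5) by (simp add: algebra_simps flip: that(5))
      also have "\<dots> < d" using M d by (simp add: s_def)
      finally show ?thesis .
    qed
    have inU: "y \<in> U" if "dist y x < d" for y
      using that d0 by (auto simp: d_def dist_commute)
    obtain a b where 1: "0 \<le> a" "a \<le> s" "0 \<le> b" "b \<le> s" "g (x + s *\<^sub>R u + s *\<^sub>R v) - g (x + s *\<^sub>R u) - g (x + s *\<^sub>R v) + g x =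
      s * s * H u v (x + a *\<^sub>R u + b *\<^sub>R v)"
      using second_difference[OF g U s, of x u v] near inU unfolding H_def M_def by blast
    have "\<exists>a b. 0 \<le> a \<and> a \<le> s \<and> 0 \<le> b \<and> b \<le> s \<and>
      g (x + s *\<^sub>R v + s *\<^sub>R u) - g (x + s *\<^sub>R v) - g (x + s *\<^sub>R u) + g x =
      s * s * H v u (x + a *\<^sub>R v + b *\<^sub>R u)"
      unfolding H_def
      by (rule second_difference[OF g U s, of x v u]) (auto intro!: inU near simp: M_def)
    then obtain a' b' where 2: "0 \<le> a'" "a' \<le> s" "0 \<le> b'" "b' \<le> s" "g (x + s *\<^sub>R v + s *\<^sub>R u) - g (x + s *\<^sub>R v) - g (x + s *\<^sub>R u) + g x =
      s * s * H v u (x + a' *\<^sub>R v + b' *\<^sub>R u)" by blast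
    have "s * s * H u v (x + a *\<^sub>R u + b *\<^sub>R v) = s * s * H v u (x + a' *\<^sub>R v + b' *\<^sub>R u)"
      using 1(5) 2(5) by (simp add: algebra_simps)
    then have eq: "H u v (x + a *\<^sub>R u + b *\<^sub>R v) = H v u (x + a' *\<^sub>R v + b' *\<^sub>R u)" using s by simp
    have n1: "dist (x + a *\<^sub>R u + b *\<^sub>R v) x < d" and n2: "dist (x + a' *\<^sub>R v + b' *\<^sub>R u) x < d"
      using near 1 2 by (auto simp: M_def)
    have "dist (H u v (x + a *\<^sub>R u + b *\<^sub>R v)) (H u v x) < e / 2"
      using d1(2)[OF inU[OF n1]] n1 by (simp add: d_def)
    moreover have "dist (H v u (x + a' *\<^sub>R v + b' *\<^sub>R u)) (H v u x) < e / 2"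
      using d2(2)[OF inU[OF n2]] n2 by (simp add: d_def)
    ultimately show ?thesis unfolding dist_real_def eq by arith
  qed
  then have "\<bar>H u v x - H v u x\<bar> \<le> 0" by (rule field_le_epsilon[of _ 0, simplified])
  then show ?thesis by (simp add: H_def)
qed

lemma mixed_derivative_symmetric:
  fixes f :: "'a::euclidean_space \<Rightarrow> 'b::euclidean_space"
  assumes f: "Ck_on 2 f U" and U: "open U" and x: "x \<in> U"
  shows "der (\<lambda>y. der f y u) x v =
    der (\<lambda>y. der f y v) x u"
proof (rule euclidean_eqI)
  fix b :: 'b assume "b \<in> Basis"
  have f1: "Ck_on (Suc 1) f U" using f by (simp add: numeral_2_eq_2)
  have 1: "der (\<lambda>y. f y \<bullet> b) y u = der f y u \<bullet> b" if "y \<in> U" for y u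
    using frechet_eqI[OF bounded_linear.has_derivative[OF bounded_linear_inner_left Ck_on_open_has_derivative[OF f1 U that], of b]]
    by simp
  have 2: "der (\<lambda>y. der (\<lambda>y. f y \<bullet> b) y u) x v =
      der (\<lambda>y. der f y u) x v \<bullet> b" for u v
  proof -
    have "Ck_on (Suc 0) (\<lambda>y. der f y u) U" using Ck_on_open_frechet[OF f1 U, of u] by simp
    from bounded_linear.has_derivative[OF bounded_linear_inner_left Ck_on_open_has_derivative[OF this U x], of b]
    have "((\<lambda>y. der (\<lambda>y. f y \<bullet> b) y u) has_derivative
      (\<lambda>v. der (\<lambda>y. der f y u) x v \<bullet> b)) (at x)"
      by (rule has_derivative_transform_within_open[OF _ U x]) (simp add: 1)
    from frechet_eqI[OF this] show ?thesis by simp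
  qed
  have "Ck_on 2 (\<lambda>y. f y \<bullet> b) U"
    by (rule Ck_on_bounded_linear[OF bounded_linear_inner_left fat_open[OF U] f])
  from mixed_derivative_symmetric_real[OF this U x, of u v]
  show "der (\<lambda>y. der f y u) x v \<bullet> b =
    der (\<lambda>y. der f y v) x u \<bullet> b"
    by (simp only: 2)
qed

text \<open>
  The functions \<open>x\<^sup>-\<^sup>n e\<^sup>-\<^sup>1\<^sup>/\<^sup>x\<close>, extended by \<open>0\<close> to \<open>x \<le> 0\<close>, have derivatives that are linear
  combinations of functions of the same family; so all of them are smooth, by induction.
\<close>

definition flat_exp :: "nat \<Rightarrow> real \<Rightarrow> real" where
  "flat_exp n x = (if x > 0 then (1 / x) ^ n * exp (- (1 / x)) else 0)"

text \<open>
  From \<open>exp (y / m) \<ge> y / m\<close> for \<open>y = 1 / x\<close> and \<open>m = n + 2\<close>: a quadratic bound is what makes the derivative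
  at \<open>0\<close> vanish.
\<close>

lemma flat_exp_bound: "0 < x \<Longrightarrow> flat_exp n x \<le> real (Suc (Suc n)) ^ Suc (Suc n) * x ^ 2"
proof -
  assume x: "0 < x"
  define m where "m = Suc (Suc n)"
  have m: "real m > 0" by (simp add: m_def)
  have "(1 / x / real m) ^ m \<le> exp (1 / x / real m) ^ m"
    using x m exp_ge_add_one_self[of "1 / x / real m"] by (intro power_mono) (linarith, simp)
  also have "\<dots> = exp (1 / x)" using m by (simp flip: exp_of_nat_mult)
  finally have "(1 / x) ^ m / real m ^ m \<le> exp (1 / x)" by (simp only: power_divide)
  then have "(1 / x) ^ m \<le> real m ^ m * exp (1 / x)"
    using m pos_divide_le_eq[of "real m ^ m" "(1 / x) ^ m"] by (simp add: mult.commute)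
  then have "(1 / x) ^ m * exp (- (1 / x)) \<le> real m ^ m * exp (1 / x) * exp (- (1 / x))"
    by (rule mult_right_mono) simp
  also have "\<dots> = real m ^ m" by (simp flip: exp_add)
  finally have "(1 / x) ^ m * exp (- (1 / x)) \<le> real m ^ m" .
  then have "((1 / x) ^ m * exp (- (1 / x))) * x ^ 2 \<le> real m ^ m * x ^ 2" by (rule mult_right_mono) simp
  moreover have "(1 / x) ^ m * x ^ 2 = (1 / x) ^ n"
    using x by (simp add: m_def power2_eq_square field_simps)
  moreover have "((1 / x) ^ m * exp (- (1 / x))) * x ^ 2 = ((1 / x) ^ m * x ^ 2) * exp (- (1 / x))" by simp
  ultimately have "(1 / x) ^ n * exp (- (1 / x)) \<le> real m ^ m * x ^ 2" by (simp only:)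
  then show ?thesis using x by (simp only: flat_exp_def m_def if_True)
qed

lemma flat_exp_derivative:
  "(flat_exp n has_vector_derivative (flat_exp (Suc (Suc n)) x - real n * flat_exp (Suc n) x)) (at x)"
proof -
  consider "x > 0" | "x < 0" | "x = 0" by linarith
  then show ?thesis
  proof cases
    case 1
    have d: "((\<lambda>x. (1 / x) ^ n * exp (- (1 / x))) has_real_derivative
      (flat_exp (Suc (Suc n)) x - real n * flat_exp (Suc n) x)) (at x)"
    proof -
      define y where "y = 1 / x"
      have d0: "((\<lambda>x. 1 / x) has_real_derivative - (y * y)) (at x)"
        using 1 by (auto intro!: derivative_eq_intros simp: y_def)
      have "((\<lambda>x. (1 / x) ^ n * exp (- (1 / x))) has_real_derivative
        real n * ((- (y * y)) * y ^ (n - Suc 0)) * exp (- y) + exp (- y) * - (- (y * y)) * y ^ n) (at x)"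
        using DERIV_mult[OF DERIV_power[OF d0, of n] DERIV_fun_exp[OF DERIV_minus[OF d0]]] by (simp add: y_def)
      moreover have "real n * ((- (y * y)) * y ^ (n - Suc 0)) * exp (- y) + exp (- y) * - (- (y * y)) * y ^ n =
        flat_exp (Suc (Suc n)) x - real n * flat_exp (Suc n) x"
        using 1 by (cases n) (simp_all add: flat_exp_def y_def[symmetric] algebra_simps)
      ultimately show ?thesis by simp
    qed
    show ?thesis
      by (rule has_vector_derivative_transform_within_open[OF
          d[unfolded has_real_derivative_iff_has_vector_derivative], of "{0<..}"]) (use 1 in \<open>auto simp: flat_exp_def\<close>)
  next
    case 2
    have "((\<lambda>x. 0) has_vector_derivative (0::real)) (at x)" by simp
    then have "(flat_exp n has_vector_derivative 0) (at x)"
      by (rule has_vector_derivative_transform_within_open[of _ _ _ "{..<0}"]) (use 2 in \<open>auto simp: flat_exp_def\<close>)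
    then show ?thesis using 2 by (simp add: flat_exp_def)
  next
    case 3
    define C where "C = real (Suc (Suc n)) ^ Suc (Suc n)"
    have C: "C \<ge> 0" by (simp add: C_def)
    have "((\<lambda>h. (flat_exp n (0 + h) - flat_exp n 0) / h) \<longlongrightarrow> 0) (at 0)"
    proof (rule Lim_null_comparison)
      show "\<forall>\<^sub>F h in at 0. norm ((flat_exp n (0 + h) - flat_exp n 0) / h) \<le> C * \<bar>h\<bar>"
      proof (rule always_eventually, rule allI)
        fix h :: real
        show "norm ((flat_exp n (0 + h) - flat_exp n 0) / h) \<le> C * \<bar>h\<bar>"
        proof (cases "h > 0")
          case True
          then have "flat_exp n h \<le> C * h ^ 2" "flat_exp n h \<ge> 0"
            using flat_exp_bound[of h n] by (auto simp: C_def flat_exp_def)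
          then show ?thesis using True by (simp add: flat_exp_def[of n 0] field_simps power2_eq_square)
        next
          case False
          then show ?thesis using C by (simp add: flat_exp_def mult_nonneg_nonpos)
        qed
      qed
      show "((\<lambda>h. C * \<bar>h\<bar>) \<longlongrightarrow> 0) (at 0)" by (auto intro!: tendsto_eq_intros)
    qed
    then have "(flat_exp n has_real_derivative 0) (at 0)" by (simp add: DERIV_def)
    then show ?thesis using 3 by (simp add: flat_exp_def has_real_derivative_iff_has_vector_derivative)
  qed
qed

lemma flat_exp_smooth: "Ck_on k (flat_exp n) UNIV"
proof (induction k arbitrary: n)
  case 0
  show ?case
    unfolding Ck_on.simps
    by (intro continuous_at_imp_continuous_on ballI has_vector_derivative_continuous[OF flat_exp_derivative])
next
  case (Suc k)
  have "Ck_on k (\<lambda>x. flat_exp (Suc (Suc n)) x + (- real n) *\<^sub>R flat_exp (Suc n) x) UNIV"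
    by (intro Ck_on_add Ck_on_scaleR Ck_on_const fat_UNIV Suc.IH)
  then show ?case
    by (intro Ck_on_SucI_vector[OF fat_UNIV flat_exp_derivative]) simp
qed

lemma bump_function_exists:
  fixes a b :: real assumes "a < b"
  shows "\<exists>\<phi>. smooth_on \<phi> UNIV \<and> (\<forall>t. \<phi> t \<ge> (0::real)) \<and> (\<forall>t. \<phi> t > 0 \<longleftrightarrow> a < t \<and> t < b)"
proof (intro exI conjI allI)
  let ?\<phi> = "\<lambda>t. flat_exp 0 ((t - a) * (b - t))"
  \<comment> \<open>The quadratic polynomial is positive exactly between its zeros \<open>a\<close> and \<open>b\<close>.\<close>
  have "Ck_on k (\<lambda>t. (t - a) * (b - t)) UNIV" for k
  proof -
    have 1: "Ck_on k (\<lambda>t::real. t) UNIV" by (rule Ck_on_linear[OF bounded_linear_ident fat_UNIV])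
    have "Ck_on k (\<lambda>t. (t + (- a)) *\<^sub>R (b + (-1) *\<^sub>R t)) UNIV"
      by (intro Ck_on_scaleR Ck_on_add Ck_on_const fat_UNIV 1)
    then show ?thesis by simp
  qed
  then show "smooth_on ?\<phi> UNIV"
    unfolding smooth_on_def by (auto intro!: Ck_on_compose[OF fat_UNIV flat_exp_smooth])
  show "?\<phi> t \<ge> 0" for t by (simp add: flat_exp_def)
  show "?\<phi> t > 0 \<longleftrightarrow> a < t \<and> t < b" for t
    using assms by (auto simp: flat_exp_def zero_less_mult_iff split: if_splits)
qed

section \<open>Metric Lie algebras\<close>

locale metric_lie_algebra =
  fixes br :: "'e::euclidean_space \<Rightarrow> 'e \<Rightarrow> 'e" and I :: "'e \<Rightarrow> 'e \<Rightarrow> real"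
  assumes br_bilinear: "bilinear br"
    and br_antisym: "br a b = - br b a"
    and jacobi: "br (br a b) c + br (br b c) a + br (br c a) b = 0"
    and I: "inner_product I"
begin

lemma I_bilinear: "bilinear I" and I_sym: "I a b = I b a"
  using I by (auto simp: inner_product_def)

lemma I_eqI: "(\<And>w. I p w = I q w) \<Longrightarrow> p = q"
  using inner_product_riesz[OF I, of "I q"] I_bilinear by (auto simp: bilinear_def)

lemmas I_simps = bilinear_ladd[OF I_bilinear] bilinear_radd[OF I_bilinear] bilinear_lmul[OF I_bilinear]
  bilinear_rmul[OF I_bilinear] bilinear_lsub[OF I_bilinear] bilinear_rsub[OF I_bilinear]
  bilinear_lneg[OF I_bilinear] bilinear_rneg[OF I_bilinear] bilinear_lzero[OF I_bilinear] bilinear_rzero[OF I_bilinear]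

lemmas br_simps = bilinear_ladd[OF br_bilinear] bilinear_radd[OF br_bilinear] bilinear_lmul[OF br_bilinear]
  bilinear_rmul[OF br_bilinear] bilinear_lsub[OF br_bilinear] bilinear_rsub[OF br_bilinear]
  bilinear_lneg[OF br_bilinear] bilinear_rneg[OF br_bilinear] bilinear_lzero[OF br_bilinear] bilinear_rzero[OF br_bilinear]

text \<open>
  The Levi-Civita connection of the left-invariant metric on left-invariant fields: in Koszul's
  formula the derivatives of the constant functions \<open>g(a\<^sub>L, b\<^sub>L)\<close> drop out, only brackets remain.
\<close>

definition nab :: "'e \<Rightarrow> 'e \<Rightarrow> 'e" where
  "nab a b = (THE z. \<forall>w. I z w = (I (br a b) w - I b (br a w) - I a (br b w)) / 2)"

lemma I_nab: "I (nab a b) w = (I (br a b) w - I b (br a w) - I a (br b w)) / 2"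
proof -
  have "linear (\<lambda>w. (I (br a b) w - I b (br a w) - I a (br b w)) / 2)"
    by (intro linearI) (simp_all add: I_simps br_simps field_simps)
  from theI'[OF inner_product_riesz[OF I this]] show ?thesis unfolding nab_def by blast
qed

lemma nab_bilinear: "bilinear nab"
  unfolding bilinear_def
  by (intro conjI allI linearI I_eqI) (simp_all add: I_nab I_simps br_simps field_simps)

lemmas nab_simps = bilinear_ladd[OF nab_bilinear] bilinear_radd[OF nab_bilinear] bilinear_lmul[OF nab_bilinear]
  bilinear_rmul[OF nab_bilinear] bilinear_lsub[OF nab_bilinear] bilinear_rsub[OF nab_bilinear]
  bilinear_lneg[OF nab_bilinear] bilinear_rneg[OF nab_bilinear] bilinear_lzero[OF nab_bilinear] bilinear_rzero[OF nab_bilinear]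

text \<open>
  Torsion-freeness and the next lemma, skewness, characterize \<open>nab\<close>; the curvature identities rest on
  these two properties and the Jacobi identity.
\<close>

lemma nab_torsion_free: "br a b = nab a b - nab b a"
  by (rule I_eqI) (simp add: I_simps I_nab br_antisym[of b a] field_simps)

lemma nab_skew: "I (nab a b) c = - I b (nab a c)"
proof -
  have "I a (br c b) = - I a (br b c)" unfolding br_antisym[of c b] by (simp add: I_simps)
  then show ?thesis
    unfolding I_sym[of b "nab a c"] I_nab using I_sym[of "br a b" c] I_sym[of "br a c" b] by argo
qed

lemma nab_skew_self [simp]: "I (nab a b) b = 0" "I b (nab a b) = 0"
  using nab_skew[of a b b] I_sym[of b "nab a b"] by linarith+

definition R :: "'e \<Rightarrow> 'e \<Rightarrow> 'e \<Rightarrow> 'e" where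
  "R a b c = nab a (nab b c) - nab b (nab a c) - nab (br a b) c"

lemma R_antisym: "R a b c = - R b a c"
  unfolding R_def br_antisym[of b a] by (simp add: nab_simps)

lemma R_skew: "I (R a b c) d = - I c (R a b d)"
  unfolding R_def by (simp add: I_simps nab_skew[of a] nab_skew[of b] nab_skew[of "br a b"])

text \<open>
  Written out with \<open>[a, b] = \<nabla>\<^sub>a b - \<nabla>\<^sub>b a\<close>, the cyclic sum of \<open>R\<close> is the negative of the Jacobi sum.
\<close>

lemma R_bianchi: "R a b c + R b c a + R c a b = 0"
proof -
  have "R a b c + R b c a + R c a b = nab a (br b c) + nab b (br c a) + nab c (br a b)
      - nab (br a b) c - nab (br b c) a - nab (br c a) b"
    by (simp only: R_def nab_torsion_free nab_simps) (simp only: algebra_simps)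
  also have "\<dots> = - (br (br a b) c + br (br b c) a + br (br c a) b)"
    by (simp only: nab_torsion_free[of "br a b" c] nab_torsion_free[of "br b c" a] nab_torsion_free[of "br c a" b])
      (simp add: algebra_simps)
  finally show ?thesis using jacobi by simp
qed

text \<open>
  The symmetry under exchange of the two pairs follows by combining the four Bianchi identities that
  start from the cyclic rotations of \<open>a, b, c, d\<close>, in which all other terms cancel.
\<close>

lemma R_pair_symmetric: "I (R a b c) d = I (R c d a) b"
proof -
  have B: "I (R a b c) d + I (R b c a) d + I (R c a b) d = 0" for a b c d
    using arg_cong[OF R_bianchi[of a b c], of "\<lambda>z. I z d"] by (simp add: I_simps)
  have S: "I (R a b c) d = - I (R a b d) c" for a b c d using R_skew I_sym by metis
  have N: "I (R a b c) d = - I (R b a c) d" for a b c d using R_antisym[of a b c] by (simp add: I_simps)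
  show ?thesis
    using B[of a b c d] B[of b c d a] B[of c d a b] B[of d a b c]
      S[of a b c d] S[of b c a d] S[of c a b d] S[of c d b a] S[of d b c a] S[of d a c b] S[of a c d b] S[of b d a c]
      S[of c d a b] S[of b c d a] S[of d a b c]
      N[of c a b d] N[of a c d b] N[of d b c a] N[of b d a c] N[of c a d b] N[of d b a c]
    by linarith
qed

text \<open>
  This moves the curvature operator \<open>\<xi> \<mapsto> R(\<xi>, v) v\<close> of the Jacobi equation from the variation field to
  the acceleration.
\<close>

lemma R_self_adjoint: "I (R a v v) b = I (R b v v) a"
proof -
  have "I (R a v v) b = I (R v b a) v" by (rule R_pair_symmetric)
  also have "\<dots> = I a (R b v v)" unfolding R_antisym[of v b a] using R_skew[of b v a v] by (simp add: I_simps)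
  finally show ?thesis by (simp only: I_sym[of a])
qed

text \<open>
  The variation of the acceleration \<open>v' + \<nabla>\<^sub>v v\<close> when the velocity varies by \<open>\<xi>' + [v, \<xi>]\<close>: as
  \<open>\<xi>' + [v, \<xi>] = D\<xi> - \<nabla>\<^sub>\<xi> v\<close>, it is \<open>D\<^sup>2\<xi> + R(\<xi>, v) v\<close> up to the term \<open>\<nabla>\<^sub>\<xi> A\<close>, which is orthogonal to
  \<open>A\<close>. The letters \<open>v1\<close>, \<open>\<xi>1\<close>, \<open>\<xi>2\<close> stand for derivatives of \<open>v\<close> and \<open>\<xi>\<close>.
\<close>

lemma variation_of_acceleration:
  "(\<xi>2 + br v1 \<xi> + br v \<xi>1) + nab (\<xi>1 + br v \<xi>) v + nab v (\<xi>1 + br v \<xi>) =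
    (\<xi>2 + nab v1 \<xi> + nab v \<xi>1) + nab v (\<xi>1 + nab v \<xi>) + R \<xi> v v - nab \<xi> (v1 + nab v v)"
  by (simp only: R_def nab_torsion_free nab_simps) (simp add: algebra_simps)

text \<open>
  This is \<open>D\<^sup>2A + R(A, v) v - \<sigma> A\<close> for \<open>A = v' + \<nabla>\<^sub>v v\<close> and \<open>D = d/dt + \<nabla>\<^sub>v\<close>, expanded, where \<open>v1\<close>, \<open>v2\<close>, \<open>v3\<close>
  stand for the derivatives of \<open>v\<close>.
\<close>

definition EL :: "real \<Rightarrow> 'e \<Rightarrow> 'e \<Rightarrow> 'e \<Rightarrow> 'e \<Rightarrow> 'e" where
  "EL \<sigma> v v1 v2 v3 = v3 + nab v2 v + 3 *\<^sub>R nab v1 v1 + 3 *\<^sub>R nab v v2 + nab v1 (nab v v)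
     + 2 *\<^sub>R nab v (nab v1 v) + 3 *\<^sub>R nab v (nab v v1) + nab v (nab v (nab v v))
     + R v1 v v + R (nab v v) v v - \<sigma> *\<^sub>R nab v v - \<sigma> *\<^sub>R v1"

lemma R_left_add: "R (a + b) c d = R a c d + R b c d"
  unfolding R_def by (simp add: nab_simps br_simps)

lemma nab_bounded_bilinear: "bounded_bilinear nab" and I_bounded_bilinear: "bounded_bilinear I"
  and br_bounded_bilinear: "bounded_bilinear br"
  using nab_bilinear I_bilinear br_bilinear by (auto simp: bilinear_conv_bounded_bilinear)

lemmas nab_deriv = bounded_bilinear.has_vector_derivative[OF nab_bounded_bilinear]
lemmas I_deriv = bounded_bilinear.has_vector_derivative[OF I_bounded_bilinear]

lemma EL_continuous:
  assumes "continuous_on S v" "continuous_on S v1" "continuous_on S v2" "continuous_on S v3"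
  shows "continuous_on S (\<lambda>t. EL \<sigma> (v t) (v1 t) (v2 t) (v3 t))"
  unfolding EL_def R_def using assms
  by (intro continuous_intros bounded_bilinear.continuous_on[OF nab_bounded_bilinear]
      bounded_bilinear.continuous_on[OF br_bounded_bilinear])

text \<open>
  Integration by parts: the integrand of the first variation differs from \<open>\<phi> I (EL \<dots>) w\<close> by the
  derivative of \<open>I A (D\<xi>) - I (DA) \<xi> + \<sigma> I v \<xi>\<close>, where \<open>\<xi> = \<phi> w\<close>.
\<close>

lemma first_variation_by_parts:
  fixes v v1 v2 v3 :: "real \<Rightarrow> 'e" and \<phi> \<phi>1 \<phi>2 :: "real \<Rightarrow> real"
  assumes ab: "a \<le> b"
    and v: "\<And>t. t \<in> {a..b} \<Longrightarrow> (v has_vector_derivative v1 t) (at t within {a..b})"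
      "\<And>t. t \<in> {a..b} \<Longrightarrow> (v1 has_vector_derivative v2 t) (at t within {a..b})"
      "\<And>t. t \<in> {a..b} \<Longrightarrow> (v2 has_vector_derivative v3 t) (at t within {a..b})"
    and \<phi>: "\<And>t. t \<in> {a..b} \<Longrightarrow> (\<phi> has_vector_derivative \<phi>1 t) (at t within {a..b})"
      "\<And>t. t \<in> {a..b} \<Longrightarrow> (\<phi>1 has_vector_derivative \<phi>2 t) (at t within {a..b})"
    and zero: "\<phi> a = 0" "\<phi> b = 0" "\<phi>1 a = 0" "\<phi>1 b = 0"
    and cont: "continuous_on {a..b} v3"
  shows "((\<lambda>t. I (v1 t + nab (v t) (v t))
        ((\<phi>2 t *\<^sub>R w + br (v1 t) (\<phi> t *\<^sub>R w) + br (v t) (\<phi>1 t *\<^sub>R w))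
          + nab (\<phi>1 t *\<^sub>R w + br (v t) (\<phi> t *\<^sub>R w)) (v t) + nab (v t) (\<phi>1 t *\<^sub>R w + br (v t) (\<phi> t *\<^sub>R w)))
      + \<sigma> * I (v t) (\<phi>1 t *\<^sub>R w + br (v t) (\<phi> t *\<^sub>R w)))
    has_integral integral {a..b} (\<lambda>t. \<phi> t * I (EL \<sigma> (v t) (v1 t) (v2 t) (v3 t)) w)) {a..b}"
proof -
  define A where "A = (\<lambda>t. v1 t + nab (v t) (v t))"
  define A1 where "A1 = (\<lambda>t. v2 t + (nab (v t) (v1 t) + nab (v1 t) (v t)))"
  define A2 where "A2 = (\<lambda>t. v3 t + ((nab (v t) (v2 t) + nab (v1 t) (v1 t)) + (nab (v1 t) (v1 t) + nab (v2 t) (v t))))"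
  define DA where "DA = (\<lambda>t. A1 t + nab (v t) (A t))"
  define DA1 where "DA1 = (\<lambda>t. A2 t + (nab (v t) (A1 t) + nab (v1 t) (A t)))"
  define X where "X = (\<lambda>t. \<phi> t *\<^sub>R w)"
  define X1 where "X1 = (\<lambda>t. \<phi>1 t *\<^sub>R w)"
  define X2 where "X2 = (\<lambda>t. \<phi>2 t *\<^sub>R w)"
  define DX where "DX = (\<lambda>t. X1 t + nab (v t) (X t))"
  define DX1 where "DX1 = (\<lambda>t. X2 t + (nab (v t) (X1 t) + nab (v1 t) (X t)))"
  define Q where "Q = (\<lambda>t. I (A t) (DX t) - I (DA t) (X t) + \<sigma> * I (v t) (X t))"
  define q where "q = (\<lambda>t. (I (A t) (DX1 t) + I (A1 t) (DX t)) - (I (DA t) (X1 t) + I (DA1 t) (X t))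
    + \<sigma> * (I (v t) (X1 t) + I (v1 t) (X t)))"
  have dX: "(X has_vector_derivative X1 t) (at t within {a..b})"
    "(X1 has_vector_derivative X2 t) (at t within {a..b})" if "t \<in> {a..b}" for t
    unfolding X_def X1_def X2_def using \<phi>[OF that]
    by (auto simp: has_real_derivative_iff_has_vector_derivative[symmetric] intro!: derivative_eq_intros)
  have dA: "(A has_vector_derivative A1 t) (at t within {a..b})" if "t \<in> {a..b}" for t
    unfolding A_def A1_def by (intro has_vector_derivative_add nab_deriv v that)
  have dA1: "(A1 has_vector_derivative A2 t) (at t within {a..b})" if "t \<in> {a..b}" for t
    unfolding A1_def A2_def by (intro has_vector_derivative_add nab_deriv v that)
  have dDA: "(DA has_vector_derivative DA1 t) (at t within {a..b})" if "t \<in> {a..b}" for t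
    unfolding DA_def DA1_def by (intro has_vector_derivative_add nab_deriv v dA dA1 that)
  have dDX: "(DX has_vector_derivative DX1 t) (at t within {a..b})" if "t \<in> {a..b}" for t
    unfolding DX_def DX1_def by (intro has_vector_derivative_add nab_deriv v dX that)
  have dQ: "(Q has_vector_derivative q t) (at t within {a..b})" if "t \<in> {a..b}" for t
    unfolding Q_def q_def
    by (intro has_vector_derivative_add has_vector_derivative_diff I_deriv v dA dDA dDX dX that
        has_vector_derivative_mult_right)
  have "X a = 0" "X b = 0" "DX a = 0" "DX b = 0"
    using zero by (simp_all add: X_def DX_def X1_def nab_simps)
  then have "Q a = 0" "Q b = 0" by (simp_all add: Q_def I_simps)
  then have Q: "(q has_integral 0) {a..b}"
    using fundamental_theorem_of_calculus[OF ab dQ] by simp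
  have c: "continuous_on {a..b} v" "continuous_on {a..b} v1" "continuous_on {a..b} v2" "continuous_on {a..b} \<phi>"
    unfolding continuous_on_eq_continuous_within using v \<phi>(1) by (blast intro: has_vector_derivative_continuous)+
  have "continuous_on {a..b} (\<lambda>t. \<phi> t * I (EL \<sigma> (v t) (v1 t) (v2 t) (v3 t)) w)"
    by (intro continuous_intros bounded_bilinear.continuous_on[OF I_bounded_bilinear] EL_continuous c cont)
  then have E: "((\<lambda>t. \<phi> t * I (EL \<sigma> (v t) (v1 t) (v2 t) (v3 t)) w) has_integral
    integral {a..b} (\<lambda>t. \<phi> t * I (EL \<sigma> (v t) (v1 t) (v2 t) (v3 t)) w)) {a..b}"
    by (intro integrable_integral integrable_continuous_real)
  have "\<phi> t * I (EL \<sigma> (v t) (v1 t) (v2 t) (v3 t)) w + q t =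
    I (A t) ((X2 t + br (v1 t) (X t) + br (v t) (X1 t)) + nab (X1 t + br (v t) (X t)) (v t) + nab (v t) (X1 t + br (v t) (X t)))
      + \<sigma> * I (v t) (X1 t + br (v t) (X t))" for t
  proof -
    have three: "3 *\<^sub>R x = x + x + x" for x :: 'e using scaleR_left_distrib[of 2 1 x] by (simp add: scaleR_2)
    have 1: "EL \<sigma> (v t) (v1 t) (v2 t) (v3 t) = DA1 t + nab (v t) (DA t) + R (A t) (v t) (v t) - \<sigma> *\<^sub>R A t"
      unfolding EL_def DA1_def DA_def A2_def A1_def A_def R_left_add
      by (simp add: nab_simps three scaleR_2 algebra_simps)
    have 2: "I (A t) (nab (v t) (DX t)) = - I (nab (v t) (A t)) (DX t)" using nab_skew[of "v t" "A t" "DX t"] by simp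
    have 3: "I (nab (v t) (DA t)) (X t) = - I (DA t) (nab (v t) (X t))" by (rule nab_skew)
    have 4: "I (A t) (R (X t) (v t) (v t)) = I (R (A t) (v t) (v t)) (X t)"
      using R_self_adjoint[of "X t" "v t" "A t"] I_sym[of "A t" "R (X t) (v t) (v t)"] by simp
    have 5: "br (v t) (X t) = nab (v t) (X t) - nab (X t) (v t)" by (rule nab_torsion_free)
    have 6: "I (v t) (nab (v t) (X t)) = - I (nab (v t) (v t)) (X t)" using nab_skew[of "v t" "v t" "X t"] by simp
    have 7: "\<phi> t * I (EL \<sigma> (v t) (v1 t) (v2 t) (v3 t)) w = I (EL \<sigma> (v t) (v1 t) (v2 t) (v3 t)) (X t)"
      by (simp add: X_def I_simps)
    have "I (A t) ((X2 t + br (v1 t) (X t) + br (v t) (X1 t)) + nab (X1 t + br (v t) (X t)) (v t) + nab (v t) (X1 t + br (v t) (X t)))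
      = I (A t) (DX1 t) + I (A t) (nab (v t) (DX t)) + I (R (A t) (v t) (v t)) (X t)"
    proof -
      have A: "v1 t + nab (v t) (v t) = A t" by (simp add: A_def)
      show ?thesis
        unfolding variation_of_acceleration A using 4 by (simp add: I_simps DX1_def DX_def nab_simps)
    qed
    moreover have "\<sigma> * I (v t) (X1 t + br (v t) (X t)) = \<sigma> * (I (v t) (X1 t) - I (nab (v t) (v t)) (X t))"
      unfolding 5 I_simps 6 by simp
    ultimately show ?thesis unfolding 7 unfolding 1 q_def I_simps 2 3
      by (simp add: DX_def DA_def I_simps A_def algebra_simps)
  qed
  with has_integral_add[OF E Q] show ?thesis
    by (simp add: A_def X_def X1_def X2_def)
qed

end

section \<open>Left-invariant frames in a chart\<close>

lemma linear_basis_expand: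
  fixes f :: "'a::euclidean_space \<Rightarrow> 'b::real_vector"
  assumes "linear f" shows "f q = (\<Sum>i\<in>Basis. (q \<bullet> i) *\<^sub>R f i)"
proof -
  have "f q = f (\<Sum>i\<in>Basis. (q \<bullet> i) *\<^sub>R i)" by (simp add: euclidean_representation)
  then show ?thesis by (simp only: linear_sum[OF assms] linear_scale[OF assms])
qed

text \<open>
  The product rule for \<open>\<Phi>(y) q\<close>, where \<open>\<Phi>(y)\<close> is linear and depends smoothly on \<open>y\<close>.
\<close>

lemma linear_family_frechet:
  fixes \<Phi> :: "'a::euclidean_space \<Rightarrow> 'd::euclidean_space \<Rightarrow> 'c::real_normed_vector"
  assumes U: "open U" and lin: "\<And>y. y \<in> U \<Longrightarrow> linear (\<Phi> y)"
    and sm: "\<And>u. Ck_on (Suc 0) (\<lambda>y. \<Phi> y u) U" and x: "x \<in> U"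
  shows "der (\<lambda>y. \<Phi> y u) x h = (\<Sum>i\<in>Basis. (u \<bullet> i) *\<^sub>R der (\<lambda>y. \<Phi> y i) x h)"
proof -
  have "((\<lambda>y. \<Sum>i\<in>Basis. (u \<bullet> i) *\<^sub>R \<Phi> y i) has_derivative
      (\<lambda>h. \<Sum>i\<in>Basis. (u \<bullet> i) *\<^sub>R der (\<lambda>y. \<Phi> y i) x h)) (at x)"
    by (intro has_derivative_sum has_derivative_scaleR_right Ck_on_open_has_derivative[OF sm U x])
  then have "((\<lambda>y. \<Phi> y u) has_derivative
      (\<lambda>h. \<Sum>i\<in>Basis. (u \<bullet> i) *\<^sub>R der (\<lambda>y. \<Phi> y i) x h)) (at x)"
    by (rule has_derivative_transform_within_open[OF _ U x]) (use linear_basis_expand[OF lin] in metis)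
  then show ?thesis by (simp add: frechet_eqI)
qed

lemma linear_family_frechet_linear:
  fixes \<Phi> :: "'a::euclidean_space \<Rightarrow> 'd::euclidean_space \<Rightarrow> 'c::real_normed_vector"
  assumes U: "open U" and lin: "\<And>y. y \<in> U \<Longrightarrow> linear (\<Phi> y)"
    and sm: "\<And>u. Ck_on (Suc 0) (\<lambda>y. \<Phi> y u) U" and x: "x \<in> U"
  shows "linear (\<lambda>u. der (\<lambda>y. \<Phi> y u) x h)"
  by (subst linear_family_frechet[OF U lin sm x], assumption)
    (intro linearI, auto simp: inner_add_left scaleR_add_left sum.distrib scaleR_sum_right)

lemma linear_family_derivative:
  fixes \<Phi> :: "'a::euclidean_space \<Rightarrow> 'd::euclidean_space \<Rightarrow> 'c::real_normed_vector"
    and y :: "'s::real_normed_vector \<Rightarrow> 'a"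
  assumes U: "open U" and lin: "\<And>y. y \<in> U \<Longrightarrow> linear (\<Phi> y)"
    and sm: "\<And>u. Ck_on (Suc 0) (\<lambda>y. \<Phi> y u) U"
    and y: "(y has_derivative y') (at s within S)" and q: "(q has_derivative q') (at s within S)"
    and s: "s \<in> S" and sub: "\<And>s. s \<in> S \<Longrightarrow> y s \<in> U"
  shows "((\<lambda>s. \<Phi> (y s) (q s)) has_derivative
    (\<lambda>h. der (\<lambda>y. \<Phi> y (q s)) (y s) (y' h) + \<Phi> (y s) (q' h))) (at s within S)"
proof -
  have d: "((\<lambda>s. \<Phi> (y s) i) has_derivative (\<lambda>h. der (\<lambda>y. \<Phi> y i) (y s) (y' h))) (at s within S)" for i
    using has_derivative_compose[OF y Ck_on_open_has_derivative[OF sm U sub[OF s]]] .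
  have "((\<lambda>s. \<Sum>i\<in>Basis. (q s \<bullet> i) *\<^sub>R \<Phi> (y s) i) has_derivative
    (\<lambda>h. \<Sum>i\<in>Basis. (q s \<bullet> i) *\<^sub>R der (\<lambda>y. \<Phi> y i) (y s) (y' h) + (q' h \<bullet> i) *\<^sub>R \<Phi> (y s) i)) (at s within S)"
    by (intro has_derivative_sum has_derivative_scaleR d has_derivative_inner_left q)
  then have "((\<lambda>s. \<Phi> (y s) (q s)) has_derivative
    (\<lambda>h. \<Sum>i\<in>Basis. (q s \<bullet> i) *\<^sub>R der (\<lambda>y. \<Phi> y i) (y s) (y' h) + (q' h \<bullet> i) *\<^sub>R \<Phi> (y s) i)) (at s within S)"
    by (rule has_derivative_transform[OF s, rotated]) (use linear_basis_expand[OF lin[OF sub]] in metis)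
  moreover have "der (\<lambda>y. \<Phi> y (q s)) (y s) (y' h) =
    (\<Sum>i\<in>Basis. (q s \<bullet> i) *\<^sub>R der (\<lambda>y. \<Phi> y i) (y s) (y' h))" for h
    by (rule linear_family_frechet[OF U lin sm sub[OF s]])
  moreover have "\<Phi> (y s) (q' h) = (\<Sum>i\<in>Basis. (q' h \<bullet> i) *\<^sub>R \<Phi> (y s) i)" for h
    by (rule linear_basis_expand[OF lin[OF sub[OF s]]])
  ultimately show ?thesis by (simp add: sum.distrib)
qed

lemma linear_family_Ck:
  fixes \<Phi> :: "'a::euclidean_space \<Rightarrow> 'd::euclidean_space \<Rightarrow> 'c::real_normed_vector"
    and y :: "'s::euclidean_space \<Rightarrow> 'a"
  assumes lin: "\<And>y. y \<in> U \<Longrightarrow> linear (\<Phi> y)"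
    and sm: "\<And>u. Ck_on k (\<lambda>y. \<Phi> y u) U"
    and S: "fat S" and y: "Ck_on k y S" and q: "Ck_on k q S" and sub: "\<And>s. s \<in> S \<Longrightarrow> y s \<in> U"
  shows "Ck_on k (\<lambda>s. \<Phi> (y s) (q s)) S"
proof -
  have "Ck_on k (\<lambda>s. \<Sum>i\<in>Basis. (q s \<bullet> i) *\<^sub>R \<Phi> (y s) i) S"
    by (intro Ck_on_sum Ck_on_scaleR S Ck_on_bounded_linear[OF bounded_linear_inner_left S q] Ck_on_compose[OF S sm y])
      (use sub in auto)
  then show ?thesis
    by (rule Ck_on_cong) (use linear_basis_expand[OF lin[OF sub]] in metis)
qed

text \<open>
  Coordinate form of the left-invariant fields in a chart with image \<open>U\<close>: \<open>E y u\<close> is the value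
  at \<open>y\<close> of the left-invariant field of \<open>u\<close>. All that is used of the group is that the bracket of two
  such fields is again one, with the same \<open>br\<close> at every point.
\<close>

locale invariant_frame =
  fixes U :: "'e::euclidean_space set" and E F :: "'e \<Rightarrow> 'e \<Rightarrow> 'e" and br :: "'e \<Rightarrow> 'e \<Rightarrow> 'e"
  assumes U: "open U"
    and E_linear: "y \<in> U \<Longrightarrow> linear (E y)" and F_linear: "y \<in> U \<Longrightarrow> linear (F y)"
    and EF: "y \<in> U \<Longrightarrow> E y (F y a) = a" and FE: "y \<in> U \<Longrightarrow> F y (E y a) = a"
    and E_smooth: "Ck_on k (\<lambda>y. E y u) U" and F_smooth: "Ck_on k (\<lambda>y. F y u) U"
    and bracket: "y \<in> U \<Longrightarrow> der (\<lambda>y. E y b) y (E y a)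
        - der (\<lambda>y. E y a) y (E y b) = E y (br a b)"
begin

abbreviation DE :: "'e \<Rightarrow> 'e \<Rightarrow> 'e \<Rightarrow> 'e" where
  "DE y h u \<equiv> der (\<lambda>y. E y u) y h"

lemma E_derivative: "y \<in> U \<Longrightarrow> ((\<lambda>y. E y u) has_derivative (\<lambda>h. DE y h u)) (at y)"
  using Ck_on_open_has_derivative[OF E_smooth U] by simp

lemma DE_linear1: "y \<in> U \<Longrightarrow> linear (\<lambda>h. DE y h u)"
  using has_derivative_linear[OF E_derivative] by simp

lemma DE_linear2: "y \<in> U \<Longrightarrow> linear (DE y h)"
  using linear_family_frechet_linear[OF U E_linear E_smooth] by simp

lemma E_inj: "y \<in> U \<Longrightarrow> E y a = E y b \<Longrightarrow> a = b"
  using FE by metis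

lemma br_eq: "y \<in> U \<Longrightarrow> br a b = F y (DE y (E y a) b - DE y (E y b) a)"
  using bracket FE by metis

lemma br_bilinear: assumes y: "y \<in> U" shows "bilinear br"
  unfolding bilinear_def
  by (intro conjI allI linearI; rule E_inj[OF y];
      simp add: bracket[OF y, symmetric] linear_add[OF E_linear[OF y]] linear_scale[OF E_linear[OF y]]
        linear_add[OF DE_linear1[OF y]] linear_scale[OF DE_linear1[OF y]]
        linear_add[OF DE_linear2[OF y]] linear_scale[OF DE_linear2[OF y]] scaleR_diff_right)

lemma br_antisym: assumes y: "y \<in> U" shows "br a b = - br b a"
  by (rule E_inj[OF y]) (simp add: linear_neg[OF E_linear[OF y]] flip: bracket[OF y])

text \<open>
  Differentiate the bracket relation \<open>DE(E a) b - DE(E b) a = E [a,b]\<close> in the direction \<open>E s\<close> and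
  sum cyclically: the second derivatives of \<open>E\<close> cancel by symmetry.
\<close>

lemma br_jacobi: assumes y: "y \<in> U" shows "br (br a b) s + br (br b s) a + br (br s a) b = 0"
proof -
  define P where "P a b = DE y (E y a) b" for a b
  define T where "T u a b = der (\<lambda>x. DE x (E y a) u) y (E y b)" for u a b
  have T_sym: "T u a b = T u b a" for u a b
    unfolding T_def using mixed_derivative_symmetric[OF E_smooth U y] by blast
  have P_br: "P a b - P b a = E y (br a b)" for a b
    unfolding P_def by (rule bracket[OF y])
  have X: "DE y (P a b) u - DE y (P b a) u = P (br a b) u" for a b u
    unfolding P_def[of "br a b"] P_br[symmetric] by (simp add: linear_diff[OF DE_linear1[OF y]])
  have D: "((\<lambda>x. DE x (E x a) u) has_derivative
      (\<lambda>h. der (\<lambda>x. DE x (E y a) u) y h + DE y (DE y h a) u)) (at y)" for a u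
    using linear_family_derivative[OF U, of "\<lambda>x h. DE x h u" "\<lambda>x. x" "\<lambda>h. h" y U "\<lambda>x. E x a" "\<lambda>h. DE y h a"]
      DE_linear1 Ck_on_open_frechet[OF E_smooth U] E_derivative[OF y] y at_within_open[OF y U]
    by (simp del: Ck_on.simps)
  have main: "T b a s + DE y (P s a) b - (T a b s + DE y (P s b) a) = P s (br a b)" for a b s
  proof -
    have "((\<lambda>x. DE x (E x a) b - DE x (E x b) a) has_derivative
      (\<lambda>h. (der (\<lambda>x. DE x (E y a) b) y h + DE y (DE y h a) b) -
        (der (\<lambda>x. DE x (E y b) a) y h + DE y (DE y h b) a))) (at y)"
      by (intro has_derivative_diff D)
    then have "((\<lambda>x. E x (br a b)) has_derivative
      (\<lambda>h. (der (\<lambda>x. DE x (E y a) b) y h + DE y (DE y h a) b) -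
        (der (\<lambda>x. DE x (E y b) a) y h + DE y (DE y h b) a))) (at y)"
      by (rule has_derivative_transform_within_open[OF _ U y]) (rule bracket)
    from fun_cong[OF frechet_eqI[OF this], of "E y s"] show ?thesis
      by (simp add: T_def P_def)
  qed
  have "P (br a b) s + P (br b s) a + P (br s a) b = P s (br a b) + P a (br b s) + P b (br s a)"
  proof -
    have "P s (br a b) + P a (br b s) + P b (br s a) =
      (T b a s + DE y (P s a) b - (T a b s + DE y (P s b) a)) +
      (T s b a + DE y (P a b) s - (T b s a + DE y (P a s) b)) +
      (T a s b + DE y (P b s) a - (T s a b + DE y (P b a) s))"
      by (simp only: main)
    also have "\<dots> = (DE y (P a b) s - DE y (P b a) s) + (DE y (P b s) a - DE y (P s b) a)
      + (DE y (P s a) b - DE y (P a s) b)"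
      using T_sym[of b a s] T_sym[of a b s] T_sym[of s a b] by simp
    finally show ?thesis by (simp only: X)
  qed
  then have "E y (br (br a b) s + br (br b s) a + br (br s a) b) = 0"
    unfolding linear_add[OF E_linear[OF y]] P_br[symmetric] by (simp add: algebra_simps)
  then show ?thesis using E_inj[OF y, of _ 0] linear_0[OF E_linear[OF y]] by simp
qed

end

locale metric_frame = invariant_frame U E F br + metric_lie_algebra br I
  for U :: "'e::euclidean_space set" and E F br I
begin

text \<open>
  The metric \<open>h\<close> is the one that makes every \<open>E y\<close> an isometry. As its Christoffel symbols \<open>\<Gamma>\<close> are
  determined by Koszul's formula, it suffices to compute the derivatives of the metric on frame
  vectors: \<open>(D\<^bsub>E s\<^esub> h)(E a, E b) = - I (Q s a) b - I a (Q s b)\<close> with \<open>Q s a = F (DE (E s) a)\<close>.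
\<close>

lemma christoffel_frame:
  assumes z: "z \<in> U"
  defines "h \<equiv> \<lambda>y a b. I (F y a) (F y b)"
  assumes \<Gamma>: "\<Gamma> = (THE \<Gamma>. levi_civita_symbol (h z) (\<lambda>w a b. der (\<lambda>y. h y a b) z w) \<Gamma>)"
  shows "bilinear \<Gamma>" and "E z (nab a b) = DE z (E z a) b + \<Gamma> (E z a) (E z b)"
proof -
  define DF where "DF w a = der (\<lambda>y. F y a) z w" for w a
  define dh where "dh w a b = der (\<lambda>y. h y a b) z w" for w a b
  have DF: "((\<lambda>y. F y a) has_derivative (\<lambda>w. DF w a)) (at z)" for a
    unfolding DF_def using Ck_on_open_has_derivative[OF F_smooth U z] by simp
  have DF1: "linear (\<lambda>w. DF w a)" for a using has_derivative_linear[OF DF] by simp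
  have DF2: "linear (DF w)" for w
    unfolding DF_def using linear_family_frechet_linear[OF U F_linear F_smooth z] by simp
  have dh: "dh w a b = I (F z a) (DF w b) + I (DF w a) (F z b)" for w a b
    unfolding dh_def h_def
    using frechet_eqI[OF bounded_bilinear.FDERIV[OF I_bounded_bilinear DF DF, of a b]] by simp
  have hz: "inner_product (h z)"
    unfolding inner_product_def
  proof (intro conjI allI impI)
    show "bilinear (h z)"
      unfolding bilinear_def h_def
      by (auto intro!: linearI simp: I_simps linear_add[OF F_linear[OF z]] linear_scale[OF F_linear[OF z]])
    show "h z u w = h z w u" for u w unfolding h_def by (rule I_sym)
    show "0 < h z u u" if "u \<noteq> 0" for u
    proof -
      have "F z u \<noteq> 0" using that EF[OF z, of u] linear_0[OF E_linear[OF z]] by auto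
      then show ?thesis using I unfolding h_def inner_product_def by blast
    qed
  qed
  have lin: "linear (\<lambda>w. dh w a b)" "linear (\<lambda>a. dh w a b)" and sym: "dh w a b = dh w b a" for w a b
    unfolding dh
    by (auto intro!: linearI simp: I_simps linear_add[OF F_linear[OF z]] linear_scale[OF F_linear[OF z]]
      linear_add[OF DF1] linear_scale[OF DF1] linear_add[OF DF2] linear_scale[OF DF2] algebra_simps I_sym)
  have LC: "levi_civita_symbol (h z) dh \<Gamma>"
    using theI'[OF levi_civita_symbol_ex1[OF hz lin sym]] unfolding \<Gamma> dh_def[abs_def] .
  then show "bilinear \<Gamma>" by (simp add: levi_civita_symbol_def)
  have koszul: "h z (\<Gamma> a b) w = (dh a b w + dh b a w - dh w a b) / 2" for a b w
    using LC levi_civita_symbol_iff_koszul[OF hz lin sym] by blast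
  define Q where "Q s a = F z (DE z (E z s) a)" for s a
  have DFE: "DF (E z s) (E z a) = - Q s a" for s a
  proof -
    have "((\<lambda>y. F y (E y a)) has_derivative (\<lambda>h. DF h (E z a) + F z (DE z h a))) (at z)"
      using linear_family_derivative[OF U F_linear F_smooth, where S = U and s = z and y = "\<lambda>x. x" and y' = "\<lambda>h. h"
          and q = "\<lambda>y. E y a" and q' = "\<lambda>h. DE z h a"]
        z at_within_open[OF z U] E_derivative[OF z, of a]
      unfolding DF_def by (simp del: Ck_on.simps)
    then have "((\<lambda>y. a) has_derivative (\<lambda>h. DF h (E z a) + F z (DE z h a))) (at z)"
      by (rule has_derivative_transform_within_open[OF _ U z]) (simp add: FE)
    from fun_cong[OF has_derivative_unique[OF has_derivative_const this], of "E z s"]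
    have "DF (E z s) (E z a) + Q s a = 0" by (simp add: Q_def)
    then show ?thesis by (simp add: eq_neg_iff_add_eq_0)
  qed
  have Q_br: "br a b = Q a b - Q b a" for a b
    unfolding Q_def br_eq[OF z, of a b] by (simp add: linear_diff[OF F_linear[OF z]])
  have "F z (DE z (E z a) b + \<Gamma> (E z a) (E z b)) = nab a b"
  proof (rule I_eqI)
    fix w
    have "I (F z (\<Gamma> (E z a) (E z b))) w = h z (\<Gamma> (E z a) (E z b)) (E z w)"
      by (simp add: h_def FE[OF z])
    also have "\<dots> = (- I b (Q a w) - I (Q a b) w - I a (Q b w) - I (Q b a) w + I a (Q w b) + I (Q w a) b) / 2"
      unfolding koszul dh DFE FE[OF z] by (simp add: I_simps)
    finally have "I (F z (DE z (E z a) b + \<Gamma> (E z a) (E z b))) w =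
      I (Q a b) w + (- I b (Q a w) - I (Q a b) w - I a (Q b w) - I (Q b a) w + I a (Q w b) + I b (Q w a)) / 2"
      by (simp add: linear_add[OF F_linear[OF z]] I_simps Q_def I_sym[of _ b])
    then show "I (F z (DE z (E z a) b + \<Gamma> (E z a) (E z b))) w = I (nab a b) w"
      unfolding I_nab Q_br I_simps by (simp add: field_simps)
  qed
  then show "E z (nab a b) = DE z (E z a) b + \<Gamma> (E z a) (E z b)"
    using EF[OF z] by metis
qed

end

section \<open>The first variation in a chart\<close>

lemma slice_snd: "(f has_derivative f') (at (a, b)) \<Longrightarrow> ((\<lambda>y. f (a, y)) has_derivative (\<lambda>h. f' (0, h))) (at b)"
  by (rule has_derivative_compose[where g = f and f = "\<lambda>y. (a, y)"]) (auto intro!: derivative_eq_intros)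

lemma slice_derivatives:
  fixes r t :: real
  assumes f: "(f has_derivative f') (at (r, t))"
  shows "((\<lambda>t. f (r, t)) has_vector_derivative f' (0, 1)) (at t)"
    and "((\<lambda>r. f (r, t)) has_vector_derivative f' (1, 0)) (at r)"
proof -
  note lin = linear_scale[OF has_derivative_linear[OF f]]
  have "((\<lambda>t. (r, t)) has_derivative (\<lambda>h. (0, h))) (at t)" "((\<lambda>r. (r, t)) has_derivative (\<lambda>h. (h, 0))) (at r)"
    by (auto intro!: derivative_eq_intros)
  note d = this[THEN has_derivative_compose, OF f]
  have "(\<lambda>h. f' (0, h)) = (\<lambda>h. h *\<^sub>R f' (0, 1))"
  proof
    fix h show "f' (0, h) = h *\<^sub>R f' (0, 1)" using lin[of h "(0, 1)"] by simp
  qed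
  with d(1) show "((\<lambda>t. f (r, t)) has_vector_derivative f' (0, 1)) (at t)"
    unfolding has_vector_derivative_def by (simp only:)
  have "(\<lambda>h. f' (h, 0)) = (\<lambda>h. h *\<^sub>R f' (1, 0))"
  proof
    fix h show "f' (h, 0) = h *\<^sub>R f' (1, 0)" using lin[of h "(1, 0)"] by simp
  qed
  with d(2) show "((\<lambda>r. f (r, t)) has_vector_derivative f' (1, 0)) (at r)"
    unfolding has_vector_derivative_def by (simp only:)
qed

lemma Ck_on_open_vector_derivative:
  fixes f :: "real \<Rightarrow> 'b::real_normed_vector"
  assumes "Ck_on (Suc k) f U" "open U"
  shows "\<And>t. t \<in> U \<Longrightarrow> (f has_vector_derivative vector_derivative f (at t)) (at t)"
    and "Ck_on k (\<lambda>t. vector_derivative f (at t)) U"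
proof -
  note * = Ck_on_vector_derivative[OF assms(1) fat_open[OF assms(2)]]
  show "(f has_vector_derivative vector_derivative f (at t)) (at t)" if "t \<in> U" for t
    using *(1)[OF that] at_within_open[OF that assms(2)] by simp
  show "Ck_on k (\<lambda>t. vector_derivative f (at t)) U"
    by (rule Ck_on_cong[OF *(2)]) (simp add: at_within_open[OF _ assms(2)])
qed

context metric_frame
begin

text \<open>
  The variation moves the curve \<open>xt\<close> in the direction \<open>\<phi> w\<^sub>L\<close>. The body velocity \<open>W\<close> of the varied
  curves and the left-trivialized variation field \<open>X\<close> satisfy \<open>\<partial>\<^sub>r W = \<partial>\<^sub>t X + [W, X]\<close>, and \<open>X = \<phi> w\<close>
  at \<open>r = 0\<close>; with this, differentiation under the integral and integration by parts give the
  first variation.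
\<close>

lemma first_variation:
  fixes \<sigma> :: real and w :: 'e and xt :: "real \<Rightarrow> 'e" and \<phi> :: "real \<Rightarrow> real" and \<Psi> :: "'e \<Rightarrow> real"
  assumes ord: "p < a" "a < a'" "a' < b'" "b' < b" "b < q"
    and xt: "smooth_on xt {p<..<q}" and xtU: "\<And>t. t \<in> {p<..<q} \<Longrightarrow> xt t \<in> U"
    and \<phi>: "smooth_on \<phi> UNIV" and supp: "\<And>t. t \<notin> {a'..b'} \<Longrightarrow> \<phi> t = 0"
    and \<epsilon>: "\<epsilon> > 0"
    and inU: "\<And>r t. r \<in> {-\<epsilon><..<\<epsilon>} \<Longrightarrow> t \<in> {p<..<q} \<Longrightarrow> xt t + r *\<^sub>R \<phi> t *\<^sub>R E (xt t) w \<in> U"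
    and \<Psi>: "Ck_on 2 \<Psi> U"
  defines "y \<equiv> \<lambda>r t. xt t + r *\<^sub>R \<phi> t *\<^sub>R E (xt t) w"
  defines "W \<equiv> \<lambda>r t. F (y r t) (vector_derivative (y r) (at t))"
  defines "L \<equiv> \<lambda>r t. 1/2 * (I (vector_derivative (W r) (at t) + nab (W r t) (W r t)) (vector_derivative (W r) (at t) + nab (W r t) (W r t))
      + \<sigma> * I (W r t) (W r t) + \<Psi> (y r t))"
  defines "v \<equiv> \<lambda>t. F (xt t) (vector_derivative xt (at t))"
  defines "v1 \<equiv> \<lambda>t. vector_derivative v (at t)"
  defines "v2 \<equiv> \<lambda>t. vector_derivative v1 (at t)"
  defines "v3 \<equiv> \<lambda>t. vector_derivative v2 (at t)"
  shows "\<And>r. r \<in> {-\<epsilon><..<\<epsilon>} \<Longrightarrow> L r integrable_on {a..b}"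
    and "((\<lambda>r. integral {a..b} (L r)) has_real_derivative
      integral {a..b} (\<lambda>t. \<phi> t * (I (EL \<sigma> (v t) (v1 t) (v2 t) (v3 t)) w
        + 1/2 * der \<Psi> (xt t) (E (xt t) w)))) (at 0)"
proof -
  define J where "J = {p<..<q}"
  define Q where "Q = {-\<epsilon><..<\<epsilon>} \<times> J"
  have J: "open J" "fat J" unfolding J_def by (auto intro: fat_open)
  have Q: "open Q" "fat Q" unfolding Q_def using J by (auto intro!: fat_open open_Times)
  have abJ: "{a..b} \<subseteq> J" using ord by (auto simp: J_def)
  have sndQ: "snd ` Q \<subseteq> J" by (auto simp: Q_def)
  have xk: "Ck_on k xt J" for k using xt by (simp add: smooth_on_def J_def)
  have \<phi>k: "Ck_on k \<phi> J" for k
    by (rule Ck_on_subset[OF _ _ J(2)]) (use \<phi> in \<open>auto simp: smooth_on_def\<close>)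
  have xtJ: "xt ` J \<subseteq> U" using xtU by (auto simp: J_def)
  define \<eta> where "\<eta> = (\<lambda>t. \<phi> t *\<^sub>R E (xt t) w)"
  have \<eta>k: "Ck_on k \<eta> J" for k
    unfolding \<eta>_def using xtU
    by (intro Ck_on_scaleR J \<phi>k Ck_on_compose[OF J(2) E_smooth xk]) (auto simp: J_def)
  define x1 where "x1 = (\<lambda>t. vector_derivative xt (at t))"
  define \<eta>1 where "\<eta>1 = (\<lambda>t. vector_derivative \<eta> (at t))"
  define \<phi>1 where "\<phi>1 = (\<lambda>t. vector_derivative \<phi> (at t))"
  define \<phi>2 where "\<phi>2 = (\<lambda>t. vector_derivative \<phi>1 (at t))"
  note D = Ck_on_open_vector_derivative[OF _ J(1)]
  have x1: "(xt has_vector_derivative x1 t) (at t)" if "t \<in> J" for t unfolding x1_def by (rule D(1)[OF xk that])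
  have x1k: "Ck_on k x1 J" for k unfolding x1_def by (rule D(2)[OF xk])
  have \<eta>1: "(\<eta> has_vector_derivative \<eta>1 t) (at t)" if "t \<in> J" for t unfolding \<eta>1_def by (rule D(1)[OF \<eta>k that])
  have \<eta>1k: "Ck_on k \<eta>1 J" for k unfolding \<eta>1_def by (rule D(2)[OF \<eta>k])
  have \<phi>1: "(\<phi> has_vector_derivative \<phi>1 t) (at t)" if "t \<in> J" for t unfolding \<phi>1_def by (rule D(1)[OF \<phi>k that])
  have \<phi>1k: "Ck_on k \<phi>1 J" for k unfolding \<phi>1_def by (rule D(2)[OF \<phi>k])
  have \<phi>2: "(\<phi>1 has_vector_derivative \<phi>2 t) (at t)" if "t \<in> J" for t unfolding \<phi>2_def by (rule D(1)[OF \<phi>1k that])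
  have onQ: "Ck_on k (\<lambda>z. f (snd z)) Q" if "\<And>k. Ck_on k f J" for k and f :: "real \<Rightarrow> 'd::real_normed_vector"
    by (rule Ck_on_compose[OF Q(2) that Ck_on_snd[OF Q(2)] sndQ])

  define Y where "Y = (\<lambda>z. xt (snd z) + fst z *\<^sub>R \<eta> (snd z))"
  define YT where "YT = (\<lambda>z. x1 (snd z) + fst z *\<^sub>R \<eta>1 (snd z))"
  have Yk: "Ck_on k Y Q" for k
    unfolding Y_def by (intro Ck_on_add Ck_on_scaleR Q Ck_on_fst onQ xk \<eta>k)
  have YTk: "Ck_on k YT Q" for k
    unfolding YT_def by (intro Ck_on_add Ck_on_scaleR Q Ck_on_fst onQ x1k \<eta>1k)
  have YU: "Y z \<in> U" if "z \<in> Q" for z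
    using that inU[of "fst z" "snd z"] by (auto simp: Y_def \<eta>_def Q_def J_def)
  have yY: "y r t = Y (r, t)" for r t by (simp add: y_def Y_def \<eta>_def)
  have y_t: "(y r has_vector_derivative YT (r, t)) (at t)" if "t \<in> J" for r t
  proof -
    have "((\<lambda>t. xt t + r *\<^sub>R \<eta> t) has_vector_derivative (x1 t + r *\<^sub>R \<eta>1 t)) (at t)"
      by (intro has_vector_derivative_add x1 that bounded_linear.has_vector_derivative[OF bounded_linear_scaleR_right] \<eta>1)
    then show ?thesis by (simp add: y_def YT_def \<eta>_def)
  qed
  define WW where "WW = (\<lambda>z. F (Y z) (YT z))"
  define X where "X = (\<lambda>z. F (Y z) (\<eta> (snd z)))"
  have WWk: "Ck_on k WW Q" for k
    unfolding WW_def by (rule linear_family_Ck[OF F_linear F_smooth Q(2) Yk YTk YU])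
  have Xk: "Ck_on k X Q" for k
    unfolding X_def by (rule linear_family_Ck[OF F_linear F_smooth Q(2) Yk onQ[OF \<eta>k] YU])
  have W_WW: "W r t = WW (r, t)" if "t \<in> J" for r t
    unfolding W_def WW_def yY using vector_derivative_at[OF y_t[OF that, of r]] by (simp add: yY[abs_def])
  let ?D = "\<lambda>f z. der f z"
  have dQ: "(f has_derivative ?D f z) (at z)" if "\<And>k. Ck_on k f Q" "z \<in> Q" for f z
    by (rule Ck_on_open_has_derivative[OF that(1) Q(1) that(2)])
  have dQk: "Ck_on k (\<lambda>z. ?D f z h) Q" if "\<And>k. Ck_on k f Q" for f h k
    by (rule Ck_on_open_frechet[OF that Q(1)])
  have slice_t: "((\<lambda>t. f (r, t)) has_vector_derivative ?D f (r, t) (0, 1)) (at t)"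
    and slice_r: "((\<lambda>r. f (r, t)) has_vector_derivative ?D f (r, t) (1, 0)) (at r)"
    if "\<And>k. Ck_on k f Q" "(r, t) \<in> Q" for f :: "real \<times> real \<Rightarrow> 'd::real_normed_vector" and r t
    using slice_derivatives[OF Ck_on_open_has_derivative[OF that(1) Q(1) that(2)]] by auto

  have Y_r: "?D Y z (1, 0) = \<eta> (snd z)" if "z \<in> Q" for z
  proof -
    obtain r t where z: "z = (r, t)" by force
    have "((\<lambda>r. xt t + r *\<^sub>R \<eta> t) has_vector_derivative 0 + \<eta> t) (at r)"
      by (intro has_vector_derivative_add has_vector_derivative_const) (auto intro!: derivative_eq_intros)
    then show ?thesis
      using slice_r[OF Yk, of r t] that vector_derivative_unique_at unfolding z by (fastforce simp: Y_def)
  qed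
  have Y_t: "?D Y z (0, 1) = YT z" if "z \<in> Q" for z
  proof -
    obtain r t where z: "z = (r, t)" by force
    show ?thesis
      using slice_t[OF Yk, of r t] y_t[of t r] that vector_derivative_unique_at unfolding z
      by (auto simp: Q_def yY[abs_def])
  qed
  have YT_r: "?D YT z (1, 0) = \<eta>1 (snd z)" if "z \<in> Q" for z
  proof -
    obtain r t where z: "z = (r, t)" by force
    have "((\<lambda>r. x1 t + r *\<^sub>R \<eta>1 t) has_vector_derivative 0 + \<eta>1 t) (at r)"
      by (intro has_vector_derivative_add has_vector_derivative_const) (auto intro!: derivative_eq_intros)
    then show ?thesis
      using slice_r[OF YTk, of r t] that vector_derivative_unique_at unfolding z by (fastforce simp: YT_def)
  qed
  have \<eta>_t: "?D (\<lambda>z. \<eta> (snd z)) z (0, 1) = \<eta>1 (snd z)" if "z \<in> Q" for z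
  proof -
    obtain r t where z: "z = (r, t)" by force
    show ?thesis
      using slice_t[OF onQ[OF \<eta>k], of r t] \<eta>1[of t] that vector_derivative_unique_at unfolding z
      by (auto simp: Q_def)
  qed

  have EDer: "?D (\<lambda>z. E (Y z) (f z)) z h = DE (Y z) (?D Y z h) (f z) + E (Y z) (?D f z h)"
    if "\<And>k. Ck_on k f Q" "z \<in> Q" for f z h
    using frechet_eqI[OF linear_family_derivative[OF U E_linear E_smooth, where S = Q and s = z and y = Y and q = f,
        unfolded at_within_open[OF that(2) Q(1)], OF _ dQ[OF Yk that(2)] dQ[OF that] that(2) YU]] by simp
  have frechet_cong: "?D f z = ?D g z" if "\<And>z. z \<in> Q \<Longrightarrow> f z = g z" "\<And>k. Ck_on k f Q" "z \<in> Q"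
    for f g :: "real \<times> real \<Rightarrow> 'e" and z
    by (rule frechet_derivative_transform_within_open[OF differentiableI[OF dQ[OF that(2,3)]] Q(1) that(3)])
      (use that in auto)

  \<comment> \<open>Both \<open>\<partial>\<^sub>r YT\<close> and \<open>\<partial>\<^sub>t \<eta>\<close> are the mixed derivative of \<open>Y\<close>; written in the frame, their equality
    becomes the structure equation \<open>\<partial>\<^sub>r WW = \<partial>\<^sub>t X + [WW, X]\<close>.\<close>
  have W_r: "?D WW z (1, 0) = ?D X z (0, 1) + br (WW z) (X z)" if z: "z \<in> Q" for z
  proof -
    have EW: "E (Y z) (WW z) = YT z" and EX: "E (Y z) (X z) = \<eta> (snd z)" if "z \<in> Q" for z
      unfolding WW_def X_def by (rule EF[OF YU[OF that]])+
    have 1: "\<eta>1 (snd z) = DE (Y z) (E (Y z) (X z)) (WW z) + E (Y z) (?D WW z (1, 0))"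
    proof -
      have "?D YT z = ?D (\<lambda>z. E (Y z) (WW z)) z" by (rule frechet_cong[OF _ YTk z]) (simp add: EW)
      then show ?thesis using EDer[OF WWk z, of "(1, 0)"] YT_r[OF z] Y_r[OF z] EX[OF z] by simp
    qed
    have 2: "\<eta>1 (snd z) = DE (Y z) (E (Y z) (WW z)) (X z) + E (Y z) (?D X z (0, 1))"
    proof -
      have "?D (\<lambda>z. \<eta> (snd z)) z = ?D (\<lambda>z. E (Y z) (X z)) z" by (rule frechet_cong[OF _ onQ[OF \<eta>k] z]) (simp add: EX)
      then show ?thesis using EDer[OF Xk z, of "(0, 1)"] \<eta>_t[OF z] Y_t[OF z] EW[OF z] by simp
    qed
    have "E (Y z) (?D WW z (1, 0)) = E (Y z) (?D X z (0, 1)) + E (Y z) (br (WW z) (X z))"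
      using 1 2 bracket[OF YU[OF z], of "X z" "WW z"] by (simp add: algebra_simps)
    then show ?thesis
      using E_inj[OF YU[OF z]] linear_add[OF E_linear[OF YU[OF z]]] by metis
  qed

  define Wt where "Wt = (\<lambda>z. ?D WW z (0, 1))"
  define Wr where "Wr = (\<lambda>z. ?D WW z (1, 0))"
  have Wtk: "Ck_on k Wt Q" and Wrk: "Ck_on k Wr Q" for k
    unfolding Wt_def Wr_def by (rule dQk[OF WWk])+
  define A where "A = (\<lambda>z. Wt z + nab (WW z) (WW z))"
  have Ak: "Ck_on k A Q" for k
    unfolding A_def by (intro Ck_on_add Q Wtk Ck_on_bilinear[OF nab_bounded_bilinear Q(2)] WWk)
  have \<Psi>Y: "Ck_on 2 (\<lambda>z. \<Psi> (Y z)) Q" by (rule Ck_on_compose[OF Q(2) \<Psi> Yk]) (use YU in auto)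
  define LL where "LL = (\<lambda>z. (1/2) *\<^sub>R (I (A z) (A z) + \<sigma> *\<^sub>R I (WW z) (WW z) + \<Psi> (Y z)))"
  have LLk: "Ck_on 2 LL Q"
    unfolding LL_def
    by (intro Ck_on_scaleR Ck_on_const Ck_on_add Q Ck_on_bilinear[OF I_bounded_bilinear Q(2)] Ak WWk \<Psi>Y)
  have LL1: "Ck_on (Suc (Suc 0)) LL Q" using LLk by (simp add: numeral_2_eq_2)
  have W_t: "vector_derivative (W r) (at t) = Wt (r, t)" if "(r, t) \<in> Q" for r t
  proof -
    have "((\<lambda>t. WW (r, t)) has_vector_derivative Wt (r, t)) (at t)"
      unfolding Wt_def by (rule slice_t[OF WWk that])
    then have "(W r has_vector_derivative Wt (r, t)) (at t)"
      by (rule has_vector_derivative_transform_within_open[OF _ J(1)]) (use that W_WW in \<open>auto simp: Q_def\<close>)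
    then show ?thesis by (rule vector_derivative_at)
  qed
  have L_LL: "L r t = LL (r, t)" if "(r, t) \<in> Q" for r t
    using that W_WW[of t r] W_t[OF that] unfolding L_def LL_def A_def yY by (auto simp: Q_def)

  have zeroQ: "(0, t) \<in> Q" if "t \<in> J" for t using that \<epsilon> by (simp add: Q_def)
  have int: "LL_int r" if "LL_int = (\<lambda>r. (\<lambda>t. LL (r, t)) integrable_on {a..b})" "r \<in> {-\<epsilon><..<\<epsilon>}" for r LL_int
    unfolding that(1)
    by (intro integrable_continuous_real continuous_on_compose2[OF Ck_on_continuous[OF LLk]] continuous_intros)
      (use that abJ in \<open>auto simp: Q_def\<close>)
  then have intLL: "(\<lambda>t. LL (r, t)) integrable_on {a..b}" if "r \<in> {-\<epsilon><..<\<epsilon>}" for r using that by blast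
  show intL: "L r integrable_on {a..b}" if "r \<in> {-\<epsilon><..<\<epsilon>}" for r
    by (rule integrable_eq[OF intLL[OF that]]) (use that abJ L_LL in \<open>auto simp: Q_def\<close>)

  have leib: "((\<lambda>r. integral (cbox a b) (\<lambda>t. LL (r, t))) has_field_derivative
      integral (cbox a b) (\<lambda>t. ?D LL (0, t) (1, 0))) (at 0 within {-\<epsilon><..<\<epsilon>})"
  proof (rule leibniz_rule_field_derivative[where fx = "\<lambda>r t. ?D LL (r, t) (1, 0)"])
    show "((\<lambda>r. LL (r, t)) has_field_derivative ?D LL (r, t) (1, 0)) (at r within {-\<epsilon><..<\<epsilon>})"
      if "r \<in> {-\<epsilon><..<\<epsilon>}" "t \<in> cbox a b" for r t
    proof -
      have "(r, t) \<in> Q" using that abJ by (auto simp: Q_def)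
      then have "((\<lambda>r. LL (r, t)) has_real_derivative ?D LL (r, t) (1, 0)) (at r)"
        unfolding has_real_derivative_iff_has_vector_derivative
        by (rule slice_derivatives(2)[OF Ck_on_open_has_derivative[OF LL1 Q(1)]])
      then show ?thesis by (rule has_field_derivative_at_within)
    qed
    show "(\<lambda>t. LL (r, t)) integrable_on cbox a b" if "r \<in> {-\<epsilon><..<\<epsilon>}" for r using intLL[OF that] by simp
    have "continuous_on Q (\<lambda>z. ?D LL z (1, 0))"
      by (rule Ck_on_continuous[OF Ck_on_open_frechet[OF LL1 Q(1)]])
    then show "continuous_on ({-\<epsilon><..<\<epsilon>} \<times> cbox a b) (\<lambda>(r, t). ?D LL (r, t) (1, 0))"
      by (rule continuous_on_subset[THEN continuous_on_eq]) (use abJ in \<open>auto simp: Q_def\<close>)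
  qed (use \<epsilon> in auto)
  have "((\<lambda>r. integral {a..b} (\<lambda>t. LL (r, t))) has_real_derivative integral {a..b} (\<lambda>t. ?D LL (0, t) (1, 0))) (at 0)"
    using leib at_within_open[of 0 "{-\<epsilon><..<\<epsilon>}"] \<epsilon> by simp
  then have dL: "((\<lambda>r. integral {a..b} (L r)) has_real_derivative integral {a..b} (\<lambda>t. ?D LL (0, t) (1, 0))) (at 0)"
    by (rule has_field_derivative_transform_within_open[of _ _ _ "{-\<epsilon><..<\<epsilon>}"])
      (use \<epsilon> abJ L_LL in \<open>auto intro!: integral_cong simp: Q_def\<close>)

  have v_WW: "v t = WW (0, t)" if "t \<in> J" for t by (simp add: v_def WW_def Y_def YT_def x1_def)
  have vk: "Ck_on k v J" for k
    unfolding v_def x1_def[symmetric]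
    by (rule linear_family_Ck[OF F_linear F_smooth J(2) xk]) (use x1k xtU in \<open>auto simp: x1_def J_def\<close>)
  have v1k: "Ck_on k v1 J" for k unfolding v1_def by (rule D(2)[OF vk])
  have v2k: "Ck_on k v2 J" for k unfolding v2_def by (rule D(2)[OF v1k])
  have v3k: "Ck_on k v3 J" for k unfolding v3_def by (rule D(2)[OF v2k])
  have dv: "(v has_vector_derivative v1 t) (at t)" "(v1 has_vector_derivative v2 t) (at t)"
    "(v2 has_vector_derivative v3 t) (at t)" if "t \<in> J" for t
    using D(1)[OF vk that] D(1)[OF v1k that] D(1)[OF v2k that] by (simp_all add: v1_def v2_def v3_def)
  have Wt0: "Wt (0, t) = v1 t" if "t \<in> J" for t
  proof -
    have "((\<lambda>t. WW (0, t)) has_vector_derivative Wt (0, t)) (at t)"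
      unfolding Wt_def by (rule slice_t[OF WWk zeroQ[OF that]])
    then have "(v has_vector_derivative Wt (0, t)) (at t)"
      by (rule has_vector_derivative_transform_within_open[OF _ J(1) that]) (simp add: v_WW)
    then show ?thesis using dv(1)[OF that] vector_derivative_unique_at by metis
  qed
  have X0: "X (0, t) = \<phi> t *\<^sub>R w" if "t \<in> J" for t
    using that xtU FE linear_scale[OF F_linear] by (simp add: X_def Y_def \<eta>_def J_def)
  have Xt0: "?D X (0, t) (0, 1) = \<phi>1 t *\<^sub>R w" if "t \<in> J" for t
  proof -
    have "((\<lambda>t. \<phi> t *\<^sub>R w) has_vector_derivative \<phi>1 t *\<^sub>R w) (at t)"
      by (rule bounded_linear.has_vector_derivative[OF bounded_linear_scaleR_left \<phi>1[OF that]])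
    then have "((\<lambda>t. X (0, t)) has_vector_derivative \<phi>1 t *\<^sub>R w) (at t)"
      by (rule has_vector_derivative_transform_within_open[OF _ J(1) that]) (simp add: X0)
    then show ?thesis using slice_t[OF Xk zeroQ[OF that]] vector_derivative_unique_at by metis
  qed
  have Wr0: "Wr (0, t) = \<phi>1 t *\<^sub>R w + br (v t) (\<phi> t *\<^sub>R w)" if "t \<in> J" for t
    unfolding Wr_def W_r[OF zeroQ[OF that]] using that by (simp add: Xt0 X0 v_WW)
  \<comment> \<open>Exchanging \<open>\<partial>\<^sub>r\<close> and \<open>\<partial>\<^sub>t\<close> reduces this to the derivative in \<open>t\<close> of the formula for \<open>\<partial>\<^sub>r WW\<close> at \<open>r = 0\<close>.\<close>
  have Wtr0: "?D Wt (0, t) (1, 0) = \<phi>2 t *\<^sub>R w + br (v1 t) (\<phi> t *\<^sub>R w) + br (v t) (\<phi>1 t *\<^sub>R w)" if t: "t \<in> J" for t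
  proof -
    have "?D Wt (0, t) (1, 0) = ?D Wr (0, t) (0, 1)"
      unfolding Wt_def Wr_def by (rule mixed_derivative_symmetric[OF WWk Q(1) zeroQ[OF t]])
    moreover have "((\<lambda>t. \<phi>1 t *\<^sub>R w + br (v t) (\<phi> t *\<^sub>R w)) has_vector_derivative
      \<phi>2 t *\<^sub>R w + (br (v t) (\<phi>1 t *\<^sub>R w) + br (v1 t) (\<phi> t *\<^sub>R w))) (at t)"
      by (intro has_vector_derivative_add bounded_bilinear.has_vector_derivative[OF br_bounded_bilinear]
          bounded_linear.has_vector_derivative[OF bounded_linear_scaleR_left] \<phi>1 \<phi>2 dv t)
    then have "((\<lambda>t. Wr (0, t)) has_vector_derivative
      \<phi>2 t *\<^sub>R w + (br (v t) (\<phi>1 t *\<^sub>R w) + br (v1 t) (\<phi> t *\<^sub>R w))) (at t)"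
      by (rule has_vector_derivative_transform_within_open[OF _ J(1) t]) (simp add: Wr0)
    ultimately show ?thesis using slice_t[OF Wrk zeroQ[OF t]] vector_derivative_unique_at by fastforce
  qed
  let ?\<delta>v = "\<lambda>t. \<phi>1 t *\<^sub>R w + br (v t) (\<phi> t *\<^sub>R w)"
  let ?\<delta>v1 = "\<lambda>t. \<phi>2 t *\<^sub>R w + br (v1 t) (\<phi> t *\<^sub>R w) + br (v t) (\<phi>1 t *\<^sub>R w)"
  have DLL: "?D LL (0, t) (1, 0) =
      (I (v1 t + nab (v t) (v t)) (?\<delta>v1 t + nab (?\<delta>v t) (v t) + nab (v t) (?\<delta>v t)) + \<sigma> * I (v t) (?\<delta>v t))
      + \<phi> t * (1/2 * der \<Psi> (xt t) (E (xt t) w))" if t: "t \<in> J" for t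
  proof -
    note z = zeroQ[OF t]
    have x: "xt t \<in> U" using xtU t by (simp add: J_def)
    have dW: "((\<lambda>r. WW (r, t)) has_vector_derivative ?\<delta>v t) (at 0)"
      using slice_r[OF WWk z] Wr0[OF t] by (simp add: Wr_def)
    have dWt: "((\<lambda>r. Wt (r, t)) has_vector_derivative ?\<delta>v1 t) (at 0)"
      using slice_r[OF Wtk z] Wtr0[OF t] by simp
    have \<Psi>1: "Ck_on (Suc 1) \<Psi> U" using \<Psi> by (simp add: numeral_2_eq_2)
    have d\<Psi>: "(\<Psi> has_derivative der \<Psi> (xt t)) (at (xt t))"
      by (rule Ck_on_open_has_derivative[OF \<Psi>1 U x])
    have "((\<lambda>r. Y (r, t)) has_derivative (\<lambda>h. h *\<^sub>R \<eta> t)) (at 0)"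
      using slice_r[OF Yk z] Y_r[OF z] by (simp add: has_vector_derivative_def)
    from has_derivative_compose[OF this, of \<Psi> "der \<Psi> (xt t)"] d\<Psi>
    have d\<Psi>Y: "((\<lambda>r. \<Psi> (Y (r, t))) has_vector_derivative der \<Psi> (xt t) (\<eta> t)) (at 0)"
      using linear_scale[OF has_derivative_linear[OF d\<Psi>]] by (simp add: has_vector_derivative_def Y_def)
    let ?a = "?\<delta>v1 t + (nab (WW (0, t)) (?\<delta>v t) + nab (?\<delta>v t) (WW (0, t)))"
    have dA: "((\<lambda>r. A (r, t)) has_vector_derivative ?a) (at 0)"
      unfolding A_def by (intro has_vector_derivative_add nab_deriv dW dWt)
    have "((\<lambda>r. LL (r, t)) has_vector_derivative
      (1/2) *\<^sub>R ((I (A (0, t)) ?a + I ?a (A (0, t))) + \<sigma> *\<^sub>R (I (WW (0, t)) (?\<delta>v t) + I (?\<delta>v t) (WW (0, t)))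
        + der \<Psi> (xt t) (\<eta> t))) (at 0)"
      unfolding LL_def
      by (intro has_vector_derivative_add bounded_linear.has_vector_derivative[OF bounded_linear_scaleR_right]
          I_deriv dA dW d\<Psi>Y)
    moreover have "((\<lambda>r. LL (r, t)) has_vector_derivative ?D LL (0, t) (1, 0)) (at 0)"
      by (rule slice_derivatives(2)[OF Ck_on_open_has_derivative[OF LL1 Q(1) z]])
    ultimately have "?D LL (0, t) (1, 0) = (1/2) *\<^sub>R ((I (A (0, t)) ?a + I ?a (A (0, t)))
        + \<sigma> *\<^sub>R (I (WW (0, t)) (?\<delta>v t) + I (?\<delta>v t) (WW (0, t))) + der \<Psi> (xt t) (\<eta> t))"
      using vector_derivative_unique_at by metis
    also have "\<dots> = I (A (0, t)) ?a + \<sigma> * I (WW (0, t)) (?\<delta>v t) + 1/2 * der \<Psi> (xt t) (\<eta> t)"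
      unfolding I_sym[of ?a] I_sym[of "?\<delta>v t" "WW (0, t)"] by simp
    finally show ?thesis
      using linear_scale[OF has_derivative_linear[OF d\<Psi>]] Wt0[OF t]
      by (simp add: A_def v_WW[OF t] \<eta>_def add.assoc add.commute[of "nab (WW (0, t)) _"])
  qed

  have ab: "a \<le> b" using ord by simp
  have near0: "\<phi> s = 0 \<and> \<phi>1 s = 0" if s: "s \<in> J" "s < a' \<or> b' < s" for s
  proof -
    have op: "open (- {a'..b'})" by auto
    have s': "s \<in> - {a'..b'}" using s by auto
    have "((\<lambda>t. 0::real) has_vector_derivative 0) (at s)" by simp
    then have "(\<phi> has_vector_derivative 0) (at s)"
      by (rule has_vector_derivative_transform_within_open[OF _ op s']) (use supp in auto)
    then show ?thesis using \<phi>1[OF s(1)] vector_derivative_unique_at s' supp by (metis ComplD)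
  qed
  have v3c: "continuous_on {a..b} v3" using Ck_on_continuous[OF v3k[of 0]] continuous_on_subset abJ by blast
  have parts: "((\<lambda>t. I (v1 t + nab (v t) (v t)) (?\<delta>v1 t + nab (?\<delta>v t) (v t) + nab (v t) (?\<delta>v t)) + \<sigma> * I (v t) (?\<delta>v t))
    has_integral integral {a..b} (\<lambda>t. \<phi> t * I (EL \<sigma> (v t) (v1 t) (v2 t) (v3 t)) w)) {a..b}"
  proof (rule first_variation_by_parts[OF ab])
    fix t assume "t \<in> {a..b}"
    then have t: "t \<in> J" using abJ by blast
    note within = has_vector_derivative_at_within
    show "(v has_vector_derivative v1 t) (at t within {a..b})" "(v1 has_vector_derivative v2 t) (at t within {a..b})"
      "(v2 has_vector_derivative v3 t) (at t within {a..b})"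
      by (rule within, rule dv[OF t])+
    show "(\<phi> has_vector_derivative \<phi>1 t) (at t within {a..b})" by (rule within[OF \<phi>1[OF t]])
    show "(\<phi>1 has_vector_derivative \<phi>2 t) (at t within {a..b})" by (rule within[OF \<phi>2[OF t]])
  next
    show "\<phi> a = 0" "\<phi> b = 0" "\<phi>1 a = 0" "\<phi>1 b = 0"
      using near0[of a] near0[of b] ord by (simp_all add: J_def)
  qed (rule v3c)
  have vc: "continuous_on {a..b} v" "continuous_on {a..b} v1" "continuous_on {a..b} v2" "continuous_on {a..b} \<phi>"
    using Ck_on_continuous[OF vk[of 0]] Ck_on_continuous[OF v1k[of 0]] Ck_on_continuous[OF v2k[of 0]]
      Ck_on_continuous[OF \<phi>k[of 0]] continuous_on_subset abJ by blast+
  have "continuous_on J (\<lambda>t. der \<Psi> (xt t) (E (xt t) w))"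
  proof -
    have \<Psi>1: "Ck_on (Suc 1) \<Psi> U" using \<Psi> by (simp add: numeral_2_eq_2)
    have "Ck_on 1 (\<lambda>t. der \<Psi> (xt t) (E (xt t) w)) J"
      by (rule linear_family_Ck[where U = U and \<Phi> = "\<lambda>y. der \<Psi> y", OF
          has_derivative_linear[OF Ck_on_open_has_derivative[OF \<Psi>1 U]] Ck_on_open_frechet[OF \<Psi>1 U] J(2) xk])
        (use xtJ Ck_on_compose[OF J(2) E_smooth xk xtJ] in \<open>auto simp del: Ck_on.simps One_nat_def\<close>)
    then show ?thesis by (rule Ck_on_continuous)
  qed
  then have i2: "(\<lambda>t. \<phi> t * (1/2 * der \<Psi> (xt t) (E (xt t) w))) integrable_on {a..b}"
    using abJ by (intro integrable_continuous_real continuous_intros vc) (rule continuous_on_subset)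
  have i1: "(\<lambda>t. \<phi> t * I (EL \<sigma> (v t) (v1 t) (v2 t) (v3 t)) w) integrable_on {a..b}"
    by (intro integrable_continuous_real continuous_intros bounded_bilinear.continuous_on[OF I_bounded_bilinear]
        EL_continuous vc v3c)
  have "((\<lambda>t. ?D LL (0, t) (1, 0)) has_integral
    integral {a..b} (\<lambda>t. \<phi> t * I (EL \<sigma> (v t) (v1 t) (v2 t) (v3 t)) w)
    + integral {a..b} (\<lambda>t. \<phi> t * (1/2 * der \<Psi> (xt t) (E (xt t) w)))) {a..b}"
    by (rule has_integral_eq[OF _ has_integral_add[OF parts integrable_integral[OF i2]]])
      (use DLL abJ in auto)
  then have "integral {a..b} (\<lambda>t. ?D LL (0, t) (1, 0)) =
    integral {a..b} (\<lambda>t. \<phi> t * I (EL \<sigma> (v t) (v1 t) (v2 t) (v3 t)) w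
      + \<phi> t * (1/2 * der \<Psi> (xt t) (E (xt t) w)))"
    unfolding integral_add[OF i1 i2] by (rule integral_unique)
  then show "((\<lambda>r. integral {a..b} (L r)) has_real_derivative
      integral {a..b} (\<lambda>t. \<phi> t * (I (EL \<sigma> (v t) (v1 t) (v2 t) (v3 t)) w
        + 1/2 * der \<Psi> (xt t) (E (xt t) w)))) (at 0)"
    using dL by (simp only: distrib_left)
qed

end

section \<open>Charts and derivatives of maps between manifolds\<close>

lemma is_chartD:
  assumes "is_chart c"
  shows "open (fst c)" "open (snd c ` fst c)" "continuous_on (fst c) (snd c)"
    "continuous_on (snd c ` fst c) (chart_inv c)"
    "\<And>p. p \<in> fst c \<Longrightarrow> chart_inv c (snd c p) = p"
    "\<And>z. z \<in> snd c ` fst c \<Longrightarrow> snd c (chart_inv c z) = z"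
    "\<And>z. z \<in> snd c ` fst c \<Longrightarrow> chart_inv c z \<in> fst c"
  using assms unfolding is_chart_def homeomorphism_def by auto

lemma chart_image_open:
  assumes c: "is_chart c" and V: "open V"
  shows "open (snd c ` (fst c \<inter> V))"
    and "z \<in> snd c ` (fst c \<inter> V) \<longleftrightarrow> z \<in> snd c ` fst c \<and> chart_inv c z \<in> V"
proof -
  have iff: "z \<in> snd c ` (fst c \<inter> V) \<longleftrightarrow> z \<in> snd c ` fst c \<and> chart_inv c z \<in> V" for z
    using is_chartD(5-7)[OF c] by (auto simp: image_iff)
  then show "z \<in> snd c ` (fst c \<inter> V) \<longleftrightarrow> z \<in> snd c ` fst c \<and> chart_inv c z \<in> V" .
  have "snd c ` (fst c \<inter> V) = snd c ` fst c \<inter> chart_inv c -` V" using iff by blast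
  then show "open (snd c ` (fst c \<inter> V))"
    using continuous_open_preimage[OF is_chartD(4,2)[OF c] V] by simp
qed

lemma std_chart_at [simp]: "chart_at std_atlas p = (UNIV, \<lambda>x. x)"
  by (auto simp: chart_at_def std_atlas_def)

lemma std_chart_inv [simp]: "chart_inv (UNIV, \<lambda>x. x) = (\<lambda>x. x)"
  by (auto simp: chart_inv_def fun_eq_iff intro!: inv_into_f_eq)

text \<open>
  While \<open>tangent_map\<close> always takes the preferred charts, which change with the point, here the charts can
  be kept fixed, so that for smooth \<open>f\<close> the derivative depends smoothly on the point.
\<close>

definition chart_derivative ::
  "('m, 'e::real_normed_vector) chart \<Rightarrow> ('n, 'f::real_normed_vector) chart \<Rightarrow> ('m \<Rightarrow> 'n) \<Rightarrow> 'm \<Rightarrow> 'e \<Rightarrow> 'f" where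
  "chart_derivative c d f p = der (snd d \<circ> f \<circ> chart_inv c) (snd c p)"

lemma tangent_map_chart_derivative:
  "tangent_map A B f p = chart_derivative (chart_at A p) (chart_at B (f p)) f p"
  by (simp add: tangent_map_def chart_derivative_def)

locale manifold =
  fixes A :: "('m::{t2_space, second_countable_topology}, 'e::euclidean_space) chart set"
  assumes atlas: "smooth_atlas A"
begin

lemma charts: "c \<in> A \<Longrightarrow> is_chart c"
  using atlas by (simp add: smooth_atlas_def)

lemmas chartD = is_chartD[OF charts]

lemma chart_at: "chart_at A p \<in> A" "p \<in> fst (chart_at A p)"
proof -
  have "p \<in> (\<Union>c\<in>A. fst c)" using atlas by (simp add: smooth_atlas_def)
  then have "\<exists>c. c \<in> A \<and> p \<in> fst c" by blast
  from someI_ex[OF this] show "chart_at A p \<in> A" "p \<in> fst (chart_at A p)"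
    by (auto simp: chart_at_def)
qed

lemma rep_domain_open:
  assumes "c \<in> A" "d \<in> A" "smooth_map_on A A f UNIV"
  shows "open (snd c ` (fst c \<inter> f -` fst d))"
proof -
  have "continuous_on UNIV f" using assms(3) by (auto simp: smooth_map_on_def Ck_map_on_def)
  then have "open (f -` fst d)" using chartD(1)[OF assms(2)] by (simp add: continuous_on_open_vimage)
  then show ?thesis by (rule chart_image_open[OF charts[OF assms(1)]])
qed

lemma rep_smooth:
  assumes "c \<in> A" "d \<in> A" "smooth_map_on A A f UNIV"
  shows "Ck_on k (snd d \<circ> f \<circ> chart_inv c) (snd c ` (fst c \<inter> f -` fst d))"
  using assms by (auto simp: smooth_map_on_def Ck_map_on_def)

lemma rep_has_derivative:
  assumes "c \<in> A" "d \<in> A" "smooth_map_on A A f UNIV" "p \<in> fst c" "f p \<in> fst d"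
  shows "((snd d \<circ> f \<circ> chart_inv c) has_derivative chart_derivative c d f p) (at (snd c p))"
  unfolding chart_derivative_def
  by (rule Ck_on_open_has_derivative[OF rep_smooth[OF assms(1-3)] rep_domain_open[OF assms(1-3)]])
    (use assms in auto)

lemma smooth_map_id: "smooth_map_on A A (\<lambda>p. p) UNIV"
  using atlas by (auto simp: smooth_map_on_def Ck_map_on_def smooth_atlas_def compatible_def smooth_on_def comp_def)

text \<open>
  The chain rule, with arbitrary charts at the three points. Taking identity maps for \<open>f\<close> or \<open>g\<close>, it
  also describes the change of charts.
\<close>

lemma chart_derivative_compose:
  assumes "c \<in> A" "d \<in> A" "e \<in> A" and f: "smooth_map_on A A f UNIV" and g: "smooth_map_on A A g UNIV"
    and p: "p \<in> fst c" "f p \<in> fst d" "g (f p) \<in> fst e"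
  shows "chart_derivative c e (\<lambda>x. g (f x)) p h = chart_derivative d e g (f p) (chart_derivative c d f p h)"
proof -
  have "((\<lambda>z. (snd e \<circ> g \<circ> chart_inv d) ((snd d \<circ> f \<circ> chart_inv c) z)) has_derivative
      (\<lambda>h. chart_derivative d e g (f p) (chart_derivative c d f p h))) (at (snd c p))"
    by (rule has_derivative_compose[OF rep_has_derivative[OF assms(1,2) f p(1,2)]])
      (use rep_has_derivative[OF assms(2,3) g p(2,3)] chartD(5)[OF assms(1) p(1)] in \<open>simp add: comp_def\<close>)
  then have "((snd e \<circ> (\<lambda>x. g (f x)) \<circ> chart_inv c) has_derivative
      (\<lambda>h. chart_derivative d e g (f p) (chart_derivative c d f p h))) (at (snd c p))"
    by (rule has_derivative_transform_within_open[OF _ rep_domain_open[OF assms(1,2) f]])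
      (use p chartD(5)[OF assms(1)] chartD(5)[OF assms(2)] in auto)
  then show ?thesis unfolding chart_derivative_def[of c e] by (simp add: frechet_eqI)
qed

lemma chart_derivative_id:
  assumes "c \<in> A" "p \<in> fst c" shows "chart_derivative c c (\<lambda>x. x) p h = h"
proof -
  have "((snd c \<circ> (\<lambda>x. x) \<circ> chart_inv c) has_derivative (\<lambda>h. h)) (at (snd c p))"
    by (rule has_derivative_transform_within_open[OF has_derivative_ident chartD(2)[OF assms(1)]])
      (use assms chartD(6)[OF assms(1)] in auto)
  then show ?thesis unfolding chart_derivative_def by (simp add: frechet_eqI)
qed

lemma tangent_map_to_chart: "tangent_map A std_atlas (snd c) p = chart_derivative (chart_at A p) c (\<lambda>x. x) p"
  by (simp add: tangent_map_def chart_derivative_def comp_def)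

lemma tangent_map_from_chart:
  assumes "c \<in> A" "z \<in> snd c ` fst c"
  shows "tangent_map std_atlas A (chart_inv c) z = chart_derivative c (chart_at A (chart_inv c z)) (\<lambda>x. x) (chart_inv c z)"
  using chartD(6)[OF assms] by (simp add: tangent_map_def chart_derivative_def comp_def)

end

section \<open>The left-invariant frame of a Lie group\<close>

locale lie_group_loc =
  fixes G :: "('g::{t2_space, second_countable_topology}, 'e::euclidean_space) lie_group_structure"
  assumes lie_group: "lie_group G"
begin

sublocale manifold "atlas G"
  using lie_group by unfold_locales (simp add: lie_group_def)

sublocale group G
  using lie_group by (simp add: lie_group_def)

abbreviation A where "A \<equiv> atlas G"
abbreviation mult (infixl "\<cdot>" 70) where "x \<cdot> y \<equiv> x \<otimes>\<^bsub>G\<^esub> y"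
abbreviation iv where "iv x \<equiv> inv\<^bsub>G\<^esub> x"

lemma in_carrier [simp]: "x \<in> carrier G"
  using lie_group by (simp add: lie_group_def)

definition unit_chart where "unit_chart = chart_at A \<one>\<^bsub>G\<^esub>"
definition unit_coord where "unit_coord = snd unit_chart \<one>\<^bsub>G\<^esub>"

lemma unit_chart: "unit_chart \<in> A" "\<one>\<^bsub>G\<^esub> \<in> fst unit_chart" "chart_inv unit_chart unit_coord = \<one>\<^bsub>G\<^esub>" "unit_coord \<in> snd unit_chart ` fst unit_chart"
  using chart_at chartD(5) by (auto simp: unit_chart_def unit_coord_def)

lemma inv_smooth: "smooth_map_on A A (\<lambda>x. iv x) UNIV"
  using lie_group by (simp add: lie_group_def)

text \<open>
  The multiplication as a smooth map between open subsets of model spaces: in this form its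
  partial derivatives are ordinary derivatives.
\<close>

definition mult_rep where "mult_rep c c' d = (\<lambda>(a, b). snd d (chart_inv c a \<cdot> chart_inv c' b))"
definition mult_dom where
  "mult_dom c c' d = {z \<in> snd c ` fst c \<times> snd c' ` fst c'. chart_inv c (fst z) \<cdot> chart_inv c' (snd z) \<in> fst d}"

lemma mult_rep:
  assumes c: "c \<in> A" "c' \<in> A" "d \<in> A"
  shows "open (mult_dom c c' d)" "Ck_on k (mult_rep c c' d) (mult_dom c c' d)"
proof -
  let ?m = "\<lambda>(x, y). x \<cdot> y" and ?P = "(fst c \<times> fst c', map_prod (snd c) (snd c'))"
  have smooth: "smooth_map_on (prod_atlas A A) A ?m UNIV"
    using lie_group by (simp add: lie_group_def)
  have cm: "continuous_on UNIV ?m" using smooth by (auto simp: smooth_map_on_def Ck_map_on_def)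
  have cont: "continuous_on (snd c ` fst c \<times> snd c' ` fst c') (\<lambda>z. ?m (chart_inv c (fst z), chart_inv c' (snd z)))"
    by (intro continuous_on_compose2[OF cm] continuous_on_Pair continuous_on_compose2[OF chartD(4)[OF c(1)]]
        continuous_on_compose2[OF chartD(4)[OF c(2)]] continuous_intros) auto
  have "mult_dom c c' d = (snd c ` fst c \<times> snd c' ` fst c') \<inter> (\<lambda>z. ?m (chart_inv c (fst z), chart_inv c' (snd z))) -` fst d"
    by (auto simp: mult_dom_def)
  then show op: "open (mult_dom c c' d)"
    using continuous_open_preimage[OF cont open_Times[OF chartD(2)[OF c(1)] chartD(2)[OF c(2)]] chartD(1)[OF c(3)]] by simp
  have inj: "inj_on (map_prod (snd c) (snd c')) (fst c \<times> fst c')"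
    by (rule inj_onI) (use chartD(5)[OF c(1)] chartD(5)[OF c(2)] in \<open>auto, metis+\<close>)
  have inv: "chart_inv ?P (snd c p, snd c' q) = (p, q)" if "p \<in> fst c" "q \<in> fst c'" for p q
    using inv_into_f_f[OF inj, of "(p, q)"] that by (simp add: chart_inv_def)
  have im: "snd ?P ` (UNIV \<inter> fst ?P \<inter> ?m -` fst d) = mult_dom c c' d" (is "?L = ?R")
  proof
    show "?L \<subseteq> ?R" using chartD(5)[OF c(1)] chartD(5)[OF c(2)] by (auto simp: mult_dom_def)
    show "?R \<subseteq> ?L"
    proof
      fix z assume "z \<in> ?R"
      then obtain p q where pq: "p \<in> fst c" "q \<in> fst c'" "z = (snd c p, snd c' q)" "p \<cdot> q \<in> fst d"
        using chartD(5)[OF c(1)] chartD(5)[OF c(2)] by (auto simp: mult_dom_def)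
      then show "z \<in> ?L" by (intro image_eqI[of _ _ "(p, q)"]) auto
    qed
  qed
  have "?P \<in> prod_atlas A A" unfolding prod_atlas_def using c(1,2) by blast
  then have "Ck_on k (snd d \<circ> ?m \<circ> chart_inv ?P) (snd ?P ` (UNIV \<inter> fst ?P \<inter> ?m -` fst d))"
    using smooth c(3) unfolding smooth_map_on_def Ck_map_on_def by blast
  then show "Ck_on k (mult_rep c c' d) (mult_dom c c' d)"
    unfolding im
  proof (rule Ck_on_cong)
    fix z assume "z \<in> mult_dom c c' d"
    then obtain p q where pq: "p \<in> fst c" "q \<in> fst c'" "z = (snd c p, snd c' q)"
      by (auto simp: mult_dom_def)
    then show "(snd d \<circ> ?m \<circ> chart_inv ?P) z = mult_rep c c' d z"
      using inv[OF pq(1,2)] chartD(5)[OF c(1) pq(1)] chartD(5)[OF c(2) pq(2)] by (simp add: mult_rep_def)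
  qed
qed

lemma left_translation_smooth: "smooth_map_on A A (\<lambda>x. a \<cdot> x) UNIV"
  unfolding smooth_map_on_def Ck_map_on_def
proof (intro allI conjI ballI)
  have "continuous_on UNIV (\<lambda>(x, y). x \<cdot> y)"
    using lie_group by (auto simp: lie_group_def smooth_map_on_def Ck_map_on_def)
  moreover have "continuous_on UNIV (\<lambda>x::'g. (a, x))" by (intro continuous_intros)
  ultimately show cont: "continuous_on UNIV (\<lambda>x. a \<cdot> x)"
    using continuous_on_compose2[of UNIV "\<lambda>(x, y). x \<cdot> y" UNIV "\<lambda>x. (a, x)"] by simp
  fix k c d assume c: "c \<in> A" "d \<in> A"
  let ?ca = "chart_at A a"
  let ?S = "snd c ` (UNIV \<inter> fst c \<inter> (\<lambda>x. a \<cdot> x) -` fst d)"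
  have S: "open ?S"
    using chart_image_open(1)[OF charts[OF c(1)], of "(\<lambda>x. a \<cdot> x) -` fst d"] cont chartD(1)[OF c(2)]
    by (simp add: continuous_on_open_vimage)
  have "Ck_on k (\<lambda>y. mult_rep ?ca c d (snd ?ca a, y)) ?S"
    by (rule Ck_on_compose[OF fat_open[OF S] mult_rep(2)[OF chart_at(1) c]
          Ck_on_Pair[OF fat_open[OF S] Ck_on_const[OF fat_open[OF S]] Ck_on_linear[OF bounded_linear_ident fat_open[OF S]]]])
      (auto simp: mult_dom_def chart_at chartD(5)[OF chart_at(1) chart_at(2)] chartD(5)[OF c(1)])
  then show "Ck_on k (snd d \<circ> (\<lambda>x. a \<cdot> x) \<circ> chart_inv c) ?S"
    by (rule Ck_on_cong) (simp add: mult_rep_def chartD(5)[OF chart_at(1) chart_at(2)])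
qed

abbreviation L where "L a \<equiv> (\<lambda>x. a \<cdot> x)"

lemma chart_derivative_left_mult:
  assumes "c \<in> A" "d \<in> A" "e \<in> A" "p \<in> fst c" "b \<cdot> p \<in> fst d" "a \<cdot> (b \<cdot> p) \<in> fst e"
  shows "chart_derivative d e (L a) (b \<cdot> p) (chart_derivative c d (L b) p h) = chart_derivative c e (L (a \<cdot> b)) p h"
  using chart_derivative_compose[OF assms(1-3) left_translation_smooth left_translation_smooth, of p b a h] assms
  by (simp add: m_assoc)

lemma chart_derivative_L1:
  assumes "c \<in> A" "p \<in> fst c" shows "chart_derivative c c (L \<one>\<^bsub>G\<^esub>) p h = h"
  using chart_derivative_id[OF assms] by simp

lemma T_left_eq:
  "T_left G a p = chart_derivative (chart_at A p) (chart_at A (a \<cdot> p)) (L a) p"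
  by (simp add: T_left_def left_translation_def[abs_def] tangent_map_chart_derivative)

lemma T_left_compose: "T_left G a (b \<cdot> p) (T_left G b p u) = T_left G (a \<cdot> b) p u"
proof -
  have e: "a \<cdot> b \<cdot> p = a \<cdot> (b \<cdot> p)" by (simp add: m_assoc)
  show ?thesis unfolding T_left_eq e
    by (rule chart_derivative_left_mult[OF chart_at(1) chart_at(1) chart_at(1) chart_at(2) chart_at(2) chart_at(2)])
qed

lemma T_left_one: "T_left G \<one>\<^bsub>G\<^esub> p u = u"
  unfolding T_left_eq l_one[OF in_carrier] by (rule chart_derivative_id[OF chart_at])

lemma T_left_linear: "linear (T_left G a p)"
  unfolding T_left_eq
  by (rule has_derivative_linear[OF rep_has_derivative[OF chart_at(1) chart_at(1) left_translation_smooth chart_at(2) chart_at(2)]])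

text \<open>
  The maps \<open>E\<close> and \<open>F\<close> of the chart \<open>c\<close>. They are defined by the terms that occur in the definitions
  of the left-invariant fields and of the left-invariant metric in a chart; \<open>frame_eq\<close> and \<open>coframe_eq\<close>
  eliminate the preferred charts from them.
\<close>

definition frame where "frame c z u = in_chart A (left_invariant_field G u) c z"
definition coframe where
  "coframe c z b = T_left G (iv (chart_inv c z)) (chart_inv c z) (tangent_map std_atlas A (chart_inv c) z b)"

lemma frame_eq:
  assumes "c \<in> A" "p \<in> fst c"
  shows "frame c (snd c p) u = chart_derivative unit_chart c (L p) \<one>\<^bsub>G\<^esub> u"
proof -
  have "frame c (snd c p) u = chart_derivative (chart_at A p) c (\<lambda>x. x) p
      (chart_derivative unit_chart (chart_at A p) (L p) \<one>\<^bsub>G\<^esub> u)"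
    using chartD(5)[OF assms]
    by (simp add: frame_def in_chart_def left_invariant_field_def tangent_map_to_chart T_left_eq unit_chart_def)
  also have "\<dots> = chart_derivative unit_chart c (L p) \<one>\<^bsub>G\<^esub> u"
    using chart_derivative_compose[OF unit_chart(1) chart_at(1)[of p] assms(1) left_translation_smooth[of p] smooth_map_id, of "\<one>\<^bsub>G\<^esub>" u]
      unit_chart(2) chart_at(2)[of p] assms(2) by simp
  finally show ?thesis .
qed

lemma coframe_eq:
  assumes "c \<in> A" "p \<in> fst c"
  shows "coframe c (snd c p) b = chart_derivative c unit_chart (L (iv p)) p b"
proof -
  have "coframe c (snd c p) b = chart_derivative (chart_at A p) unit_chart (L (iv p)) p
      (chart_derivative c (chart_at A p) (\<lambda>x. x) p b)"
    using chartD(5)[OF assms] assms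
    by (simp add: coframe_def tangent_map_from_chart T_left_eq unit_chart_def)
  also have "\<dots> = chart_derivative c unit_chart (L (iv p)) p b"
    using chart_derivative_compose[OF assms(1) chart_at(1)[of p] unit_chart(1) smooth_map_id left_translation_smooth[of "iv p"], of p b]
      unit_chart(2) chart_at(2)[of p] assms(2) by simp
  finally show ?thesis .
qed

lemma frame_linear: assumes "c \<in> A" "p \<in> fst c" shows "linear (frame c (snd c p))"
  unfolding frame_eq[OF assms, abs_def]
  by (rule has_derivative_linear[OF rep_has_derivative[OF unit_chart(1) assms(1) left_translation_smooth unit_chart(2)]])
    (use assms in simp)

lemma coframe_linear: assumes "c \<in> A" "p \<in> fst c" shows "linear (coframe c (snd c p))"
  unfolding coframe_eq[OF assms, abs_def]
  by (rule has_derivative_linear[OF rep_has_derivative[OF assms(1) unit_chart(1) left_translation_smooth assms(2)]])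
    (use unit_chart in simp)

lemma coframe_frame: assumes "c \<in> A" "p \<in> fst c" shows "coframe c (snd c p) (frame c (snd c p) a) = a"
  unfolding frame_eq[OF assms] coframe_eq[OF assms]
  using chart_derivative_left_mult[OF unit_chart(1) assms(1) unit_chart(1) unit_chart(2), of p "iv p" a] assms unit_chart
    chart_derivative_L1[OF unit_chart(1,2)] by simp

lemma frame_coframe: assumes "c \<in> A" "p \<in> fst c" shows "frame c (snd c p) (coframe c (snd c p) a) = a"
  unfolding frame_eq[OF assms] coframe_eq[OF assms]
  using chart_derivative_left_mult[OF assms(1) unit_chart(1) assms(1) assms(2), of "iv p" p a] assms unit_chart
    chart_derivative_L1[OF assms] by simp

text \<open>
  The frame is the partial derivative of the multiplication with respect to the second factor, at
  the identity.
\<close>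

lemma frame_smooth: assumes c: "c \<in> A" shows "Ck_on k (\<lambda>z. frame c z u) (snd c ` fst c)"
proof -
  let ?U = "snd c ` fst c"
  note m = mult_rep[OF c unit_chart(1) c]
  have dom: "(z, unit_coord) \<in> mult_dom c unit_chart c" if "z \<in> ?U" for z
    using that unit_chart chartD(7)[OF c] by (auto simp: mult_dom_def)
  have "Ck_on k (\<lambda>z. der (mult_rep c unit_chart c) (z, unit_coord) (0, u)) ?U"
    by (rule Ck_on_compose[OF fat_open[OF chartD(2)[OF c]] Ck_on_open_frechet[OF m(2,1)]
          Ck_on_Pair[OF fat_open[OF chartD(2)[OF c]] Ck_on_linear[OF bounded_linear_ident] Ck_on_const]])
      (use dom fat_open[OF chartD(2)[OF c]] in auto)
  then show ?thesis
  proof (rule Ck_on_cong)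
    fix z assume z: "z \<in> ?U"
    then obtain p where p: "p \<in> fst c" "z = snd c p" by auto
    have "((\<lambda>y. mult_rep c unit_chart c (z, y)) has_derivative (\<lambda>h. der (mult_rep c unit_chart c) (z, unit_coord) (0, h))) (at unit_coord)"
      by (rule slice_snd[OF Ck_on_open_has_derivative[OF m(2,1) dom[OF z]]])
    moreover have "(\<lambda>y. mult_rep c unit_chart c (z, y)) = snd c \<circ> L p \<circ> chart_inv unit_chart"
      using chartD(5)[OF c p(1)] p by (auto simp: mult_rep_def)
    ultimately show "der (mult_rep c unit_chart c) (z, unit_coord) (0, u) = frame c z u"
      unfolding p(2) frame_eq[OF c p(1)] chart_derivative_def using p by (simp add: frechet_eqI unit_coord_def)
  qed
qed

text \<open>
  Smoothness is obtained from the inversion of the group: the coframe at \<open>p\<close> is the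
  derivative of \<open>q \<mapsto> p\<^sup>-\<^sup>1 q\<close> at \<open>q = p\<close>.
\<close>

lemma coframe_smooth: assumes c: "c \<in> A" shows "Ck_on k (\<lambda>z. coframe c z b) (snd c ` fst c)"
proof (rule Ck_on_local)
  fix y assume "y \<in> snd c ` fst c"
  then obtain p0 where p0: "p0 \<in> fst c" "y = snd c p0" by auto
  define c' where "c' = chart_at A (iv p0)"
  have c': "c' \<in> A" "iv p0 \<in> fst c'" using chart_at by (auto simp: c'_def)
  let ?U = "snd c ` (fst c \<inter> (\<lambda>x. iv x) -` fst c')"
  let ?i = "snd c' \<circ> (\<lambda>x. iv x) \<circ> chart_inv c"
  have U: "open ?U" "fat ?U" using rep_domain_open[OF c c'(1) inv_smooth] fat_open by auto
  note m = mult_rep[OF c'(1) c unit_chart(1)]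
  have ip: "chart_inv c' (?i (snd c p)) = iv p" if "p \<in> fst c" "iv p \<in> fst c'" for p
    using that chartD(5)[OF c] chartD(5)[OF c'(1)] by simp
  have dom: "(?i z, z) \<in> mult_dom c' c unit_chart" if "z \<in> ?U" for z
    using that chartD(5)[OF c] chartD(5)[OF c'(1)] unit_chart by (auto simp: mult_dom_def)
  have "Ck_on k (\<lambda>z. der (mult_rep c' c unit_chart) (?i z, z) (0, b)) ?U"
    by (rule Ck_on_compose[OF U(2) Ck_on_open_frechet[OF m(2,1)]
          Ck_on_Pair[OF U(2) rep_smooth[OF c c'(1) inv_smooth] Ck_on_linear[OF bounded_linear_ident U(2)]]])
      (use dom in auto)
  then have "Ck_on k (\<lambda>z. coframe c z b) ?U"
  proof (rule Ck_on_cong)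
    fix z assume z: "z \<in> ?U"
    then obtain p where p: "p \<in> fst c" "iv p \<in> fst c'" "z = snd c p" by auto
    have "((\<lambda>y. mult_rep c' c unit_chart (?i z, y)) has_derivative (\<lambda>h. der (mult_rep c' c unit_chart) (?i z, z) (0, h))) (at z)"
      by (rule slice_snd[OF Ck_on_open_has_derivative[OF m(2,1) dom[OF z]]])
    moreover have "(\<lambda>y. mult_rep c' c unit_chart (?i z, y)) = snd unit_chart \<circ> L (iv p) \<circ> chart_inv c"
      using ip[OF p(1,2)] p(3) by (auto simp: mult_rep_def)
    ultimately show "der (mult_rep c' c unit_chart) (?i z, z) (0, b) = coframe c z b"
      unfolding p(3) coframe_eq[OF c p(1)] chart_derivative_def using p by (simp add: frechet_eqI)
  qed
  then have "Ck_on k (\<lambda>z. coframe c z b) (snd c ` fst c \<inter> ?U)"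
    by (simp add: Int_absorb1 image_mono)
  then show "\<exists>U. open U \<and> y \<in> U \<and> Ck_on k (\<lambda>z. coframe c z b) (snd c ` fst c \<inter> U)"
    using U p0 c' by (intro exI[of _ ?U]) auto
qed

definition lie_algebra_bracket where
  "lie_algebra_bracket a b = lie_bracket A (left_invariant_field G a) (left_invariant_field G b) \<one>\<^bsub>G\<^esub>"

lemma left_invariant_field_one: "left_invariant_field G a \<one>\<^bsub>G\<^esub> = a"
  by (simp add: left_invariant_field_def T_left_one)

lemma in_chart_frame: "in_chart A (left_invariant_field G u) c = (\<lambda>z. frame c z u)"
  by (simp add: frame_def)

lemma lie_algebra_bracket_eq:
  "lie_algebra_bracket a b = der (\<lambda>y. frame unit_chart y b) unit_coord a - der (\<lambda>y. frame unit_chart y a) unit_coord b"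
  by (simp add: lie_algebra_bracket_def lie_bracket_def Let_def left_invariant_field_one in_chart_frame unit_chart_def unit_coord_def)

text \<open>
  The frame is invariant under the coordinate expression \<open>n\<close> of a left translation. Differentiating
  \<open>E (n y) w = Dn (E y w)\<close> at the identity, the second derivative of \<open>n\<close> appears symmetrically in
  the two directions and drops out of the bracket.
\<close>

lemma frame_bracket:
  assumes c: "c \<in> A" and z: "z \<in> snd c ` fst c"
  shows "der (\<lambda>y. frame c y b) z (frame c z a)
    - der (\<lambda>y. frame c y a) z (frame c z b) = frame c z (lie_algebra_bracket a b)"
proof -
  obtain p where p: "p \<in> fst c" "z = snd c p" using z by auto
  define n where "n = snd c \<circ> L p \<circ> chart_inv unit_chart"
  define B where "B = snd unit_chart ` (fst unit_chart \<inter> L p -` fst c)"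
  have B: "open B" unfolding B_def by (rule rep_domain_open[OF unit_chart(1) c left_translation_smooth])
  have n: "Ck_on k n B" for k unfolding n_def B_def by (rule rep_smooth[OF unit_chart(1) c left_translation_smooth])
  have unit_B: "unit_coord \<in> B" using unit_chart(2) p by (auto simp: B_def unit_coord_def)
  have n_unit: "n unit_coord = z" using unit_chart(3) p by (simp add: n_def)
  have B_sub: "B \<subseteq> snd unit_chart ` fst unit_chart" by (auto simp: B_def)
  have Dn: "(n has_derivative der n y) (at y)" if "y \<in> B" for y
    by (rule Ck_on_open_has_derivative[OF n B that])
  have Dn0: "der n unit_coord a = frame c z a" for a
    unfolding p(2) frame_eq[OF c p(1)] by (simp add: chart_derivative_def n_def unit_coord_def)
  have rel: "frame c (n y) w = der n y (frame unit_chart y w)" if "y \<in> B" for y w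
  proof -
    obtain q where q: "q \<in> fst unit_chart" "p \<cdot> q \<in> fst c" "y = snd unit_chart q" using \<open>y \<in> B\<close> by (auto simp: B_def)
    have "n y = snd c (p \<cdot> q)" using q chartD(5)[OF unit_chart(1)] by (simp add: n_def)
    then have "frame c (n y) w = chart_derivative unit_chart c (L (p \<cdot> q)) \<one>\<^bsub>G\<^esub> w" using frame_eq[OF c q(2)] by simp
    also have "\<dots> = chart_derivative unit_chart c (L p) q (chart_derivative unit_chart unit_chart (L q) \<one>\<^bsub>G\<^esub> w)"
      using chart_derivative_left_mult[OF unit_chart(1) unit_chart(1) c unit_chart(2), of q p w] q by simp
    finally show ?thesis using frame_eq[OF unit_chart(1) q(1)] q(3) by (simp add: chart_derivative_def n_def)
  qed
  have fr_d: "((\<lambda>y. frame c y w) has_derivative der (\<lambda>y. frame c y w) y) (at y)"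
    if "c \<in> A" "y \<in> snd c ` fst c" for c y w
    by (rule Ck_on_open_has_derivative[OF frame_smooth[OF that(1)] chartD(2)[OF that(1)] that(2)])
  have fr0: "frame unit_chart unit_coord w = w" for w
    using frame_eq[OF unit_chart(1,2)] chart_derivative_L1[OF unit_chart(1,2)] by (simp add: unit_coord_def)
  have key: "der (\<lambda>y. frame c y w) z (frame c z a) =
      der (\<lambda>y. der n y w) unit_coord a
      + frame c z (der (\<lambda>y. frame unit_chart y w) unit_coord a)" for a w
  proof -
    have "((\<lambda>y. der n y (frame unit_chart y w)) has_derivative
      (\<lambda>h. der (\<lambda>y. der n y (frame unit_chart unit_coord w)) unit_coord h
        + der n unit_coord (der (\<lambda>y. frame unit_chart y w) unit_coord h))) (at unit_coord)"
      using linear_family_derivative[OF B has_derivative_linear[OF Dn] Ck_on_open_frechet[OF n B], where S = B and s = unit_coord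
          and y = "\<lambda>x. x" and y' = "\<lambda>h. h" and q = "\<lambda>y. frame unit_chart y w" and q' = "der (\<lambda>y. frame unit_chart y w) unit_coord"]
        fr_d[OF unit_chart(1,4)] unit_B at_within_open[OF unit_B B] by simp
    then have "((\<lambda>y. frame c (n y) w) has_derivative
      (\<lambda>h. der (\<lambda>y. der n y (frame unit_chart unit_coord w)) unit_coord h
        + der n unit_coord (der (\<lambda>y. frame unit_chart y w) unit_coord h))) (at unit_coord)"
      by (rule has_derivative_transform_within_open[OF _ B unit_B]) (simp add: rel)
    moreover have "((\<lambda>y. frame c (n y) w) has_derivative
      (\<lambda>h. der (\<lambda>y. frame c y w) z (der n unit_coord h))) (at unit_coord)"
      using has_derivative_compose[OF Dn[OF unit_B], of "\<lambda>y. frame c y w"] fr_d[OF c z] n_unit by simp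
    ultimately have "(\<lambda>h. der (\<lambda>y. frame c y w) z (der n unit_coord h)) =
      (\<lambda>h. der (\<lambda>y. der n y (frame unit_chart unit_coord w)) unit_coord h
        + der n unit_coord (der (\<lambda>y. frame unit_chart y w) unit_coord h))"
      by (rule has_derivative_unique[rotated])
    from fun_cong[OF this, of a] show ?thesis by (simp add: Dn0 fr0)
  qed
  have "frame c z (lie_algebra_bracket a b) = frame c z (der (\<lambda>y. frame unit_chart y b) unit_coord a)
      - frame c z (der (\<lambda>y. frame unit_chart y a) unit_coord b)"
    unfolding lie_algebra_bracket_eq p(2) using linear_diff[OF frame_linear[OF c p(1)]] by simp
  then show ?thesis
    unfolding key using mixed_derivative_symmetric[OF n B unit_B, of b a] by simp
qed

lemma frame_locale: assumes c: "c \<in> A" shows "invariant_frame (snd c ` fst c) (frame c) (coframe c) lie_algebra_bracket"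
proof (rule invariant_frame.intro)
  show "open (snd c ` fst c)" by (rule chartD(2)[OF c])
  fix y a assume "y \<in> snd c ` fst c"
  then obtain p where p: "p \<in> fst c" "y = snd c p" by auto
  show "linear (frame c y)" "linear (coframe c y)" "frame c y (coframe c y a) = a" "coframe c y (frame c y a) = a"
    using frame_linear[OF c p(1)] coframe_linear[OF c p(1)] coframe_frame[OF c p(1)] frame_coframe[OF c p(1)] p(2) by simp_all
qed (rule frame_smooth[OF c] coframe_smooth[OF c] frame_bracket[OF c]; assumption?)+

end

locale riemannian_lie_group = lie_group_loc G
  for G :: "('g::{t2_space, second_countable_topology}, 'e::euclidean_space) lie_group_structure" +
  fixes I :: "'e \<Rightarrow> 'e \<Rightarrow> real"
  assumes inner: "inner_product I"
begin

sublocale metric_lie_algebra lie_algebra_bracket I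
proof -
  interpret invariant_frame "snd unit_chart ` fst unit_chart" "frame unit_chart" "coframe unit_chart" lie_algebra_bracket by (rule frame_locale[OF unit_chart(1)])
  show "metric_lie_algebra lie_algebra_bracket I"
    by (rule metric_lie_algebra.intro[OF br_bilinear[OF unit_chart(4)] br_antisym[OF unit_chart(4)] br_jacobi[OF unit_chart(4)] inner])
qed

abbreviation g where "g \<equiv> left_invariant_metric G I"
abbreviation body_gradient where "body_gradient V p \<equiv> T_left G (iv p) p (gradient A g V p)"

lemma metric_frame_locale: "c \<in> A \<Longrightarrow> metric_frame (snd c ` fst c) (frame c) (coframe c) lie_algebra_bracket I"
  by (intro metric_frame.intro frame_locale metric_lie_algebra_axioms)

lemma christoffel_chart:
  assumes c: "c \<in> A" and z: "z \<in> snd c ` fst c"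
  shows "bilinear (christoffel A g c z)"
    and "frame c z (nab a b) = der (\<lambda>y. frame c y b) z (frame c z a)
      + christoffel A g c z (frame c z a) (frame c z b)"
proof -
  interpret metric_frame "snd c ` fst c" "frame c" "coframe c" lie_algebra_bracket I by (rule metric_frame_locale[OF c])
  have m: "metric_in_chart A g c y a b = I (coframe c y a) (coframe c y b)" for y a b
    by (simp add: metric_in_chart_def left_invariant_metric_def coframe_def Let_def)
  have "christoffel A g c z = (THE \<Gamma>. levi_civita_symbol (\<lambda>a b. I (coframe c z a) (coframe c z b))
    (\<lambda>w a b. der (\<lambda>y. I (coframe c y a) (coframe c y b)) z w) \<Gamma>)"
    unfolding christoffel_def m[abs_def] ..
  from christoffel_frame[OF z this]
  show "bilinear (christoffel A g c z)" "frame c z (nab a b) = der (\<lambda>y. frame c y b) z (frame c z a)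
      + christoffel A g c z (frame c z a) (frame c z b)" by auto
qed

lemma frame_preferred: "frame (chart_at A p) (snd (chart_at A p) p) u = left_invariant_field G u p"
  unfolding frame_eq[OF chart_at] left_invariant_field_def T_left_eq unit_chart_def by simp

text \<open>
  The preferred chart changes with the point, but the coordinate formula for the connection holds
  in each of them.
\<close>

lemma levi_civita_left_invariant:
  "levi_civita A g (left_invariant_field G a) (left_invariant_field G b) = left_invariant_field G (nab a b)"
proof
  fix p
  let ?c = "chart_at A p"
  show "levi_civita A g (left_invariant_field G a) (left_invariant_field G b) p = left_invariant_field G (nab a b) p"
    using christoffel_chart(2)[OF chart_at(1), of "snd ?c p" p a b] chart_at(2)[of p]
    by (simp add: levi_civita_def Let_def frame_preferred in_chart_frame)
qed

lemma lie_algebra_connection_eq: "lie_algebra_connection G I = nab"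
  by (intro ext) (simp add: lie_algebra_connection_def levi_civita_left_invariant left_invariant_field_one)

text \<open>
  The field \<open>[u\<^sub>L, v\<^sub>L]\<close> may be replaced by a left-invariant one, as \<open>\<nabla>\<^sub>X Z\<close> at a point depends on \<open>X\<close> only through
  its value there.
\<close>

lemma lie_algebra_curvature_eq: "lie_algebra_curvature G I = R"
proof (intro ext)
  fix u v w
  have "levi_civita A g (lie_bracket A (left_invariant_field G u) (left_invariant_field G v)) (left_invariant_field G w) \<one>\<^bsub>G\<^esub>
    = levi_civita A g (left_invariant_field G (lie_algebra_bracket u v)) (left_invariant_field G w) \<one>\<^bsub>G\<^esub>"
    unfolding levi_civita_def left_invariant_field_one lie_algebra_bracket_def ..
  then show "lie_algebra_curvature G I u v w = R u v w"
    by (simp add: lie_algebra_curvature_def curvature_def levi_civita_left_invariant left_invariant_field_one R_def)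
qed

end

section \<open>Curves in a Riemannian Lie group\<close>

lemma vector_derivative_cong_open:
  assumes "open V" "t \<in> V" "t \<in> S" "\<And>s. s \<in> S \<inter> V \<Longrightarrow> f s = g s"
  shows "vector_derivative f (at t within S) = vector_derivative g (at t within S)"
proof -
  have "(f has_vector_derivative D) (at t within S \<inter> V) \<longleftrightarrow> (g has_vector_derivative D) (at t within S \<inter> V)" for D
    unfolding has_vector_derivative_def
    using has_derivative_transform[of t "S \<inter> V" f g] has_derivative_transform[of t "S \<inter> V" g f] assms by auto
  then show ?thesis
    unfolding vector_derivative_def at_within_Int_open[OF assms(2,1)] by simp
qed

lemma at_within_open_subset: "open J \<Longrightarrow> t \<in> J \<Longrightarrow> J \<subseteq> S \<Longrightarrow> at t within S = at (t::real)"
  by (metis at_within_interior interiorI)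

context manifold
begin

lemma curve_chart_domain:
  assumes "continuous_on S x" "c \<in> A"
  obtains V where "open V" "S \<inter> x -` fst c = S \<inter> V"
proof -
  obtain V where "open V" "V \<inter> S = x -` fst c \<inter> S"
    using assms(1) chartD(1)[OF assms(2)] unfolding continuous_on_open_invariant by blast
  then show thesis by (intro that[of V]) auto
qed

lemma curve_rep:
  fixes x :: "'s::euclidean_space \<Rightarrow> 'm"
  assumes "Ck_map_on k std_atlas A x S" "c \<in> A"
  shows "continuous_on S x" "Ck_on k (\<lambda>s. snd c (x s)) (S \<inter> x -` fst c)"
  using assms by (auto simp: Ck_map_on_def std_atlas_def comp_def)

lemma Ck_map_on_curveI:
  fixes x :: "'s::euclidean_space \<Rightarrow> 'm"
  assumes "continuous_on S x" "\<And>c. c \<in> A \<Longrightarrow> Ck_on k (\<lambda>s. snd c (x s)) (S \<inter> x -` fst c)"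
  shows "Ck_map_on k std_atlas A x S"
  using assms by (auto simp: Ck_map_on_def std_atlas_def comp_def)

lemma Ck_map_on_curve_subset:
  fixes x :: "real \<Rightarrow> 'm"
  assumes x: "Ck_map_on k std_atlas A x S" and T: "T \<subseteq> S" "fat T"
  shows "Ck_map_on k std_atlas A x T"
proof (rule Ck_map_on_curveI)
  show c: "continuous_on T x" using x T(1) by (auto simp: Ck_map_on_def intro: continuous_on_subset)
  fix d assume d: "d \<in> A"
  obtain V where V: "open V" "T \<inter> x -` fst d = T \<inter> V" using curve_chart_domain[OF c d] .
  show "Ck_on k (\<lambda>s. snd d (x s)) (T \<inter> x -` fst d)"
    by (rule Ck_on_subset[OF curve_rep(2)[OF x d]]) (use T V fat_Int_open in auto)
qed

text \<open>
  The velocity is defined in the preferred chart at \<open>x t\<close>, which varies with \<open>t\<close>; it can be computed in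
  any fixed chart.
\<close>

lemma velocity_in_chart:
  assumes c: "c \<in> A" and S: "fat S" and x: "continuous_on S x" and t: "t \<in> S" "x t \<in> fst c"
    and q: "((\<lambda>s. snd c (x s)) has_vector_derivative q) (at t within S)"
  shows "velocity A S x t = tangent_map std_atlas A (chart_inv c) (snd c (x t)) q"
    and "tangent_map A std_atlas (snd c) (x t) (velocity A S x t) = q"
proof -
  let ?c' = "chart_at A (x t)"
  have c': "?c' \<in> A" "x t \<in> fst ?c'" using chart_at by auto
  let ?D = "chart_derivative c ?c' (\<lambda>x. x) (x t)"
  obtain V where V: "open V" "S \<inter> x -` fst c = S \<inter> V" using curve_chart_domain[OF x c] .
  have tV: "t \<in> V" "t \<in> S \<inter> V" using V t by auto
  have Vc: "x s \<in> fst c" if "s \<in> S \<inter> V" for s using V(2) that by blast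
  have D: "((snd ?c' \<circ> (\<lambda>x. x) \<circ> chart_inv c) has_derivative ?D) (at (snd c (x t)))"
    by (rule rep_has_derivative[OF c c'(1) smooth_map_id t(2) c'(2)])
  have q': "((\<lambda>s. snd c (x s)) has_derivative (\<lambda>h. h *\<^sub>R q)) (at t within S \<inter> V)"
    using q by (simp add: has_vector_derivative_def at_within_Int_open tV V)
  have "((\<lambda>s. snd ?c' (x s)) has_derivative (\<lambda>h. ?D (h *\<^sub>R q))) (at t within S \<inter> V)"
    by (rule has_derivative_transform[OF tV(2) _ has_derivative_compose[OF q' D]])
      (use Vc chartD(5)[OF c] in simp)
  then have "((\<lambda>s. snd ?c' (x s)) has_vector_derivative ?D q) (at t within S)"
    using linear_scale[OF has_derivative_linear[OF D]]
    by (simp add: has_vector_derivative_def at_within_Int_open tV V)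
  then have v: "velocity A S x t = ?D q"
    unfolding velocity_def by (rule vector_derivative_within[OF fat_not_bot[OF S t(1)]])
  then show "velocity A S x t = tangent_map std_atlas A (chart_inv c) (snd c (x t)) q"
    using t chartD(5)[OF c t(2)] by (simp add: tangent_map_from_chart[OF c])
  show "tangent_map A std_atlas (snd c) (x t) (velocity A S x t) = q"
    unfolding v tangent_map_to_chart
    using chart_derivative_compose[OF c c'(1) c smooth_map_id smooth_map_id t(2), of q] c' t(2)
      chart_derivative_id[OF c t(2)] by simp
qed

lemma velocity_cong:
  assumes "open V" "t \<in> V" "t \<in> S" "\<And>s. s \<in> S \<inter> V \<Longrightarrow> x s = y s"
  shows "velocity A S x t = velocity A S y t"
proof -
  have "x t = y t" using assms by auto
  then show ?thesis
    unfolding velocity_def by (auto intro!: vector_derivative_cong_open[OF assms(1-3)] simp: assms(4))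
qed

lemma velocity_open: "open J \<Longrightarrow> t \<in> J \<Longrightarrow> J \<subseteq> S \<Longrightarrow> velocity A S x t = velocity A J x t"
  unfolding velocity_def by (simp only: at_within_open_subset[of J t S] at_within_open[of t J])

lemma acceleration_cong:
  assumes "open V" "t \<in> V" "t \<in> S" "\<And>s. s \<in> S \<inter> V \<Longrightarrow> x s = y s"
  shows "acceleration A g S x t = acceleration A g S y t"
proof -
  have xt: "x t = y t" and v: "velocity A S x s = velocity A S y s" if "s \<in> S \<inter> V" for s
    using assms that velocity_cong[OF assms(1), of s S x y] by auto
  show ?thesis
    unfolding acceleration_def covariant_derivative_along_def Let_def
    using vector_derivative_cong_open[OF assms(1-3),
        of "\<lambda>s. tangent_map A std_atlas (snd (chart_at A (y t))) (x s) (velocity A S x s)"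
          "\<lambda>s. tangent_map A std_atlas (snd (chart_at A (y t))) (y s) (velocity A S y s)"]
      xt v assms by auto
qed

lemma acceleration_open:
  assumes "open J" "t \<in> J" "J \<subseteq> S"
  shows "acceleration A g S x t = acceleration A g J x t"
  unfolding acceleration_def covariant_derivative_along_def Let_def velocity_open[OF assms]
    at_within_open_subset[OF assms] at_within_open[OF assms(2,1)]
  using vector_derivative_cong_open[OF assms(1,2), of UNIV
      "\<lambda>s. tangent_map A std_atlas (snd (chart_at A (x t))) (x s) (velocity A S x s)"
      "\<lambda>s. tangent_map A std_atlas (snd (chart_at A (x t))) (x s) (velocity A J x s)"]
    velocity_open[OF assms(1) _ assms(3)] by simp

end

context riemannian_lie_group
begin

lemma coframe_linear_on: "c \<in> A \<Longrightarrow> z \<in> snd c ` fst c \<Longrightarrow> linear (coframe c z)"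
  and frame_linear_on: "c \<in> A \<Longrightarrow> z \<in> snd c ` fst c \<Longrightarrow> linear (frame c z)"
  by (metis imageE coframe_linear) (metis imageE frame_linear)

lemma body_velocity_in_chart:
  assumes c: "c \<in> A" and S: "fat S" and x: "continuous_on S x" and t: "t \<in> S" "x t \<in> fst c"
    and q: "((\<lambda>s. snd c (x s)) has_vector_derivative q) (at t within S)"
  shows "body_velocity G S x t = coframe c (snd c (x t)) q"
  unfolding body_velocity_def coframe_def velocity_in_chart(1)[OF assms] chartD(5)[OF c t(2)] ..

lemma body_velocity_open: "open J \<Longrightarrow> t \<in> J \<Longrightarrow> J \<subseteq> S \<Longrightarrow> body_velocity G S x t = body_velocity G J x t"
  unfolding body_velocity_def by (simp only: velocity_open[of J t S])

text \<open>
  On a smooth piece \<open>P\<close> of a \<open>C\<^sup>1\<close> curve on \<open>S\<close>, the derivative within \<open>S\<close> may be computed within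
  \<open>P\<close>, which makes the body velocity smooth on \<open>P\<close>.
\<close>

lemma body_velocity_smooth:
  assumes S: "fat S" and P: "fat P" "P \<subseteq> S" and x1: "Ck_map_on 1 std_atlas A x S"
    and xP: "Ck_map_on (Suc k) std_atlas A x P"
  shows "Ck_on k (body_velocity G S x) P"
proof (rule Ck_on_local)
  fix t0 assume t0: "t0 \<in> P"
  define c where "c = chart_at A (x t0)"
  have c: "c \<in> A" "x t0 \<in> fst c" using chart_at by (auto simp: c_def)
  let ?x = "\<lambda>s. snd c (x s)"
  note rS = curve_rep[OF x1 c(1)] and rP = curve_rep[OF xP c(1)]
  obtain V where V: "open V" "P \<inter> x -` fst c = P \<inter> V" using curve_chart_domain[OF rP(1) c(1)] .
  obtain V' where V': "open V'" "S \<inter> x -` fst c = S \<inter> V'" using curve_chart_domain[OF rS(1) c(1)] .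
  have f: "fat (P \<inter> V)" "fat (S \<inter> V')" using fat_Int_open S P V V' by auto
  note dP = Ck_on_vector_derivative[OF rP(2)[unfolded V(2)] f(1)]
  have "Ck_on (Suc 0) ?x (S \<inter> V')" using rS(2) V'(2) by simp
  note dS = Ck_on_vector_derivative[OF this f(2)]
  have eq: "body_velocity G S x t = coframe c (?x t) (vector_derivative ?x (at t within P \<inter> V))" if t: "t \<in> P \<inter> V" for t
  proof -
    have tS: "t \<in> S \<inter> V'" "x t \<in> fst c" using t P V V' by auto
    have "(?x has_vector_derivative vector_derivative ?x (at t within S \<inter> V')) (at t within P \<inter> V)"
      by (rule has_vector_derivative_within_subset[OF dS(1)[OF tS(1)]]) (use V V' P in auto)
    then have e: "vector_derivative ?x (at t within P \<inter> V) = vector_derivative ?x (at t within S \<inter> V')"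
      by (rule vector_derivative_within[OF fat_not_bot[OF f(1) t]])
    have "(?x has_vector_derivative vector_derivative ?x (at t within S \<inter> V')) (at t within S)"
      using dS(1)[OF tS(1)] at_within_Int_open[of t V' S] tS(1) V'(1) by simp
    then show ?thesis
      unfolding e using body_velocity_in_chart[OF c(1) S rS(1) _ tS(2)] tS(1) by simp
  qed
  have "Ck_on k (\<lambda>t. coframe c (?x t) (vector_derivative ?x (at t within P \<inter> V))) (P \<inter> V)"
    by (rule linear_family_Ck[OF coframe_linear_on[OF c(1)] coframe_smooth[OF c(1)] f(1)
          Ck_on_Suc_imp[OF rP(2)[unfolded V(2)]] dP(2)]) (use V in auto)
  then have "Ck_on k (body_velocity G S x) (P \<inter> V)" by (rule Ck_on_cong) (simp add: eq)
  then show "\<exists>U. open U \<and> t0 \<in> U \<and> Ck_on k (body_velocity G S x) (P \<inter> U)"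
    using V t0 c by (intro exI[of _ V]) auto
qed

lemma inner_T_left: "left_invariant_metric G I p a b = I (T_left G (iv p) p a) (T_left G (iv p) p b)"
  by (simp add: left_invariant_metric_def)

text \<open>
  In a chart, with \<open>x' = E v\<close>, the covariant derivative \<open>x'' + \<Gamma>(x', x')\<close> of the velocity is
  \<open>DE(E v) v + E v' + \<Gamma>(E v, E v) = E (v' + \<nabla>\<^sub>v v)\<close>.
\<close>

lemma acceleration_body:
  assumes J: "open J" "t \<in> J" and x: "Ck_map_on 2 std_atlas A x J"
  defines "v \<equiv> body_velocity G J x"
  shows "T_left G (iv (x t)) (x t) (acceleration A g J x t) = vector_derivative v (at t) + nab (v t) (v t)"
proof -
  define c where "c = chart_at A (x t)"
  have c: "c \<in> A" "x t \<in> fst c" using chart_at by (auto simp: c_def)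
  let ?x = "\<lambda>s. snd c (x s)" and ?z = "snd c (x t)"
  have fJ: "fat J" by (rule fat_open[OF J(1)])
  have x2: "Ck_map_on (Suc (Suc 0)) std_atlas A x J" using x by (simp add: numeral_2_eq_2)
  note r = curve_rep[OF x2 c(1)]
  obtain V' where V': "open V'" "J \<inter> x -` fst c = J \<inter> V'" using curve_chart_domain[OF r(1) c(1)] .
  define V where "V = J \<inter> V'"
  have V: "open V" "V = J \<inter> x -` fst c" "t \<in> V" "V \<subseteq> J" using V' J c by (auto simp: V_def)
  have xk: "Ck_on (Suc (Suc 0)) ?x V" using r(2) V(2) by simp
  note d = Ck_on_open_vector_derivative[OF xk V(1)]
  let ?x' = "\<lambda>s. vector_derivative ?x (at s)"
  have inU: "?x s \<in> snd c ` fst c" if "s \<in> V" for s using that V(2) by auto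
  have vel: "tangent_map A std_atlas (snd c) (x s) (velocity A J x s) = ?x' s"
    and bv: "v s = coframe c (?x s) (?x' s)" if "s \<in> V" for s
  proof -
    have "s \<in> J" "x s \<in> fst c" using that V by auto
    moreover have "(?x has_vector_derivative ?x' s) (at s within J)"
      by (rule has_vector_derivative_at_within[OF d(1)[OF that]])
    ultimately show "tangent_map A std_atlas (snd c) (x s) (velocity A J x s) = ?x' s"
      "v s = coframe c (?x s) (?x' s)"
      using velocity_in_chart(2)[OF c(1) fJ r(1)] body_velocity_in_chart[OF c(1) fJ r(1)] by (auto simp: v_def)
  qed
  have x'_frame: "?x' s = frame c (?x s) (v s)" if "s \<in> V" for s
    using bv[OF that] frame_coframe[OF c(1), of "x s" "?x' s"] that V(2) by simp
  have "Ck_on (Suc 0) (\<lambda>s. coframe c (?x s) (?x' s)) V"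
    by (rule linear_family_Ck[OF coframe_linear_on[OF c(1)] coframe_smooth[OF c(1)] fat_open[OF V(1)]
          Ck_on_Suc_imp[OF xk] d(2) inU])
  then have "Ck_on (Suc 0) v V" by (rule Ck_on_cong) (simp add: bv)
  then have dv: "(v has_vector_derivative vector_derivative v (at t)) (at t)"
    by (rule Ck_on_open_vector_derivative(1)[OF _ V(1,3)])
  let ?DE = "der (\<lambda>y. frame c y (v t)) ?z"
  have "((\<lambda>s. frame c (?x s) (v s)) has_derivative
      (\<lambda>h. ?DE (h *\<^sub>R ?x' t) + frame c ?z (h *\<^sub>R vector_derivative v (at t)))) (at t within V)"
    by (rule linear_family_derivative[OF chartD(2)[OF c(1)] frame_linear_on[OF c(1)] frame_smooth[OF c(1)] _ _ V(3) inU])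
      (use d(1)[OF V(3)] dv in \<open>auto simp: has_vector_derivative_def intro: has_derivative_at_withinI\<close>)
  then have dE: "((\<lambda>s. frame c (?x s) (v s)) has_vector_derivative
      ?DE (?x' t) + frame c ?z (vector_derivative v (at t))) (at t)"
    using linear_scale[OF frame_linear[OF c]]
      linear_scale[OF has_derivative_linear[OF Ck_on_open_has_derivative[OF frame_smooth[OF c(1)] chartD(2)[OF c(1)] inU[OF V(3)]]]]
    by (simp add: has_vector_derivative_def at_within_open[OF V(3,1)] scaleR_add_right)
  have "((\<lambda>s. tangent_map A std_atlas (snd c) (x s) (velocity A J x s)) has_vector_derivative
      ?DE (?x' t) + frame c ?z (vector_derivative v (at t))) (at t)"
    by (rule has_vector_derivative_transform_within_open[OF dE V(1,3)]) (simp add: vel x'_frame)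
  then have acc: "acceleration A g J x t = ?DE (?x' t) + frame c ?z (vector_derivative v (at t))
      + christoffel A g c ?z (velocity A J x t) (velocity A J x t)"
    unfolding acceleration_def covariant_derivative_along_def Let_def c_def[symmetric] at_within_open[OF J(2,1)]
    by (simp add: vector_derivative_at)
  have "velocity A J x t = ?x' t"
    using vel[OF V(3)] chart_derivative_id[OF c] by (simp add: tangent_map_to_chart c_def)
  then have "acceleration A g J x t = frame c ?z (vector_derivative v (at t) + nab (v t) (v t))"
    unfolding acc x'_frame[OF V(3)] using christoffel_chart(2)[OF c(1) inU[OF V(3)], of "v t" "v t"]
    by (simp add: linear_add[OF frame_linear[OF c]] x'_frame[OF V(3)])
  then have "coframe c ?z (acceleration A g J x t) = vector_derivative v (at t) + nab (v t) (v t)"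
    using coframe_frame[OF c] by simp
  moreover have "coframe c ?z a = T_left G (iv (x t)) (x t) a" for a
    unfolding coframe_eq[OF c] T_left_eq by (simp add: c_def unit_chart_def)
  ultimately show ?thesis by simp
qed

definition integrand where
  "integrand \<sigma> V S x t = 1/2 * (g (x t) (acceleration A g S x t) (acceleration A g S x t)
     + \<sigma> * g (x t) (velocity A S x t) (velocity A S x t) + V (x t))"

lemma cost_integrand: "cost A g \<sigma> V T x = integral {0..T} (integrand \<sigma> V {0..T} x)"
  unfolding cost_def integrand_def ..

lemma integrand_body:
  assumes J: "open J" "t \<in> J" "J \<subseteq> S" and x: "Ck_map_on 2 std_atlas A x J"
  defines "v \<equiv> body_velocity G J x"
  shows "integrand \<sigma> V S x t = 1/2 * (I (vector_derivative v (at t) + nab (v t) (v t)) (vector_derivative v (at t) + nab (v t) (v t))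
    + \<sigma> * I (v t) (v t) + V (x t))"
  unfolding integrand_def inner_T_left acceleration_open[OF J] velocity_open[OF J]
    acceleration_body[OF J(1,2) x] v_def[symmetric] body_velocity_def[symmetric] ..

lemma integrand_cong:
  assumes "open W" "t \<in> W" "t \<in> S" "\<And>s. s \<in> S \<inter> W \<Longrightarrow> x s = y s"
  shows "integrand \<sigma> V S x t = integrand \<sigma> V S y t"
  using acceleration_cong[OF assms] velocity_cong[OF assms] assms by (simp add: integrand_def)

text \<open>
  In the interior of the piece the integrand is an expression in the body velocity that is
  continuous on the closed piece; at the two end points it may differ, since the acceleration of \<open>x\<close>
  within \<open>S\<close> need not exist there.
\<close>

lemma integrand_integrable_on_piece:
  assumes pq: "p < q" and S: "fat S" "{p..q} \<subseteq> S" and x1: "Ck_map_on 1 std_atlas A x S"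
    and xP: "smooth_map_on std_atlas A x {p..q}" and V: "continuous_on UNIV V"
  shows "integrand \<sigma> V S x integrable_on {p..q}"
proof -
  let ?P = "{p..q}"
  define v where "v = body_velocity G S x"
  define v1 where "v1 = (\<lambda>t. vector_derivative v (at t within ?P))"
  have fP: "fat ?P" by (rule fat_Icc[OF pq])
  have v: "Ck_on (Suc 0) v ?P"
    unfolding v_def by (rule body_velocity_smooth[OF S(1) fP S(2) x1]) (use xP in \<open>auto simp: smooth_map_on_def\<close>)
  note dv = Ck_on_vector_derivative[OF v fP]
  have c: "continuous_on ?P v" "continuous_on ?P v1" "continuous_on ?P x"
    using Ck_on_continuous[OF v] Ck_on_continuous[OF dv(2)] xP
    by (auto simp: v1_def smooth_map_on_def Ck_map_on_def)
  let ?h = "\<lambda>t. 1/2 * (I (v1 t + nab (v t) (v t)) (v1 t + nab (v t) (v t)) + \<sigma> * I (v t) (v t) + V (x t))"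
  have "continuous_on ?P ?h"
    by (intro continuous_intros bounded_bilinear.continuous_on[OF I_bounded_bilinear]
        bounded_bilinear.continuous_on[OF nab_bounded_bilinear] c continuous_on_compose2[OF V]) auto
  then have "?h integrable_on ?P" by (rule integrable_continuous_real)
  moreover have "integrand \<sigma> V S x t = ?h t" if "t \<in> ?P - {p, q}" for t
  proof -
    let ?J = "{p<..<q}"
    have J: "open ?J" "t \<in> ?J" "?J \<subseteq> S" "?J \<subseteq> ?P" using that S by auto
    have "Ck_map_on 2 std_atlas A x ?J"
      by (rule Ck_map_on_curve_subset[OF _ J(4) fat_open[OF J(1)]]) (use xP in \<open>auto simp: smooth_map_on_def\<close>)
    note ib = integrand_body[OF J(1-3) this, of \<sigma> V]
    have vJ: "body_velocity G ?J x s = v s" if "s \<in> ?J" for s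
      unfolding v_def using body_velocity_open[OF J(1) that J(3)] by simp
    have "vector_derivative (body_velocity G ?J x) (at t) = vector_derivative v (at t)"
      by (rule vector_derivative_cong_open[OF J(1,2)]) (use vJ in auto)
    also have "\<dots> = v1 t" unfolding v1_def using at_within_open_subset[OF J(1,2,4)] by simp
    finally show ?thesis using ib vJ[OF J(2)] by simp
  qed
  ultimately show ?thesis by (intro integrable_spike_finite[of "{p, q}" ?P "integrand \<sigma> V S x" ?h]) auto
qed

text \<open>
  Left-trivialized, the gradient represents the derivative of \<open>V\<close> along left-invariant fields.
\<close>

lemma gradient_body:
  assumes V: "Ck_map_on 2 A std_atlas V UNIV" and c: "c \<in> A" "p \<in> fst c"
  shows "I (body_gradient V p) w =
    der (\<lambda>z. V (chart_inv c z)) (snd c p) (frame c (snd c p) w)"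
    and "Ck_on 2 (\<lambda>z. V (chart_inv c z)) (snd c ` fst c)"
proof -
  have Vc: "Ck_on 2 (\<lambda>z. V (chart_inv c z)) (snd c ` fst c)" if "c \<in> A" for c
    using V that by (auto simp: Ck_map_on_def std_atlas_def comp_def)
  then show "Ck_on 2 (\<lambda>z. V (chart_inv c z)) (snd c ` fst c)" using c by blast
  have dV: "((\<lambda>z. V (chart_inv c z)) has_derivative der (\<lambda>z. V (chart_inv c z)) (snd c p)) (at (snd c p))"
    if "c \<in> A" "p \<in> fst c" for c
    using Ck_on_open_has_derivative[of 1 "\<lambda>z. V (chart_inv c z)" "snd c ` fst c" "snd c p"] Vc[OF that(1)]
      chartD(2)[OF that(1)] that by (auto simp: numeral_2_eq_2)
  let ?c' = "chart_at A p"
  have tV: "tangent_map A std_atlas V p = der (\<lambda>z. V (chart_inv ?c' z)) (snd ?c' p)"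
    by (simp add: tangent_map_def comp_def)
  have lin: "linear (tangent_map A std_atlas V p)"
    unfolding tV by (rule has_derivative_linear[OF dV[OF chart_at]])
  have inv: "T_left G p \<one>\<^bsub>G\<^esub> (T_left G (iv p) p u) = u" for u
    using T_left_compose[of p "iv p" p u] T_left_one[of p u] by simp
  have inv': "T_left G (iv p) p (T_left G p \<one>\<^bsub>G\<^esub> u) = u" for u
    using T_left_compose[of "iv p" p "\<one>\<^bsub>G\<^esub>" u] T_left_one[of "\<one>\<^bsub>G\<^esub>" u] by simp
  have "inner_product (g p)"
    unfolding inner_product_def
  proof (intro conjI allI impI)
    show "bilinear (g p)"
      unfolding bilinear_def inner_T_left
      by (auto intro!: linearI simp: I_simps linear_add[OF T_left_linear] linear_scale[OF T_left_linear])
    show "g p u w = g p w u" for u w unfolding inner_T_left by (rule I_sym)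
    show "0 < g p u u" if "u \<noteq> 0" for u
    proof -
      have "T_left G (iv p) p u \<noteq> 0" using inv[of u] that linear_0[OF T_left_linear] by auto
      then show ?thesis using inner unfolding inner_T_left inner_product_def by blast
    qed
  qed
  from theI'[OF inner_product_riesz[OF this lin]]
  have gr: "g p (gradient A g V p) u = tangent_map A std_atlas V p u" for u
    unfolding gradient_def by blast
  let ?u = "left_invariant_field G w p"
  have "I (body_gradient V p) w = g p (gradient A g V p) ?u"
    unfolding inner_T_left left_invariant_field_def inv' ..
  also have "\<dots> = der (\<lambda>z. V (chart_inv ?c' z)) (snd ?c' p) ?u"
    unfolding gr tV ..
  also have "\<dots> = der (\<lambda>z. V (chart_inv c z)) (snd c p) (chart_derivative ?c' c (\<lambda>x. x) p ?u)"
  proof -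
    have "((\<lambda>z. V (chart_inv c ((snd c \<circ> (\<lambda>x. x) \<circ> chart_inv ?c') z))) has_derivative
      (\<lambda>h. der (\<lambda>z. V (chart_inv c z)) (snd c p) (chart_derivative ?c' c (\<lambda>x. x) p h))) (at (snd ?c' p))"
      using has_derivative_compose[OF rep_has_derivative[OF chart_at(1) c(1) smooth_map_id chart_at(2) c(2)], of "\<lambda>z. V (chart_inv c z)"]
        dV[OF c] chartD(5)[OF chart_at] by simp
    then have "((\<lambda>z. V (chart_inv ?c' z)) has_derivative
      (\<lambda>h. der (\<lambda>z. V (chart_inv c z)) (snd c p) (chart_derivative ?c' c (\<lambda>x. x) p h))) (at (snd ?c' p))"
      by (rule has_derivative_transform_within_open[OF _ rep_domain_open[OF chart_at(1) c(1) smooth_map_id]])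
        (use c chart_at chartD(5)[OF c(1)] chartD(5)[OF chart_at(1)] in auto)
    then show ?thesis by (simp add: frechet_eqI)
  qed
  also have "chart_derivative ?c' c (\<lambda>x. x) p ?u = frame c (snd c p) w"
    using chartD(5)[OF c] by (simp add: frame_def in_chart_def tangent_map_to_chart)
  finally show "I (body_gradient V p) w =
    der (\<lambda>z. V (chart_inv c z)) (snd c p) (frame c (snd c p) w)" .
qed

end

section \<open>Variations supported in one chart\<close>

lemma integral_change:
  assumes f: "f integrable_on S" and h: "h integrable_on {a..b}" and sub: "{a..b} \<subseteq> S"
    and eq: "\<And>t. t \<in> S \<Longrightarrow> f' t = f t + (if t \<in> {a..b} then h t else 0)"
  shows "integral S f' = integral S f + integral {a..b} (h :: real \<Rightarrow> real)"
proof -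
  have "((\<lambda>t. if t \<in> {a..b} then h t else 0) has_integral integral {a..b} h) S"
    using has_integral_restrict[OF sub] integrable_integral[OF h] by blast
  from has_integral_add[OF integrable_integral[OF f] this]
  show ?thesis by (intro integral_unique) (rule has_integral_eq[rotated], auto simp: eq)
qed

text \<open>
  A curve that runs inside one chart during \<open>{p<..<q}\<close> is moved there, in coordinates, by
  \<open>r \<phi> w\<^sub>L\<close> with a bump function \<open>\<phi>\<close>; outside of the support of \<open>\<phi>\<close> nothing changes.
\<close>

locale bump_variation = riemannian_lie_group G I
  for G :: "('g::{t2_space, second_countable_topology}, 'e::euclidean_space) lie_group_structure" and I +
  fixes c :: "('g, 'e) chart" and x :: "real \<Rightarrow> 'g" and p a' b' q :: real and \<phi> :: "real \<Rightarrow> real" and w :: 'e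
    and \<epsilon> :: real
  assumes c: "c \<in> A" and ord: "p < a'" "a' < b'" "b' < q"
    and xJ: "\<And>t. t \<in> {p<..<q} \<Longrightarrow> x t \<in> fst c"
    and x_smooth: "smooth_map_on std_atlas A x {p<..<q}"
    and \<phi>: "smooth_on \<phi> UNIV" and supp: "\<And>t. t \<notin> {a'..b'} \<Longrightarrow> \<phi> t = 0"
    and \<epsilon>: "\<epsilon> > 0"
    and inU: "\<And>r t. r \<in> {-\<epsilon><..<\<epsilon>} \<Longrightarrow> t \<in> {p<..<q} \<Longrightarrow>
      snd c (x t) + r *\<^sub>R \<phi> t *\<^sub>R frame c (snd c (x t)) w \<in> snd c ` fst c"
begin

abbreviation J where "J \<equiv> {p<..<q}"
abbreviation xt where "xt \<equiv> \<lambda>t. snd c (x t)"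
definition Y where "Y r t = xt t + r *\<^sub>R \<phi> t *\<^sub>R frame c (xt t) w"
definition \<alpha> where "\<alpha> r t = (if t \<in> J then chart_inv c (Y r t) else x t)"

lemma fatJ: "fat J" by (rule fat_open) simp

lemma xt_smooth: "Ck_on k xt J"
  using curve_rep(2)[OF _ c, of k x J] x_smooth xJ
  by (auto simp: smooth_map_on_def Int_absorb2 subset_iff)

lemma \<alpha>_outside: "t \<notin> {a'..b'} \<Longrightarrow> \<alpha> r t = x t"
  by (simp add: \<alpha>_def Y_def supp chartD(5)[OF c] xJ)

lemma \<alpha>_zero: "\<alpha> 0 = x"
  by (auto simp: \<alpha>_def Y_def chartD(5)[OF c] xJ fun_eq_iff)

lemma \<alpha>_inside:
  assumes "r \<in> {-\<epsilon><..<\<epsilon>}" "t \<in> J" shows "\<alpha> r t \<in> fst c" "snd c (\<alpha> r t) = Y r t" "Y r t \<in> snd c ` fst c"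
proof -
  show Y: "Y r t \<in> snd c ` fst c" using inU[OF assms] by (simp add: Y_def)
  show "\<alpha> r t \<in> fst c" "snd c (\<alpha> r t) = Y r t"
    using chartD(6,7)[OF c Y] assms(2) by (simp_all add: \<alpha>_def)
qed

text \<open>
  The varied curves are described by the chart over \<open>J\<close> and by \<open>x\<close> off the support of \<open>\<phi>\<close>; these two
  sets of times are open and cover everything, and smoothness is local.
\<close>

lemma \<alpha>_Ck:
  assumes S: "fat S" and x: "Ck_map_on k std_atlas A x S"
  shows "Ck_map_on k std_atlas A (\<lambda>(r, t). \<alpha> r t) ({-\<epsilon><..<\<epsilon>} \<times> S)"
proof -
  let ?Q = "{-\<epsilon><..<\<epsilon>} \<times> S" and ?\<alpha> = "\<lambda>(r, t). \<alpha> r t"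
  let ?W1 = "UNIV \<times> J :: (real \<times> real) set" and ?W2 = "UNIV \<times> (- {a'..b'}) :: (real \<times> real) set"
  have W: "open ?W1" "open ?W2" by (auto intro!: open_Times)
  have cover: "z \<in> ?W1 \<or> z \<in> ?W2" for z using ord by (cases z) auto
  have fQ: "fat ?Q" by (intro fat_Times S fat_open) simp
  have fQ1: "fat (?Q \<inter> ?W1)" by (rule fat_Int_open[OF fQ W(1)])
  let ?Y = "\<lambda>z. Y (fst z) (snd z)"
  have Yk: "Ck_on k ?Y (?Q \<inter> ?W1)" for k
  proof -
    have s: "Ck_on k snd (?Q \<inter> ?W1)" "snd ` (?Q \<inter> ?W1) \<subseteq> J" by (auto intro!: Ck_on_snd fQ1)
    have f: "Ck_on k (\<lambda>t. frame c (xt t) w) J"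
      by (rule Ck_on_compose[OF fatJ frame_smooth[OF c] xt_smooth]) (use xJ in auto)
    have \<phi>J: "Ck_on k \<phi> J" by (rule Ck_on_subset[OF _ _ fatJ]) (use \<phi> in \<open>auto simp: smooth_on_def\<close>)
    show ?thesis
      unfolding Y_def
      by (intro Ck_on_add Ck_on_scaleR fQ1 Ck_on_fst Ck_on_compose[OF fQ1 xt_smooth s] Ck_on_compose[OF fQ1 f s]
          Ck_on_compose[OF fQ1 \<phi>J s])
  qed
  have Y_in: "?Y z \<in> snd c ` fst c" "?\<alpha> z = chart_inv c (?Y z)" if "z \<in> ?Q \<inter> ?W1" for z
    using that \<alpha>_inside(3) by (cases z; auto simp: \<alpha>_def)+
  have \<alpha>_W2: "?\<alpha> z = x (snd z)" if "z \<in> ?W2" for z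
    using that \<alpha>_outside by (cases z) auto
  have cx: "continuous_on S x" using x by (simp add: Ck_map_on_def)
  have cont1: "continuous_on (?Q \<inter> ?W1) ?\<alpha>"
  proof (rule continuous_on_eq[OF continuous_on_compose2[OF chartD(4)[OF c] Ck_on_continuous[OF Yk[of 0]]]])
    show "?Y ` (?Q \<inter> ?W1) \<subseteq> snd c ` fst c" using Y_in(1) by blast
    show "chart_inv c (?Y z) = ?\<alpha> z" if "z \<in> ?Q \<inter> ?W1" for z using Y_in(2)[OF that] by simp
  qed
  have cont2: "continuous_on (?Q \<inter> ?W2) ?\<alpha>"
    by (rule continuous_on_eq[OF continuous_on_compose2[OF cx, of "?Q \<inter> ?W2" snd]])
      (auto intro!: continuous_intros simp: \<alpha>_outside)
  have cont: "continuous_on ?Q ?\<alpha>"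
    unfolding continuous_on_eq_continuous_within
  proof
    fix z assume z: "z \<in> ?Q"
    from cover[of z] show "continuous (at z within ?Q) ?\<alpha>"
    proof
      assume "z \<in> ?W1"
      then show ?thesis using cont1 z at_within_Int_open[OF _ W(1), of z ?Q]
        unfolding continuous_on_eq_continuous_within by (metis IntI)
    next
      assume "z \<in> ?W2"
      then show ?thesis using cont2 z at_within_Int_open[OF _ W(2), of z ?Q]
        unfolding continuous_on_eq_continuous_within by (metis IntI)
    qed
  qed
  show ?thesis
  proof (rule Ck_map_on_curveI[OF cont])
    fix d assume d: "d \<in> A"
    let ?D = "?Q \<inter> ?\<alpha> -` fst d"
    obtain V where V: "open V" "?D = ?Q \<inter> V" using curve_chart_domain[OF cont d] .
    have fD: "fat (?D \<inter> W)" if "open W" for W using fat_Int_open[OF fat_Int_open[OF fQ V(1)] that] V(2) by simp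
    show "Ck_on k (\<lambda>z. snd d (?\<alpha> z)) ?D"
    proof (rule Ck_on_local)
      fix z assume z: "z \<in> ?D"
      have 1: "Ck_on k (\<lambda>z. snd d (?\<alpha> z)) (?D \<inter> ?W1)"
      proof -
        have "?Y ` (?D \<inter> ?W1) \<subseteq> snd c ` (fst c \<inter> (\<lambda>x. x) -` fst d)"
        proof
          fix y assume "y \<in> ?Y ` (?D \<inter> ?W1)"
          then obtain z where z: "z \<in> ?D \<inter> ?W1" "y = ?Y z" by blast
          then have "y \<in> snd c ` fst c" "chart_inv c y \<in> fst d" using Y_in[of z] by auto
          then show "y \<in> snd c ` (fst c \<inter> (\<lambda>x. x) -` fst d)"
            using chartD(6,7)[OF c] by (intro image_eqI[of _ _ "chart_inv c y"]) auto
        qed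
        moreover have "Ck_on k ?Y (?D \<inter> ?W1)" by (rule Ck_on_subset[OF Yk _ fD[OF W(1)]]) auto
        ultimately have "Ck_on k (\<lambda>z. (snd d \<circ> (\<lambda>x. x) \<circ> chart_inv c) (?Y z)) (?D \<inter> ?W1)"
          using Ck_on_compose[OF fD[OF W(1)] rep_smooth[OF c d smooth_map_id]] by blast
        then show ?thesis
        proof (rule Ck_on_cong)
          fix z assume "z \<in> ?D \<inter> ?W1"
          then have "?\<alpha> z = chart_inv c (?Y z)" by (intro Y_in(2)) blast
          then show "(snd d \<circ> (\<lambda>x. x) \<circ> chart_inv c) (?Y z) = snd d (?\<alpha> z)" by simp
        qed
      qed
      have 2: "Ck_on k (\<lambda>z. snd d (?\<alpha> z)) (?D \<inter> ?W2)"
      proof -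
        have sub: "snd ` (?D \<inter> ?W2) \<subseteq> S \<inter> x -` fst d"
        proof
          fix t assume "t \<in> snd ` (?D \<inter> ?W2)"
          then obtain z where z: "z \<in> ?D \<inter> ?W2" "t = snd z" by blast
          then show "t \<in> S \<inter> x -` fst d" using \<alpha>_W2[of z] by (cases z) auto
        qed
        have "Ck_on k (\<lambda>z. snd d (x (snd z))) (?D \<inter> ?W2)"
          by (rule Ck_on_compose[OF fD[OF W(2)] curve_rep(2)[OF x d] Ck_on_snd[OF fD[OF W(2)]] sub])
        then show ?thesis
        proof (rule Ck_on_cong)
          fix z assume "z \<in> ?D \<inter> ?W2"
          then have "?\<alpha> z = x (snd z)" by (intro \<alpha>_W2) blast
          then show "snd d (x (snd z)) = snd d (?\<alpha> z)" by simp
        qed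
      qed
      show "\<exists>U. open U \<and> z \<in> U \<and> Ck_on k (\<lambda>z. snd d (?\<alpha> z)) (?D \<inter> U)"
        using cover[of z] 1 2 W by blast
    qed
  qed
qed

lemma \<alpha>_slice_Ck:
  assumes S: "fat S" and x: "Ck_map_on k std_atlas A x S" and r: "r \<in> {-\<epsilon><..<\<epsilon>}"
  shows "Ck_map_on k std_atlas A (\<alpha> r) S"
proof -
  let ?Q = "{-\<epsilon><..<\<epsilon>} \<times> S" and ?\<alpha> = "\<lambda>(r, t). \<alpha> r t"
  note A = \<alpha>_Ck[OF S x]
  have "continuous_on S (\<lambda>t. ?\<alpha> (r, t))"
    by (rule continuous_on_compose2[of ?Q ?\<alpha>]) (use A r in \<open>auto simp: Ck_map_on_def intro!: continuous_intros\<close>)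
  then have cont: "continuous_on S (\<alpha> r)" by simp
  show ?thesis
  proof (rule Ck_map_on_curveI[OF cont])
    fix d assume d: "d \<in> A"
    obtain V where V: "open V" "S \<inter> \<alpha> r -` fst d = S \<inter> V" using curve_chart_domain[OF cont d] .
    have f: "fat (S \<inter> \<alpha> r -` fst d)" unfolding V(2) by (rule fat_Int_open[OF S V(1)])
    have "Ck_on k (\<lambda>t. snd d (?\<alpha> (r, t))) (S \<inter> \<alpha> r -` fst d)"
      by (rule Ck_on_compose[OF f curve_rep(2)[OF A d]
            Ck_on_Pair[OF f Ck_on_const[OF f] Ck_on_linear[OF bounded_linear_ident f]]]) (use r in auto)
    then show "Ck_on k (\<lambda>s. snd d (\<alpha> r s)) (S \<inter> \<alpha> r -` fst d)" by simp
  qed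
qed

definition W where "W r t = coframe c (Y r t) (vector_derivative (Y r) (at t))"

lemma body_velocity_\<alpha>:
  assumes r: "r \<in> {-\<epsilon><..<\<epsilon>}" and t: "t \<in> J" shows "body_velocity G J (\<alpha> r) t = W r t"
proof -
  have Jop: "open J" by simp
  have "Ck_map_on 1 std_atlas A (\<alpha> r) J"
    by (rule \<alpha>_slice_Ck[OF fatJ _ r]) (use x_smooth in \<open>auto simp: smooth_map_on_def\<close>)
  note A = curve_rep[OF this c]
  have eq: "J \<inter> \<alpha> r -` fst c = J" using \<alpha>_inside(1)[OF r] by auto
  have "Ck_on (Suc 0) (\<lambda>s. snd c (\<alpha> r s)) J" using A(2) eq by simp
  then have "Ck_on (Suc 0) (Y r) J" by (rule Ck_on_cong) (use \<alpha>_inside(2)[OF r] in auto)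
  from Ck_on_open_vector_derivative(1)[OF this Jop t]
  have "((\<lambda>s. snd c (\<alpha> r s)) has_vector_derivative vector_derivative (Y r) (at t)) (at t)"
    by (rule has_vector_derivative_transform_within_open[OF _ Jop t]) (use \<alpha>_inside(2)[OF r] in auto)
  from body_velocity_in_chart[OF c fatJ A(1) t \<alpha>_inside(1)[OF r t] has_vector_derivative_at_within[OF this]]
  show ?thesis unfolding W_def \<alpha>_inside(2)[OF r t] .
qed

lemma integrand_\<alpha>:
  assumes r: "r \<in> {-\<epsilon><..<\<epsilon>}" and t: "t \<in> J" and S: "J \<subseteq> S"
  shows "integrand \<sigma> V S (\<alpha> r) t = 1/2 * (I (vector_derivative (W r) (at t) + nab (W r t) (W r t))
      (vector_derivative (W r) (at t) + nab (W r t) (W r t)) + \<sigma> * I (W r t) (W r t) + V (chart_inv c (Y r t)))"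
proof -
  have Jop: "open J" by simp
  have "Ck_map_on 2 std_atlas A (\<alpha> r) J"
    by (rule \<alpha>_slice_Ck[OF fatJ _ r]) (use x_smooth in \<open>auto simp: smooth_map_on_def\<close>)
  note ib = integrand_body[OF Jop t S this, of \<sigma> V]
  have "vector_derivative (body_velocity G J (\<alpha> r)) (at t) = vector_derivative (W r) (at t)"
    by (rule vector_derivative_cong_open[OF Jop t]) (use body_velocity_\<alpha>[OF r] in auto)
  then show ?thesis using ib body_velocity_\<alpha>[OF r t] t by (simp add: \<alpha>_def)
qed

text \<open>
  The part of the integral outside of the support does not depend on \<open>r\<close>, the part inside
  has the derivative computed in the chart.
\<close>

lemma cost_derivative:
  assumes ab: "p < a" "a < a'" "b' < b" "b < q" and T: "J \<subseteq> {0..T}"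
    and int: "integrand \<sigma> V {0..T} x integrable_on {0..T}"
    and V: "Ck_map_on 2 A std_atlas V UNIV"
  defines "v \<equiv> body_velocity G J x"
  defines "v1 \<equiv> \<lambda>t. vector_derivative v (at t)"
  defines "v2 \<equiv> \<lambda>t. vector_derivative v1 (at t)"
  defines "v3 \<equiv> \<lambda>t. vector_derivative v2 (at t)"
  shows "((\<lambda>r. cost A g \<sigma> V T (\<alpha> r)) has_real_derivative
    integral {a..b} (\<lambda>t. \<phi> t * (I (EL \<sigma> (v t) (v1 t) (v2 t) (v3 t)) w
      + 1/2 * I (body_gradient V (x t)) w))) (at 0)"
proof -
  interpret F: metric_frame "snd c ` fst c" "frame c" "coframe c" lie_algebra_bracket I by (rule metric_frame_locale[OF c])
  define L where "L = (\<lambda>r t. 1/2 * (I (vector_derivative (W r) (at t) + nab (W r t) (W r t))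
      (vector_derivative (W r) (at t) + nab (W r t) (W r t)) + \<sigma> * I (W r t) (W r t) + V (chart_inv c (Y r t))))"
  have x_in: "xt t \<in> snd c ` fst c" if "t \<in> J" for t using xJ[OF that] by auto
  have xs: "smooth_on xt J" using xt_smooth by (simp add: smooth_on_def)
  have \<Psi>: "Ck_on 2 (\<lambda>z. V (chart_inv c z)) (snd c ` fst c)"
    using gradient_body(2)[OF V c xJ[of "(p + q) / 2"]] ord by auto
  note fv = F.first_variation[where \<sigma> = \<sigma> and w = w and xt = xt and \<phi> = \<phi> and \<epsilon> = \<epsilon> and p = p and q = q
      and a = a and a' = a' and b' = b' and b = b and \<Psi> = "\<lambda>z. V (chart_inv c z)", folded Y_def, folded W_def]
  have inY: "Y r t \<in> snd c ` fst c" if "r \<in> {-\<epsilon><..<\<epsilon>}" "t \<in> J" for r t by (rule \<alpha>_inside(3)[OF that])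
  have abJ: "{a..b} \<subseteq> J" using ab by auto
  have LI: "L r integrable_on {a..b}" if "r \<in> {-\<epsilon><..<\<epsilon>}" for r
    unfolding L_def
    by (rule fv(1); (rule ab ord xs x_in \<phi> supp \<epsilon> inY \<Psi> that; assumption?))
  have 0: "0 \<in> {-\<epsilon><..<\<epsilon>}" using \<epsilon> by simp
  have cost: "cost A g \<sigma> V T (\<alpha> r) = cost A g \<sigma> V T x - integral {a..b} (L 0) + integral {a..b} (L r)"
    if r: "r \<in> {-\<epsilon><..<\<epsilon>}" for r
  proof -
    have "integral {0..T} (integrand \<sigma> V {0..T} (\<alpha> r)) =
      integral {0..T} (integrand \<sigma> V {0..T} x) + integral {a..b} (\<lambda>t. L r t - L 0 t)"
    proof (rule integral_change[OF int integrable_diff[OF LI[OF r] LI[OF 0]]])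
      show "{a..b} \<subseteq> {0..T}" using abJ T by blast
      fix t assume t: "t \<in> {0..T}"
      show "integrand \<sigma> V {0..T} (\<alpha> r) t = integrand \<sigma> V {0..T} x t + (if t \<in> {a..b} then L r t - L 0 t else 0)"
      proof (cases "t \<in> {a..b}")
        case True
        then have "t \<in> J" using abJ by blast
        from integrand_\<alpha>[OF r this T, of \<sigma> V] integrand_\<alpha>[OF 0 this T, of \<sigma> V]
        have "integrand \<sigma> V {0..T} (\<alpha> r) t = L r t" "integrand \<sigma> V {0..T} x t = L 0 t"
          unfolding \<alpha>_zero L_def .
        then show ?thesis using True by simp
      next
        case False
        then have "t \<in> - {a'..b'}" using ab by auto
        moreover have "open (- {a'..b'})" by auto
        ultimately show ?thesis
          using integrand_cong[of "- {a'..b'}" t "{0..T}" "\<alpha> r" x] t False \<alpha>_outside by auto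
      qed
    qed
    then show ?thesis unfolding cost_integrand by (simp add: integral_diff[OF LI[OF r] LI[OF 0]])
  qed
  have vW: "v t = coframe c (xt t) (vector_derivative xt (at t))" if "t \<in> J" for t
  proof -
    have "Y 0 = xt" by (auto simp: Y_def)
    then show ?thesis using body_velocity_\<alpha>[OF 0 that] by (simp add: v_def \<alpha>_zero W_def)
  qed
  let ?v = "\<lambda>t. coframe c (xt t) (vector_derivative xt (at t))"
  let ?v1 = "\<lambda>t. vector_derivative ?v (at t)"
  let ?v2 = "\<lambda>t. vector_derivative ?v1 (at t)"
  let ?v3 = "\<lambda>t. vector_derivative ?v2 (at t)"
  have Jop: "open J" by simp
  have e1: "?v1 t = v1 t" if "t \<in> J" for t
    unfolding v1_def by (rule vector_derivative_cong_open[OF Jop that]) (use vW in auto)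
  have e2: "?v2 t = v2 t" if "t \<in> J" for t
    unfolding v2_def by (rule vector_derivative_cong_open[OF Jop that]) (use e1 in auto)
  have e3: "?v3 t = v3 t" if "t \<in> J" for t
    unfolding v3_def by (rule vector_derivative_cong_open[OF Jop that]) (use e2 in auto)
  have "((\<lambda>r. integral {a..b} (L r)) has_real_derivative
      integral {a..b} (\<lambda>t. \<phi> t * (I (EL \<sigma> (?v t) (?v1 t) (?v2 t) (?v3 t)) w
        + 1/2 * der (\<lambda>z. V (chart_inv c z)) (xt t) (frame c (xt t) w)))) (at 0)"
    unfolding L_def
    by (rule fv(2); (rule ab ord xs x_in \<phi> supp \<epsilon> inY \<Psi>; assumption?))
  moreover have "integral {a..b} (\<lambda>t. \<phi> t * (I (EL \<sigma> (?v t) (?v1 t) (?v2 t) (?v3 t)) w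
        + 1/2 * der (\<lambda>z. V (chart_inv c z)) (xt t) (frame c (xt t) w))) =
      integral {a..b} (\<lambda>t. \<phi> t * (I (EL \<sigma> (v t) (v1 t) (v2 t) (v3 t)) w
      + 1/2 * I (body_gradient V (x t)) w))"
  proof (rule integral_cong)
    fix t assume "t \<in> {a..b}"
    then have t: "t \<in> J" using abJ by blast
    show "\<phi> t * (I (EL \<sigma> (?v t) (?v1 t) (?v2 t) (?v3 t)) w
        + 1/2 * der (\<lambda>z. V (chart_inv c z)) (xt t) (frame c (xt t) w)) =
      \<phi> t * (I (EL \<sigma> (v t) (v1 t) (v2 t) (v3 t)) w
      + 1/2 * I (body_gradient V (x t)) w)"
      unfolding gradient_body(1)[OF V c xJ[OF t]] e1[OF t] e2[OF t] e3[OF t] vW[OF t] ..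
  qed
  ultimately have d: "((\<lambda>r. integral {a..b} (L r)) has_real_derivative
      integral {a..b} (\<lambda>t. \<phi> t * (I (EL \<sigma> (v t) (v1 t) (v2 t) (v3 t)) w
      + 1/2 * I (body_gradient V (x t)) w))) (at 0)" by (simp only:)
  have "((\<lambda>r. cost A g \<sigma> V T x - integral {a..b} (L 0) + integral {a..b} (L r)) has_real_derivative
      0 + integral {a..b} (\<lambda>t. \<phi> t * (I (EL \<sigma> (v t) (v1 t) (v2 t) (v3 t)) w
      + 1/2 * I (body_gradient V (x t)) w))) (at 0)"
    by (rule DERIV_add[OF DERIV_const d])
  then show ?thesis
    unfolding add_0_left
    by (rule has_field_derivative_transform_within_open[of _ _ _ "{-\<epsilon><..<\<epsilon>}"]) (use cost 0 in auto)
qed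

lemma \<alpha>_admissible:
  assumes x: "x \<in> admissible_curves A N \<tau> X v0 vN"
    and \<tau>: "0 < \<tau> N" "\<And>i. i \<in> {1..N} \<Longrightarrow> \<tau> (i - 1) < \<tau> i" "\<And>i. i \<le> N \<Longrightarrow> \<tau> i \<notin> J" "\<tau> 0 = 0"
  shows "admissible_variation A N \<tau> X v0 vN x \<alpha>"
  unfolding admissible_variation_def
proof (intro exI[of _ \<epsilon>] conjI ballI \<epsilon>)
  have x1: "Ck_map_on 1 std_atlas A x {0..\<tau> N}"
    and xs: "\<And>i k. i \<in> {1..N} \<Longrightarrow> Ck_map_on k std_atlas A x {\<tau> (i - 1)..\<tau> i}"
    using x by (auto simp: admissible_curves_def smooth_map_on_def)
  show "Ck_map_on 1 std_atlas A (\<lambda>(r, t). \<alpha> r t) ({-\<epsilon><..<\<epsilon>} \<times> {0..\<tau> N})"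
    by (rule \<alpha>_Ck[OF fat_Icc[OF \<tau>(1)] x1])
  show "smooth_map_on std_atlas A (\<lambda>(r, t). \<alpha> r t) ({-\<epsilon><..<\<epsilon>} \<times> {\<tau> (i - 1)..\<tau> i})" if "i \<in> {1..N}" for i
    unfolding smooth_map_on_def using \<alpha>_Ck[OF fat_Icc[OF \<tau>(2)[OF that]] xs[OF that]] by blast
  show "\<alpha> 0 t = x t" for t by (simp add: \<alpha>_zero)
  fix r assume r: "r \<in> {-\<epsilon><..<\<epsilon>}"
  have out: "\<tau> i \<notin> {a'..b'}" if "i \<le> N" for i using \<tau>(3)[OF that] ord by auto
  have fixed: "\<alpha> r (\<tau> i) = x (\<tau> i)" if "i \<le> N" for i by (rule \<alpha>_outside[OF out[OF that]])
  have vel: "velocity A {0..\<tau> N} (\<alpha> r) (\<tau> i) = velocity A {0..\<tau> N} x (\<tau> i)"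
    if "i \<le> N" "\<tau> i \<in> {0..\<tau> N}" for i
  proof (rule velocity_cong[of "- {a'..b'}"])
    show "open (- {a'..b'})" by auto
    show "\<tau> i \<in> - {a'..b'}" using out[OF that(1)] by blast
    show "\<alpha> r s = x s" if "s \<in> {0..\<tau> N} \<inter> - {a'..b'}" for s using that \<alpha>_outside by blast
  qed (use that in auto)
  have e: "\<alpha> r 0 = x 0" "velocity A {0..\<tau> N} (\<alpha> r) 0 = velocity A {0..\<tau> N} x 0"
    using fixed[of 0] vel[of 0] \<tau> by auto
  show "\<alpha> r \<in> admissible_curves A N \<tau> X v0 vN"
    unfolding admissible_curves_def
  proof (intro CollectI conjI ballI)
    show "Ck_map_on 1 std_atlas A (\<alpha> r) {0..\<tau> N}"
      by (rule \<alpha>_slice_Ck[OF fat_Icc[OF \<tau>(1)] x1 r])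
    show "smooth_map_on std_atlas A (\<alpha> r) {\<tau> (i - 1)..\<tau> i}" if "i \<in> {1..N}" for i
      unfolding smooth_map_on_def using \<alpha>_slice_Ck[OF fat_Icc[OF \<tau>(2)[OF that]] xs[OF that] r] by blast
  qed (use x fixed e vel[of N] \<tau>(1) in \<open>auto simp: admissible_curves_def\<close>)
qed

end

section \<open>The Euler-Lagrange equation\<close>

context riemannian_lie_group
begin

lemma gradient_continuous:
  assumes V: "Ck_map_on 2 A std_atlas V UNIV" and P: "fat P"
    and x: "Ck_map_on 1 std_atlas A x P"
  shows "continuous_on P (\<lambda>t. I (body_gradient V (x t)) w)"
proof -
  have "Ck_on 0 (\<lambda>t. I (body_gradient V (x t)) w) P"
  proof (rule Ck_on_local)
    fix t0 assume t0: "t0 \<in> P"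
    define c where "c = chart_at A (x t0)"
    have c: "c \<in> A" "x t0 \<in> fst c" using chart_at by (auto simp: c_def)
    let ?x = "\<lambda>s. snd c (x s)" and ?U = "snd c ` fst c"
    note r = curve_rep[OF x c(1)]
    obtain W where W: "open W" "P \<inter> x -` fst c = P \<inter> W" using curve_chart_domain[OF r(1) c(1)] .
    have xW: "x t \<in> fst c" if "t \<in> P \<inter> W" for t using W(2) that by blast
    have f: "fat (P \<inter> W)" by (rule fat_Int_open[OF P W(1)])
    have \<Psi>: "Ck_on (Suc 1) (\<lambda>z. V (chart_inv c z)) ?U" using gradient_body(2)[OF V c] by (simp add: numeral_2_eq_2)
    have xk: "Ck_on 1 ?x (P \<inter> W)" using r(2) W(2) by simp
    have "Ck_on 1 (\<lambda>t. der (\<lambda>z. V (chart_inv c z)) (?x t) (frame c (?x t) w)) (P \<inter> W)"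
      by (rule linear_family_Ck[where U = ?U, OF has_derivative_linear[OF Ck_on_open_has_derivative[OF \<Psi> chartD(2)[OF c(1)]]]
            Ck_on_open_frechet[OF \<Psi> chartD(2)[OF c(1)]] f xk Ck_on_compose[OF f frame_smooth[OF c(1)] xk]])
        (use xW in auto)
    then have "Ck_on 1 (\<lambda>t. I (body_gradient V (x t)) w) (P \<inter> W)"
      by (rule Ck_on_cong) (simp add: gradient_body(1)[OF V c(1) xW])
    then show "\<exists>U. open U \<and> t0 \<in> U \<and>
      Ck_on 0 (\<lambda>t. I (body_gradient V (x t)) w) (P \<inter> U)"
      using W t0 c Ck_on_le[of 1 _ _ 0] by (intro exI[of _ W]) auto
  qed
  then show ?thesis by simp
qed

lemma integrand_integrable:
  assumes x: "x \<in> admissible_curves A N \<tau> X v0 vN" and V: "continuous_on UNIV V"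
    and \<tau>: "\<tau> 0 = 0" "\<And>i. i < N \<Longrightarrow> \<tau> i < \<tau> (Suc i)" "\<And>i. i \<le> N \<Longrightarrow> 0 \<le> \<tau> i \<and> \<tau> i \<le> \<tau> N" "0 < \<tau> N"
  shows "integrand \<sigma> V {0..\<tau> N} x integrable_on {0..\<tau> N}"
proof -
  have x1: "Ck_map_on 1 std_atlas A x {0..\<tau> N}"
    and xs: "\<And>i. i \<in> {1..N} \<Longrightarrow> smooth_map_on std_atlas A x {\<tau> (i - 1)..\<tau> i}"
    using x by (auto simp: admissible_curves_def)
  have "integrand \<sigma> V {0..\<tau> N} x integrable_on {0..\<tau> n}" if "n \<le> N" for n
    using that
  proof (induction n)
    case 0
    show ?case using integrable_on_refl[of _ "0::real"] \<tau>(1) by simp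
  next
    case (Suc n)
    have "integrand \<sigma> V {0..\<tau> N} x integrable_on {\<tau> n..\<tau> (Suc n)}"
    proof (rule integrand_integrable_on_piece[OF _ fat_Icc[OF \<tau>(4)] _ x1 _ V])
      show "\<tau> n < \<tau> (Suc n)" using \<tau>(2)[of n] Suc.prems by simp
      show "{\<tau> n..\<tau> (Suc n)} \<subseteq> {0..\<tau> N}" using \<tau>(3)[of n] \<tau>(3)[of "Suc n"] Suc.prems by auto
      show "smooth_map_on std_atlas A x {\<tau> n..\<tau> (Suc n)}" using xs[of "Suc n"] Suc.prems by simp
    qed
    then show ?case
      using Henstock_Kurzweil_Integration.integrable_combine[of 0 "\<tau> n" "\<tau> (Suc n)"] Suc \<tau>(2)[of n] \<tau>(3)[of n] by simp
  qed
  then show ?thesis by blast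
qed

text \<open>
  At an interior time the Euler-Lagrange expression vanishes: otherwise, by continuity, it has a fixed
  sign near \<open>t0\<close> when paired with some \<open>w\<close>, and so has the derivative of the cost along a variation
  in the direction \<open>\<phi> w\<^sub>L\<close> with a bump function \<open>\<phi>\<close> supported near \<open>t0\<close>.
\<close>

lemma euler_lagrange_interior:
  fixes w :: 'e
  assumes V: "Ck_map_on 2 A std_atlas V UNIV"
    and ext: "extremizer A g \<sigma> V N \<tau> X v0 vN x"
    and \<tau>0: "\<tau> 0 = 0" and \<tau>_Suc: "\<And>i. i < N \<Longrightarrow> \<tau> i < \<tau> (Suc i)"
    and i: "i \<in> {1..N}" and t0: "t0 \<in> {\<tau> (i - 1)<..<\<tau> i}"
  defines "P \<equiv> {\<tau> (i - 1)..\<tau> i}"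
  defines "v \<equiv> body_velocity G {0..\<tau> N} x"
  defines "D \<equiv> \<lambda>f s. vector_derivative f (at s within P)"
  defines "H \<equiv> \<lambda>t. I (EL \<sigma> (v t) (D v t) (D (D v) t) (D (D (D v)) t)) w
      + 1/2 * I (body_gradient V (x t)) w"
  shows "continuous_on P H" and "H t0 = 0"
proof -
  have \<tau>_less: "\<tau> j < \<tau> k" if "j < k" "k \<le> N" for j k
    using that
  proof (induction k)
    case (Suc k)
    show ?case
    proof (cases "j = k")
      case True then show ?thesis using \<tau>_Suc[of k] Suc.prems by simp
    next
      case False
      then have "\<tau> j < \<tau> k" using Suc by simp
      then show ?thesis using \<tau>_Suc[of k] Suc.prems by simp
    qed
  qed simp
  have \<tau>_le: "\<tau> j \<le> \<tau> k" if "j \<le> k" "k \<le> N" for j k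
    using \<tau>_less[of j k] that by (cases "j = k") auto
  define S where "S = {0..\<tau> N}"
  have TN: "0 < \<tau> N" using \<tau>_less[of 0 N] i \<tau>0 by simp
  have fS: "fat S" unfolding S_def by (rule fat_Icc[OF TN])
  have lu: "\<tau> (i - 1) < \<tau> i" using \<tau>_less[of "i - 1" i] i by simp
  have fP: "fat P" unfolding P_def by (rule fat_Icc[OF lu])
  have PS: "P \<subseteq> S" using \<tau>_le[of 0 "i - 1"] \<tau>_le[of i N] i \<tau>0 by (auto simp: P_def S_def)
  have x: "x \<in> admissible_curves A N \<tau> X v0 vN" using ext by (simp add: extremizer_def)
  have x1: "Ck_map_on 1 std_atlas A x S" and xP: "\<And>k. Ck_map_on k std_atlas A x P"
    using x i by (auto simp: admissible_curves_def smooth_map_on_def S_def P_def)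
  have vk: "Ck_on k v P" for k
    unfolding v_def S_def[symmetric] by (rule body_velocity_smooth[OF fS fP PS x1 xP])
  have DkI: "Ck_on k (D f) P" if "\<And>k. Ck_on k f P" for f :: "real \<Rightarrow> 'e" and k
    unfolding D_def by (rule Ck_on_vector_derivative(2)[OF that fP])
  have Dk: "Ck_on k (D v) P" "Ck_on k (D (D v)) P" "Ck_on k (D (D (D v))) P" for k
    by (intro DkI vk)+
  show H_cont: "continuous_on P H"
    unfolding H_def
    by (intro continuous_intros bounded_bilinear.continuous_on[OF I_bounded_bilinear] EL_continuous
        gradient_continuous[OF V fP xP] Ck_on_continuous[OF vk[of 0]] Ck_on_continuous[OF Dk(1)[of 0]]
        Ck_on_continuous[OF Dk(2)[of 0]] Ck_on_continuous[OF Dk(3)[of 0]])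
  show "H t0 = 0"
  proof (rule ccontr)
    assume H0: "H t0 \<noteq> 0"
    have t0P: "t0 \<in> P" using t0 by (auto simp: P_def)
    define c where "c = chart_at A (x t0)"
    have c: "c \<in> A" "x t0 \<in> fst c" using chart_at by (auto simp: c_def)
    have cx: "continuous_on P x" using xP[of 0] by (simp add: Ck_map_on_def)
    obtain W where W: "open W" "P \<inter> x -` fst c = P \<inter> W" using curve_chart_domain[OF cx c(1)] .
    have "open ({\<tau> (i - 1)<..<\<tau> i} \<inter> W)" "t0 \<in> {\<tau> (i - 1)<..<\<tau> i} \<inter> W" using W c t0 t0P by auto
    then obtain \<kappa>1 where \<kappa>1: "\<kappa>1 > 0" "ball t0 \<kappa>1 \<subseteq> {\<tau> (i - 1)<..<\<tau> i} \<inter> W" by (meson openE)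
    obtain \<kappa>2 where \<kappa>2: "\<kappa>2 > 0" "\<And>t. t \<in> P \<Longrightarrow> dist t t0 < \<kappa>2 \<Longrightarrow> dist (H t) (H t0) < \<bar>H t0\<bar>"
      using H_cont t0P H0 unfolding continuous_on_iff by (metis zero_less_abs_iff)
    \<comment> \<open>Nested windows around \<open>t0\<close>: the bump lives on \<open>(a', b')\<close>, the integral is taken over \<open>[a, b]\<close>, and
      on \<open>(p, q)\<close> the curve stays in the chart and \<open>H\<close> keeps its sign.\<close>
    define \<kappa> where "\<kappa> = min \<kappa>1 \<kappa>2"
    define p a a' b' b q where "p = t0 - \<kappa>" and "a = t0 - 3/4 * \<kappa>" and "a' = t0 - 1/2 * \<kappa>"
      and "b' = t0 + 1/2 * \<kappa>" and "b = t0 + 3/4 * \<kappa>" and "q = t0 + \<kappa>"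
    have \<kappa>: "\<kappa> > 0" using \<kappa>1 \<kappa>2 by (simp add: \<kappa>_def)
    have ord: "p < a" "a < a'" "a' < b'" "b' < b" "b < q" "p < a'" "b' < q"
      using \<kappa> by (simp_all add: p_def a_def a'_def b'_def b_def q_def)
    let ?J = "{p<..<q}"
    have Jop: "open ?J" by simp
    have J_ball: "?J \<subseteq> ball t0 \<kappa>" by (auto simp: p_def q_def dist_real_def)
    have JP: "?J \<subseteq> {\<tau> (i - 1)<..<\<tau> i}" "?J \<subseteq> W" "?J \<subseteq> P"
      using J_ball \<kappa>1 by (auto simp: \<kappa>_def P_def subset_iff)
    have JS: "?J \<subseteq> S" using JP PS by blast
    have xJ: "x t \<in> fst c" if "t \<in> ?J" for t using that JP W(2) by blast
    have H_sign: "H t * H t0 > 0" if "t \<in> ?J" for t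
    proof -
      have "t \<in> P" "dist t t0 < \<kappa>2" using that JP J_ball by (auto simp: \<kappa>_def dist_commute subset_iff)
      from \<kappa>2(2)[OF this] have "\<bar>H t - H t0\<bar> < \<bar>H t0\<bar>" by (simp add: dist_real_def)
      then have "0 < H t \<and> 0 < H t0 \<or> H t < 0 \<and> H t0 < 0" using H0 by arith
      then show ?thesis by (simp add: zero_less_mult_iff)
    qed
    obtain \<phi> :: "real \<Rightarrow> real" where \<phi>: "smooth_on \<phi> UNIV" "\<And>t. \<phi> t \<ge> 0" "\<And>t. \<phi> t > 0 \<longleftrightarrow> a' < t \<and> t < b'"
      using bump_function_exists[OF ord(3)] by metis
    have \<phi>_cont: "continuous_on UNIV \<phi>" using \<phi>(1) unfolding smooth_on_def by (blast intro: Ck_on_continuous)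
    have supp: "\<phi> t = 0" if "t \<notin> {a'..b'}" for t
      using \<phi>(2)[of t] \<phi>(3)[of t] that by auto
    have x_smooth: "smooth_map_on std_atlas A x ?J"
      unfolding smooth_map_on_def using Ck_map_on_curve_subset[OF xP JP(3) fat_open[OF Jop]] by blast
    let ?x = "\<lambda>t. snd c (x t)" and ?U = "snd c ` fst c"
    have abJ: "{a'..b'} \<subseteq> ?J" using ord by auto
    have "Ck_on 0 ?x (?J \<inter> x -` fst c)"
      using x_smooth curve_rep(2)[OF _ c(1)] unfolding smooth_map_on_def by blast
    moreover have "?J \<inter> x -` fst c = ?J" using xJ by auto
    ultimately have cxt: "continuous_on ?J ?x" by simp
    then have cxt': "continuous_on {a'..b'} ?x" using abJ continuous_on_subset by blast
    have "compact (?x ` {a'..b'})" by (intro compact_continuous_image cxt') simp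
    moreover have "?x ` {a'..b'} \<subseteq> ?U" using xJ abJ by auto
    ultimately obtain \<delta> where \<delta>: "\<delta> > 0" "(\<Union>z\<in>?x ` {a'..b'}. ball z \<delta>) \<subseteq> ?U"
      using compact_subset_open_imp_ball_epsilon_subset chartD(2)[OF c(1)] by metis
    have "continuous_on {a'..b'} (\<lambda>t. \<phi> t *\<^sub>R frame c (?x t) w)"
      using xJ abJ continuous_on_subset[OF \<phi>_cont]
      by (intro continuous_intros continuous_on_compose2[OF Ck_on_continuous[OF frame_smooth[OF c(1), of 0]] cxt'])
        auto
    then have "compact ((\<lambda>t. \<phi> t *\<^sub>R frame c (?x t) w) ` {a'..b'})" by (rule compact_continuous_image) (rule compact_Icc)
    from compact_imp_bounded[OF this] obtain M
      where M: "M > 0" "\<And>t. t \<in> {a'..b'} \<Longrightarrow> norm (\<phi> t *\<^sub>R frame c (?x t) w) \<le> M"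
      unfolding bounded_pos by blast
    \<comment> \<open>With this bound on \<open>r\<close>, a variation of size at most \<open>M\<close> stays within distance \<open>\<delta>\<close> of the curve.\<close>
    define \<epsilon> where "\<epsilon> = \<delta> / M"
    have \<epsilon>: "\<epsilon> > 0" using \<delta> M by (simp add: \<epsilon>_def)
    have inU: "?x t + r *\<^sub>R \<phi> t *\<^sub>R frame c (?x t) w \<in> ?U" if r: "r \<in> {-\<epsilon><..<\<epsilon>}" and t: "t \<in> ?J" for r t
    proof (cases "t \<in> {a'..b'}")
      case True
      have "norm (r *\<^sub>R \<phi> t *\<^sub>R frame c (?x t) w) = \<bar>r\<bar> * norm (\<phi> t *\<^sub>R frame c (?x t) w)"
        by (rule norm_scaleR)
      also have "\<dots> \<le> \<bar>r\<bar> * M" using M(2)[OF True] by (intro mult_left_mono) auto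
      also have "\<dots> < \<epsilon> * M" using r M(1) by (intro mult_strict_right_mono) auto
      also have "\<dots> = \<delta>" using M(1) by (simp add: \<epsilon>_def)
      finally have "?x t + r *\<^sub>R \<phi> t *\<^sub>R frame c (?x t) w \<in> ball (?x t) \<delta>" by (simp add: dist_norm)
      then show ?thesis using \<delta>(2) True by blast
    next
      case False
      then show ?thesis using supp xJ[OF t] by simp
    qed
    interpret B: bump_variation G I c x p a' b' q \<phi> w \<epsilon>
      by (unfold_locales; (rule c ord xJ x_smooth \<phi>(1) supp \<epsilon> inU; assumption?))
    have Vc: "continuous_on UNIV V" using V by (simp add: Ck_map_on_def)
    have int: "integrand \<sigma> V {0..\<tau> N} x integrable_on {0..\<tau> N}"
      by (rule integrand_integrable[OF x Vc \<tau>0 \<tau>_Suc _ TN]) (use \<tau>_le[of 0] \<tau>_le[of _ N] \<tau>0 in auto)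
    note dc = B.cost_derivative[OF ord(1,2,4,5) JS[unfolded S_def] int V]
    have "\<tau> j \<notin> ?J" if "j \<le> N" for j
    proof -
      have "\<tau> j \<le> \<tau> (i - 1) \<or> \<tau> i \<le> \<tau> j" using \<tau>_le[of j "i - 1"] \<tau>_le[of i j] that i by (cases "j < i") auto
      then show ?thesis using JP(1) by (auto simp: subset_iff)
    qed
    then have "admissible_variation A N \<tau> X v0 vN x B.\<alpha>"
      using B.\<alpha>_admissible[OF x TN _ _ \<tau>0] \<tau>_less by auto
    then have "((\<lambda>r. cost A g \<sigma> V (\<tau> N) (B.\<alpha> r)) has_real_derivative 0) (at 0)"
      using ext by (simp add: extremizer_def)
    note zero = DERIV_unique[OF dc this]
    let ?v = "body_velocity G ?J x"
    let ?v1 = "\<lambda>t. vector_derivative ?v (at t)"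
    let ?v2 = "\<lambda>t. vector_derivative ?v1 (at t)"
    let ?v3 = "\<lambda>t. vector_derivative ?v2 (at t)"
    have D_open: "D f t = vector_derivative h (at t)" if "t \<in> ?J" "\<And>s. s \<in> ?J \<Longrightarrow> f s = h s"
      for f h :: "real \<Rightarrow> 'e" and t
      unfolding D_def at_within_open_subset[OF Jop that(1) JP(3)]
      by (rule vector_derivative_cong_open[OF Jop that(1)]) (use that(2) in auto)
    have e0: "v t = ?v t" if "t \<in> ?J" for t
      unfolding v_def using body_velocity_open[OF Jop that JS] by (simp add: S_def)
    have e1: "D v t = ?v1 t" if "t \<in> ?J" for t using D_open[OF that e0] .
    have e2: "D (D v) t = ?v2 t" if "t \<in> ?J" for t using D_open[OF that e1] .
    have e3: "D (D (D v)) t = ?v3 t" if "t \<in> ?J" for t using D_open[OF that e2] .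
    have abJ': "{a..b} \<subseteq> ?J" using ord by auto
    have "integral {a..b} (\<lambda>t. \<phi> t * H t) = 0"
      unfolding zero[symmetric]
    proof (rule integral_cong)
      fix t assume "t \<in> {a..b}"
      then have t: "t \<in> ?J" using abJ' by blast
      show "\<phi> t * H t = \<phi> t * (I (EL \<sigma> (?v t) (?v1 t) (?v2 t) (?v3 t)) w
        + 1/2 * I (body_gradient V (x t)) w)"
        unfolding H_def e0[OF t] e1[OF t] e2[OF t] e3[OF t] ..
    qed
    then have i0: "integral {a..b} (\<lambda>t. \<phi> t * (H t * H t0)) = 0"
      by (simp flip: mult.assoc)
    have c\<phi>: "continuous_on {a..b} \<phi>"
      by (rule continuous_on_subset[OF \<phi>_cont]) simp
    have "continuous_on {a..b} H" using H_cont abJ' JP(3) continuous_on_subset by blast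
    then have cont: "continuous_on {a..b} (\<lambda>t. \<phi> t * (H t * H t0))"
      using c\<phi> by (intro continuous_intros)
    have "\<phi> t * (H t * H t0) \<ge> 0" if "t \<in> {a..b}" for t
    proof -
      have "t \<in> ?J" using that abJ' by blast
      from H_sign[OF this] \<phi>(2)[of t] show ?thesis by simp
    qed
    then have "\<forall>t\<in>{a..b}. \<phi> t * (H t * H t0) = 0"
      using integral_eq_0_iff[OF cont] i0 ord by simp
    moreover have "t0 \<in> {a..b}" using \<kappa> by (simp add: a_def b_def)
    ultimately have "\<phi> t0 * (H t0 * H t0) = 0" by blast
    moreover have "\<phi> t0 > 0" using \<phi>(3)[of t0] \<kappa> by (simp add: a'_def b'_def)
    ultimately show False using H0 by simp
  qed
qed

text \<open>
  Both terms are continuous on the closed piece after pairing with a fixed vector, so the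
  equation extends from the interior to the end points.
\<close>

lemma euler_lagrange:
  assumes V: "Ck_map_on 2 A std_atlas V UNIV"
    and ext: "extremizer A g \<sigma> V N \<tau> X v0 vN x"
    and \<tau>0: "\<tau> 0 = 0" and \<tau>_Suc: "\<And>i. i < N \<Longrightarrow> \<tau> i < \<tau> (Suc i)"
    and i: "i \<in> {1..N}" and t: "t \<in> {\<tau> (i - 1)..\<tau> i}"
  defines "v \<equiv> body_velocity G {0..\<tau> N} x"
  defines "D \<equiv> \<lambda>f s. vector_derivative f (at s within {\<tau> (i - 1)..\<tau> i})"
  shows "EL \<sigma> (v t) (D v t) (D (D v) t) (D (D (D v)) t)
    + (1/2) *\<^sub>R body_gradient V (x t) = 0"
proof (rule I_eqI)
  fix w
  let ?H = "\<lambda>t. I (EL \<sigma> (v t) (D v t) (D (D v) t) (D (D (D v)) t)) w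
      + 1/2 * I (body_gradient V (x t)) w"
  note H = euler_lagrange_interior[OF V ext \<tau>0 \<tau>_Suc i, where w = w]
  have lt: "\<tau> (i - 1) < \<tau> i" using \<tau>_Suc[of "i - 1"] i by (cases i) auto
  have cl: "closure {\<tau> (i - 1)<..<\<tau> i} = {\<tau> (i - 1)..\<tau> i}" using closure_greaterThanLessThan[OF lt] .
  have mid: "(\<tau> (i - 1) + \<tau> i) / 2 \<in> {\<tau> (i - 1)<..<\<tau> i}" using lt by simp
  have "?H t = 0"
  proof (rule continuous_constant_on_closure[of "{\<tau> (i - 1)<..<\<tau> i}" ?H])
    show "continuous_on (closure {\<tau> (i - 1)<..<\<tau> i}) ?H" unfolding cl v_def D_def by (rule H(1)[OF _ mid])
    show "?H s = 0" if "s \<in> {\<tau> (i - 1)<..<\<tau> i}" for s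
      unfolding v_def D_def by (rule H(2)[OF _ that])
    show "t \<in> closure {\<tau> (i - 1)<..<\<tau> i}" unfolding cl by (rule t)
  qed
  then show "I (EL \<sigma> (v t) (D v t) (D (D v) t) (D (D (D v)) t)
    + (1/2) *\<^sub>R body_gradient V (x t)) w = I 0 w"
    by (simp add: I_simps)
qed

lemma velocity_body: "velocity A S x t = T_left G (x t) \<one>\<^bsub>G\<^esub> (body_velocity G S x t)"
  using T_left_compose[of "x t" "iv (x t)" "x t"] T_left_one by (simp add: body_velocity_def)

end

theorem corollary3p5:
  fixes G :: "('g::{t2_space, second_countable_topology}, 'e::euclidean_space) lie_group_structure"
    and I :: "'e \<Rightarrow> 'e \<Rightarrow> real"
    and e :: "nat \<Rightarrow> 'e"
    and \<sigma> :: real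
    and V :: "'g \<Rightarrow> real"
    and S :: "'g set"
    and N :: nat
    and X :: "nat \<Rightarrow> 'g"
    and \<tau> :: "nat \<Rightarrow> real"
    and v0 vN :: 'e
    and x :: "real \<Rightarrow> 'g"
    and v :: "real \<Rightarrow> 'e"
    and vi :: "nat \<Rightarrow> real \<Rightarrow> real"
  assumes "lie_group G"
    and "inner_product I"
    and "inj_on e {1..DIM('e)}" and "independent (e ` {1..DIM('e)})"
    and "span (e ` {1..DIM('e)}) = UNIV"
    and "\<sigma> > 0"
    and "Ck_map_on 2 (atlas G) std_atlas V UNIV"
    and "regular_submanifold (atlas G) S"
    and "inj_on X {0..N}" and "\<And>i. i \<in> {0..N} \<Longrightarrow> X i \<notin> S"
    and "N \<ge> 1" and "\<tau> 0 = 0" and "\<And>i. i < N \<Longrightarrow> \<tau> i < \<tau> (Suc i)"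
    and "extremizer (atlas G) (left_invariant_metric G I) \<sigma> V N \<tau> X v0 vN x"
    and "v = body_velocity G {0..\<tau> N} x"
    and "\<And>t. t \<in> {0..\<tau> N} \<Longrightarrow> v t = (\<Sum>i=1..DIM('e). vi i t *\<^sub>R e i)"
  shows
    "(\<forall>i\<in>{1..N}. \<forall>t\<in>{\<tau> (i - 1)..\<tau> i}.
        (let nab = lie_algebra_connection G I;
             R = lie_algebra_curvature G I;
             D = (\<lambda>w s. vector_derivative w (at s within {\<tau> (i - 1)..\<tau> i}));
             u = v t; u' = D v t; u'' = D (D v) t; u''' = D (D (D v)) t
         in 0 = u''' + nab u'' u + 3 *\<^sub>R nab u' u' + 3 *\<^sub>R nab u u'' + nab u' (nab u u)
              + 2 *\<^sub>R nab u (nab u' u) + 3 *\<^sub>R nab u (nab u u') + nab u (nab u (nab u u))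
              + R u' u u + R (nab u u) u u - \<sigma> *\<^sub>R nab u u - \<sigma> *\<^sub>R u'
              + (1/2) *\<^sub>R T_left G (inv\<^bsub>G\<^esub> (x t)) (x t)
                  (gradient (atlas G) (left_invariant_metric G I) V (x t)))
        \<and> velocity (atlas G) {0..\<tau> N} x t = T_left G (x t) \<one>\<^bsub>G\<^esub> (v t)
        \<and> T_left G (x t) \<one>\<^bsub>G\<^esub> (v t) = (\<Sum>j=1..DIM('e). vi j t *\<^sub>R left_invariant_field G (e j) (x t)))
     \<and> (\<forall>i\<in>{1..<N}. x (\<tau> i) = X i) \<and> x 0 = X 0 \<and> x (\<tau> N) = X N
     \<and> v 0 = T_left G (inv\<^bsub>G\<^esub> (X 0)) (X 0) v0
     \<and> v (\<tau> N) = T_left G (inv\<^bsub>G\<^esub> (X N)) (X N) vN"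
proof -
  interpret riemannian_lie_group G I
    by (rule riemannian_lie_group.intro[OF lie_group_loc.intro[OF assms(1)] riemannian_lie_group_axioms.intro[OF assms(2)]])
  note ext = assms(14)
  have x: "x \<in> admissible_curves (atlas G) N \<tau> X v0 vN" using ext by (simp add: extremizer_def)
  have v: "v = body_velocity G {0..\<tau> N} x" by (rule assms(15))
  have le: "\<tau> j \<le> \<tau> k" if "j \<le> k" "k \<le> N" for j k
    using that
  proof (induction k)
    case (Suc k)
    then show ?case using assms(13)[of k] by (cases "j = Suc k") auto
  qed simp
  have EL: "EL \<sigma> (v t) (vector_derivative v (at t within {\<tau> (i - 1)..\<tau> i}))
        (vector_derivative (\<lambda>s. vector_derivative v (at s within {\<tau> (i - 1)..\<tau> i})) (at t within {\<tau> (i - 1)..\<tau> i}))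
        (vector_derivative (\<lambda>s. vector_derivative (\<lambda>s. vector_derivative v (at s within {\<tau> (i - 1)..\<tau> i}))
          (at s within {\<tau> (i - 1)..\<tau> i})) (at t within {\<tau> (i - 1)..\<tau> i}))
      + (1/2) *\<^sub>R T_left G (inv\<^bsub>G\<^esub> (x t)) (x t) (gradient (atlas G) (left_invariant_metric G I) V (x t)) = 0"
    if "i \<in> {1..N}" "t \<in> {\<tau> (i - 1)..\<tau> i}" for i t
    unfolding v by (rule euler_lagrange[OF assms(7) ext assms(12,13) that])
  have vel: "velocity (atlas G) {0..\<tau> N} x t = T_left G (x t) \<one>\<^bsub>G\<^esub> (v t)" for t
    unfolding v by (rule velocity_body)
  have expand: "T_left G (x t) \<one>\<^bsub>G\<^esub> (v t) = (\<Sum>j=1..DIM('e). vi j t *\<^sub>R left_invariant_field G (e j) (x t))"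
    if "i \<in> {1..N}" "t \<in> {\<tau> (i - 1)..\<tau> i}" for i t
  proof -
    have "t \<in> {0..\<tau> N}" using that le[of 0 "i - 1"] le[of i N] assms(12) by (cases i) auto
    from assms(16)[OF this] show ?thesis
      by (simp add: left_invariant_field_def linear_sum[OF T_left_linear] linear_scale[OF T_left_linear])
  qed
  have bc: "v s = T_left G (inv\<^bsub>G\<^esub> (x s)) (x s) (velocity (atlas G) {0..\<tau> N} x s)" for s
    unfolding v body_velocity_def ..
  show ?thesis
    unfolding Let_def lie_algebra_connection_eq lie_algebra_curvature_eq
    using EL vel expand bc[of 0] bc[of "\<tau> N"] x
    by (auto simp: EL_def admissible_curves_def)
qed

end
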